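(* Let $n\ge1$. Let, for every prime power $p^v$, a subset $A_{p^v}\subset(\mathbf{Z}/p^v\mathbf{Z})^n$ be given (possibly empty). Suppose there are constants $\alpha>0$, $x_0\ge2$ with $\sum_{p\le y,\ \rho(p)\ge1}\log p\ge\alpha y$ for all $y\ge x_0$. Let $x$ be sufficiently large in terms of $x_0$ and $\alpha$, and suppose $0<\delta\le1$ satisfies $$\sum_{\substack{p\le x\\ p\in\mathcal{Q}}}\Big(1-\frac{\lambda(p)}{\rho(p)}\Big)\frac1p\ge\delta\log\log x.$$ Then uniformly for integers $k$ with $$\frac{20(6+n)}{\delta}\log\Big(\frac{20(6+n)}{\delta}\Big)\le k\le\exp\Big(\sqrt{\frac{\alpha\delta\log\log x}{20(6+n)}}\Big)$$ we have $$\frac{1}{|\mathcal{Q}_k(x)|}\sum_{q\in\mathcal{Q}_k(x)}\operatorname{disc}(\Delta_q)\ll\frac1\alpha\Big(e^{-\delta k/18}+(\log x)^{-\alpha\delta/18}\Big),$$ where the implied constant depends only on $n$.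
   Context: For $q\ge1$, $A_q\subset(\mathbf{Z}/q\mathbf{Z})^n$ is the set of $x\bmod q$ with $x\bmod p^v\in A_{p^v}$ for every prime power $p^v$ exactly dividing $q$; $\rho(q)=|A_q|$ (multiplicative, $\rho(1)=1$). $\mathcal{Q}=\{q\ge1:\rho(q)\ge1\}$; $\mathcal{Q}_k$ is the set of elements of $\mathcal{Q}$ with exactly $k$ distinct prime factors, $\mathcal{Q}_k(x)=\{q\in\mathcal{Q}_k:q\le x\}$. For a prime $p\in\mathcal{Q}$, $\lambda(p)=\max_H|H\cap A_p|$ over affine hyperplanes $H=\{x\in(\mathbf{Z}/p\mathbf{Z})^n:h\cdot x=a\}$, $h\ne0$. $\Delta_q=\frac1{\rho(q)}\sum_{a\in A_q}\delta_{\{a/q\}}$ on $(\mathbf{R}/\mathbf{Z})^n$ (coordinatewise fractional parts), and $\operatorname{disc}(\Delta_q)=\sup_B|\Delta_q(B)-\operatorname{vol}(B)|$ over boxes $B$ of $(\mathbf{R}/\mathbf{Z})^n$ (projections of products of closed intervals with side lengths $\le1$). *)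

theory Defs
  imports "HOL-Analysis.Analysis"
begin

text \<open>
  Elements of \<open>(\<int>/q\<int>)\<^sup>n\<close> are represented by their reduced representatives: extensional functions
  on \<open>{..<n}\<close> with values in \<open>{..<q}\<close>.  Similarly \<open>(\<real>/\<int>)\<^sup>n\<close> is represented by the fundamental
  domain \<open>[0,1)\<^sup>n\<close>, so that the projection from \<open>\<real>\<^sup>n\<close> is the coordinatewise fractional part.
\<close>

definition residue_vecs :: "nat \<Rightarrow> nat \<Rightarrow> (nat \<Rightarrow> nat) set" where
  "residue_vecs n q = {..<n} \<rightarrow>\<^sub>E {..<q}"

definition reduce_vec :: "nat \<Rightarrow> nat \<Rightarrow> (nat \<Rightarrow> nat) \<Rightarrow> (nat \<Rightarrow> nat)" where
  "reduce_vec n m x = (\<lambda>i\<in>{..<n}. x i mod m)"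

text \<open>
  The given data is \<open>A\<close>, of which only the values \<open>A (p ^ v)\<close> at prime powers with \<open>v \<ge> 1\<close>
  are ever used.
\<close>

definition prime_power_family :: "nat \<Rightarrow> (nat \<Rightarrow> (nat \<Rightarrow> nat) set) \<Rightarrow> bool" where
  "prime_power_family n A \<longleftrightarrow>
     (\<forall>p v. prime p \<longrightarrow> 1 \<le> v \<longrightarrow> A (p ^ v) \<subseteq> residue_vecs n (p ^ v))"

definition crt_set :: "nat \<Rightarrow> (nat \<Rightarrow> (nat \<Rightarrow> nat) set) \<Rightarrow> nat \<Rightarrow> (nat \<Rightarrow> nat) set" where
  "crt_set n A q =
     {x \<in> residue_vecs n q. \<forall>p \<in> prime_factors q.
        reduce_vec n (p ^ multiplicity p q) x \<in> A (p ^ multiplicity p q)}"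

definition rho :: "nat \<Rightarrow> (nat \<Rightarrow> (nat \<Rightarrow> nat) set) \<Rightarrow> nat \<Rightarrow> nat" where
  "rho n A q = card (crt_set n A q)"

definition Q_set :: "nat \<Rightarrow> (nat \<Rightarrow> (nat \<Rightarrow> nat) set) \<Rightarrow> nat set" where
  "Q_set n A = {q. 1 \<le> q \<and> 1 \<le> rho n A q}"

definition Q_k :: "nat \<Rightarrow> (nat \<Rightarrow> (nat \<Rightarrow> nat) set) \<Rightarrow> nat \<Rightarrow> nat set" where
  "Q_k n A k = {q \<in> Q_set n A. card (prime_factors q) = k}"

definition Q_k_upto :: "nat \<Rightarrow> (nat \<Rightarrow> (nat \<Rightarrow> nat) set) \<Rightarrow> nat \<Rightarrow> real \<Rightarrow> nat set" where
  "Q_k_upto n A k x = {q \<in> Q_k n A k. real q \<le> x}"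

definition affine_hyperplanes :: "nat \<Rightarrow> nat \<Rightarrow> (nat \<Rightarrow> nat) set set" where
  "affine_hyperplanes n p =
     {{x \<in> residue_vecs n p. (\<Sum>i<n. h i * x i) mod p = a} | h a.
        h \<in> residue_vecs n p \<and> (\<exists>i<n. h i \<noteq> 0) \<and> a < p}"

definition lam :: "nat \<Rightarrow> (nat \<Rightarrow> (nat \<Rightarrow> nat) set) \<Rightarrow> nat \<Rightarrow> nat" where
  "lam n A p = Max ((\<lambda>H. card (H \<inter> crt_set n A p)) ` affine_hyperplanes n p)"

definition torus_proj :: "nat \<Rightarrow> (nat \<Rightarrow> real) \<Rightarrow> (nat \<Rightarrow> real)" where
  "torus_proj n x = (\<lambda>i\<in>{..<n}. frac (x i))"

definition torus_boxes :: "nat \<Rightarrow> (nat \<Rightarrow> real) set set" where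
  "torus_boxes n =
     {torus_proj n ` (\<Pi>\<^sub>E i\<in>{..<n}. {a i..b i}) | a b.
        \<forall>i<n. a i \<le> b i \<and> b i - a i \<le> 1}"

text \<open>
  On subsets of the fundamental domain, the normalised Haar measure of the torus is
  \<open>n\<close>-dimensional Lebesgue measure.
\<close>

definition torus_vol :: "nat \<Rightarrow> (nat \<Rightarrow> real) set \<Rightarrow> real" where
  "torus_vol n B = measure (\<Pi>\<^sub>M i\<in>{..<n}. lborel) B"

definition Delta :: "nat \<Rightarrow> (nat \<Rightarrow> (nat \<Rightarrow> nat) set) \<Rightarrow> nat \<Rightarrow> (nat \<Rightarrow> real) set \<Rightarrow> real" where
  "Delta n A q B =
     1 / real (rho n A q) *
       (\<Sum>a\<in>crt_set n A q. indicator B (torus_proj n (\<lambda>i. real (a i) / real q)))"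

definition disc :: "nat \<Rightarrow> ((nat \<Rightarrow> real) set \<Rightarrow> real) \<Rightarrow> real" where
  "disc n \<mu> = (SUP B\<in>torus_boxes n. \<bar>\<mu> B - torus_vol n B\<bar>)"

end

theory Submission
  imports Defs "HOL-Number_Theory.Cong" "HOL-Computational_Algebra.Squarefree"
begin

text \<open>
  Discrepancy is bounded by Weyl sums \<open>W\<^sub>q(h) = \<rho>(q)\<^sup>-\<^sup>1 \<Sum>\<^bsub>a \<in> A\<^sub>q\<^esub> e(h \<cdot> a / q)\<close>, so it suffices to average
  \<open>|W\<^sub>q(h)|\<close> over \<open>q \<in> Q\<^sub>k(x)\<close> for each fixed small \<open>h \<noteq> 0\<close>.  With \<open>z = x\<^bsup>1/2k\<^esup>\<close> and
  \<open>y = x\<^bsup>1/32k\<^sup>2\<^esup>\<close>, all but a negligible number of \<open>q\<close> factor as \<open>q = u w P\<close>, where \<open>u\<close> is the part of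
  \<open>q\<close> composed of primes up to \<open>y\<close>, \<open>P \<ge> z\<close> is prime, and \<open>w\<close> is squarefree.  By the Chinese
  remainder theorem \<open>|W\<^sub>q(h)|\<close> is at most \<open>|W\<^sub>u|\<close> at a frequency determined by \<open>P mod u\<close>.  Summing over
  \<open>P\<close> with the Brun--Titchmarsh inequality replaces this by a mean over all frequencies modulo
  \<open>u\<close>, which is at most the product of \<open>(\<lambda>(p)/\<rho>(p))\<^bsup>1/2\<^esup>\<close> over the primes \<open>p \<parallel> u\<close> not dividing \<open>h\<close>.
  The sums over \<open>u\<close> with a given number of prime factors are bounded by powers of \<open>\<Sum> 1/p\<close>, and
  the same decomposition bounds \<open>|Q\<^sub>k(x)|\<close> from below with the same sums over \<open>w\<close>.  The comparison
  saves a factor \<open>exp (- c \<delta> k)\<close> at the cost of a power of \<open>k\<close>, which the range of \<open>k\<close> absorbs.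
\<close>

section \<open>Chebyshev and Mertens type bounds for primes\<close>

text \<open>An individual Weyl sum need not be small: the cancellation comes from letting
  \<open>P\<close> run over primes, so \<open>u\<close> must be far below the range left for
  \<open>P\<close>. This fixes the sizes. Apart from those with a large square factor, moduli
  without a prime factor above \<open>z\<close> are at most \<open>z^k = sqrt x\<close>, while
  \<open>u \<le> y^k = z^(1/16)\<close> keeps the sieve remainder below the main term. The
  comparison costs \<open>k^3\<close>: one factor from the crude bound for
  \<open>u / phi(u)\<close>, one from \<open>ln x / ln z = 2 k\<close>, one because the lower bound
  may count a modulus once for each prime factor. The lower limit for \<open>k\<close> gives
  \<open>ln k \<le> \<delta> k / 70\<close>, which absorbs \<open>k^3\<close>; the upper limit makes
  the sum of \<open>1 / p\<close> over \<open>(y, x]\<close>, about \<open>2 ln k\<close>, small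
  against \<open>\<alpha> \<delta> ln ln x\<close>. The Weyl averages then save
  \<open>exp (- \<delta> k / 6)\<close>. With cut-off \<open>H\<close> near
  \<open>exp (\<delta> k / 6)\<close> and smoothing width \<open>\<eta>\<close> near
  \<open>H^(-1/2)\<close>, the discrepancy is of order \<open>\<eta>\<close> times a power of
  \<open>ln H\<close>; conceding \<open>exp (\<delta> k / 36)\<close> to that power leaves the
  exponent \<open>1/12 - 1/36 = 1/18\<close>.\<close>

definition theta :: "nat \<Rightarrow> real" where
  "theta N = (\<Sum>p | prime p \<and> p \<le> N. ln (real p))"

lemma finite_primes_le [simp]: "finite {p::nat. prime p \<and> p \<le> N}"
  by (rule finite_subset[of _ "{..N}"]) auto

lemma prod_primes_dvd:
  fixes m :: nat
  assumes "finite T" "\<And>p. p \<in> T \<Longrightarrow> prime p \<and> p dvd m"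
  shows "\<Prod>T dvd m"
  using assms
proof (induction T rule: finite_induct)
  case (insert p T)
  have "coprime p (\<Prod>T)"
    using insert by (intro prod_coprime_right) (metis insertI1 insertI2 primes_coprime)
  then show ?case
    using insert by (auto intro: divides_mult)
qed simp

lemma prod_primes_pos: "finite T \<Longrightarrow> (\<And>p. p \<in> T \<Longrightarrow> prime (p::nat)) \<Longrightarrow> 0 < \<Prod>T"
  by (meson prime_gt_0_nat prod_pos)

lemma sum_ln_primes_le:
  fixes m :: nat
  assumes "finite T" "\<And>p. p \<in> T \<Longrightarrow> prime p \<and> p dvd m" "m > 0"
  shows "(\<Sum>p\<in>T. ln (real p)) \<le> ln (real m)"
proof -
  have "(\<Sum>p\<in>T. ln (real p)) = ln (\<Prod>p\<in>T. real p)"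
    using assms by (intro ln_prod[symmetric]) (auto simp: prime_gt_0_nat)
  also have "(\<Prod>p\<in>T. real p) = real (\<Prod>T)" by simp
  also have "ln (real (\<Prod>T)) \<le> ln (real m)"
    using prod_primes_dvd[OF assms(1,2)] assms prod_primes_pos[OF assms(1)] dvd_imp_le
    by (subst ln_le_cancel_iff) (auto simp del: of_nat_prod)
  finally show ?thesis .
qed

text \<open>Chebyshev's argument: a prime in \<open>(N, 2N]\<close> divides \<open>(2N)!\<close> but
  not \<open>N!\<close>, hence the central binomial coefficient, which is at most
  \<open>4^N\<close>.\<close>

lemma theta_double: "theta (2 * N) - theta N \<le> real N * ln 4"
proof (cases "N = 0")
  case False
  have "theta (2 * N) - theta N = (\<Sum>p\<in>{p. prime p \<and> p \<le> 2*N} - {p. prime p \<and> p \<le> N}. ln (real p))"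
    unfolding theta_def by (subst sum_diff) auto
  also have "\<dots> \<le> ln (real ((2*N) choose N))"
  proof (rule sum_ln_primes_le)
    fix p assume p: "p \<in> {p. prime p \<and> p \<le> 2*N} - {p. prime p \<and> p \<le> N}"
    have "p dvd fact (2*N)" using p by (simp add: prime_dvd_fact_iff)
    also have "fact (2*N) = fact N * fact N * ((2*N) choose N)"
      using binomial_fact_lemma[of N "2*N"] by (simp add: mult_2)
    finally have "p dvd fact N * fact N * ((2*N) choose N)" .
    moreover have "\<not> p dvd fact N" using p by (auto simp: prime_dvd_fact_iff)
    ultimately show "prime p \<and> p dvd ((2*N) choose N)"
      using p by (auto simp: prime_dvd_mult_iff)
  qed auto
  also have "\<dots> \<le> ln (4 ^ N)"
    using binomial_le_pow2[of "2*N" N] False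
    by (subst ln_le_cancel_iff) (auto simp: power_mult simp flip: of_nat_le_iff)
  also have "\<dots> = real N * ln 4" by (simp add: ln_realpow)
  finally show ?thesis .
qed simp

text \<open>Induction by halving. In the odd case the target exceeds \<open>3 * K * ln 4\<close> by
  \<open>K * ln 4 + 2 * ln 4\<close>, which pays for the possible extra prime
  \<open>2 * K + 1\<close>.\<close>

lemma theta_le: "theta N \<le> 2 * ln 4 * real N"
proof (induction N rule: less_induct)
  case (less N)
  show ?case
  proof (cases "N \<le> 1")
    case True
    have "{p. prime p \<and> p \<le> N} = {}"
      using True by (auto dest: prime_gt_1_nat)
    then show ?thesis by (simp add: theta_def del: Collect_empty_eq)
  next
    case False
    define M where "M = (N + 1) div 2"
    have M: "M < N" "N \<le> 2 * M" "2 * M \<le> N + 1" using False by (auto simp: M_def)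
    show ?thesis
    proof (cases "even N")
      case True
      then have N: "N = 2 * M" by (auto simp: M_def)
      define L where "L = real M * ln 4"
      have "theta (2 * M) - theta M \<le> L" "theta M \<le> 2 * L" "0 \<le> L"
        using theta_double[of M] less.IH[OF M(1)] by (simp_all add: L_def mult_ac)
      then have "theta (2 * M) \<le> 4 * L" by linarith
      then show ?thesis unfolding N L_def by (simp add: mult_ac)
    next
      case odd: False
      then obtain K where N: "N = 2 * K + 1" by (auto elim: oddE)
      have KN: "K < N" using False N by auto
      have "theta N \<le> theta (2 * K) + ln N"
      proof -
        have "{p. prime p \<and> p \<le> N} \<subseteq> insert N {p. prime p \<and> p \<le> 2 * K}" by (auto simp: N)
        then have "theta N \<le> (\<Sum>p\<in>insert N {p. prime p \<and> p \<le> 2 * K}. ln (real p))"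
          unfolding theta_def using False by (intro sum_mono2) (auto simp: Suc_le_eq prime_gt_0_nat)
        also have "\<dots> = theta (2 * K) + ln N" by (subst sum.insert) (auto simp: theta_def N)
        finally show ?thesis .
      qed
      also have "theta (2 * K) \<le> 3 * (real K * ln 4)"
      proof -
        define L where "L = real K * ln 4"
        have "theta (2 * K) - theta K \<le> L" "theta K \<le> 2 * L"
          using theta_double[of K] less.IH[OF KN] by (simp_all add: L_def mult_ac)
        then show ?thesis unfolding L_def by linarith
      qed
      also have "ln (real N) \<le> ln 4 * K + 2 * ln 4"
      proof -
        have "ln (real N) \<le> ln (4 ^ (K+2))"
        proof (subst ln_le_cancel_iff)
          have "2 * K + 1 \<le> 4 ^ (K+2)" by (induction K) auto
          then have "real (2 * K + 1) \<le> real (4 ^ (K+2))" by (simp only: of_nat_le_iff)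
          then show "real N \<le> 4 ^ (K+2)" unfolding N by (simp only: of_nat_power of_nat_numeral)
        qed (use False in simp_all)
        also have "\<dots> = real (K+2) * ln 4" by (rule ln_realpow)
        finally show ?thesis by (simp add: algebra_simps)
      qed
      finally show ?thesis unfolding N by (simp add: algebra_simps)
    qed
  qed
qed

lemma ln4_le: "ln (4::real) \<le> 3/2"
proof -
  have "(4::real) \<le> exp (3/2)"
  proof -
    have "(4::real) \<le> 1 + 3/2 + (3/2)^2/2 + (3/2)^3/6" by (simp add: power2_eq_square power3_eq_cube)
    also have "\<dots> = (\<Sum>i<4. (3/2)^i /\<^sub>R fact i)"
      by (simp add: eval_nat_numeral)
    also have "\<dots> \<le> exp (3/2)" unfolding exp_def
      by (intro sum_le_suminf summable_exp_generic) auto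
    finally show ?thesis .
  qed
  then show ?thesis by (metis ln_exp ln_le_cancel_iff exp_gt_zero zero_less_numeral)
qed

lemma theta_le3: "theta N \<le> 3 * real N"
proof -
  have "2 * ln 4 * real N \<le> 3 * real N" using ln4_le by (intro mult_right_mono) auto
  with theta_le[of N] show ?thesis by linarith
qed

lemma card_multiples: "card {m. 1 \<le> m \<and> m \<le> N \<and> d dvd m} = N div d" if "d > 0" for d N :: nat
proof -
  have "{m. 1 \<le> m \<and> m \<le> N \<and> d dvd m} = (\<lambda>i. d * i) ` {1..N div d}"
  proof (intro equalityI subsetI)
    fix m assume "m \<in> {m. 1 \<le> m \<and> m \<le> N \<and> d dvd m}"
    then obtain i where "m = d * i" "1 \<le> m" "m \<le> N" by (auto elim: dvdE)
    then show "m \<in> (\<lambda>i. d * i) ` {1..N div d}" using that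
      by (auto simp: less_eq_div_iff_mult_less_eq mult.commute intro!: imageI)
  next
    fix m assume "m \<in> (\<lambda>i. d * i) ` {1..N div d}"
    then show "m \<in> {m. 1 \<le> m \<and> m \<le> N \<and> d dvd m}" using that
      by (auto simp: less_eq_div_iff_mult_less_eq mult.commute)
  qed
  then show ?thesis using that by (simp add: card_image inj_on_def)
qed

text \<open>Mertens' first theorem from above, by double counting: the logarithms of the primes
  dividing \<open>m\<close> add up to at most \<open>ln m\<close>, and rounding \<open>N / p\<close>
  down to \<open>N div p\<close> costs at most \<open>theta N \<le> 3 * N\<close>.\<close>

lemma sum_ln_div_primes:
  assumes "N \<ge> 1"
  shows "(\<Sum>p | prime p \<and> p \<le> N. ln (real p) / real p) \<le> ln (real N) + 3"
proof -
  let ?P = "{p. prime p \<and> p \<le> N}"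
  have pos: "0 \<le> ln (real p)" if "p \<in> ?P" for p using that by (auto simp: Suc_le_eq prime_gt_0_nat)
  have "(\<Sum>p\<in>?P. ln (real p) * (real N / real p - 1)) \<le> (\<Sum>p\<in>?P. ln (real p) * real (N div p))"
  proof (intro sum_mono mult_left_mono pos)
    fix p assume p: "p \<in> ?P"
    then have "p > 0" by (auto simp: prime_gt_0_nat)
    have "real N = real (N div p) * real p + real (N mod p)"
      by (metis div_mult_mod_eq of_nat_add of_nat_mult)
    also have "\<dots> \<le> (real (N div p) + 1) * real p"
      using mod_less_divisor[OF \<open>p > 0\<close>, of N] by (simp add: algebra_simps less_imp_le)
    finally show "real N / real p - 1 \<le> real (N div p)" using \<open>p > 0\<close> by (simp add: field_simps)
  qed
  also have "\<dots> = (\<Sum>p\<in>?P. \<Sum>m\<in>{m. 1 \<le> m \<and> m \<le> N \<and> p dvd m}. ln (real p))"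
    by (intro sum.cong refl) (use card_multiples prime_gt_0_nat in auto)
  also have "\<dots> = (\<Sum>p\<in>?P. \<Sum>m\<in>{m\<in>{1..N}. p dvd m}. ln (real p))"
    by (intro sum.cong refl) auto
  also have "\<dots> = (\<Sum>m\<in>{1..N}. \<Sum>p\<in>{p\<in>?P. p dvd m}. ln (real p))"
    by (rule sum.swap_restrict) auto
  also have "\<dots> \<le> (\<Sum>m\<in>{1..N}. ln (real m))"
    by (intro sum_mono sum_ln_primes_le) auto
  also have "\<dots> \<le> (\<Sum>m\<in>{1..N}. ln (real N))" by (intro sum_mono) auto
  also have "\<dots> = real N * ln (real N)" by simp
  finally have "(\<Sum>p\<in>?P. ln (real p) * (real N / real p - 1)) \<le> real N * ln (real N)" .
  moreover have "(\<Sum>p\<in>?P. ln (real p) * (real N / real p - 1)) = real N * (\<Sum>p\<in>?P. ln (real p) / real p) - theta N"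
    unfolding theta_def by (simp add: sum_distrib_left sum_subtractf algebra_simps)
  ultimately have "real N * (\<Sum>p\<in>?P. ln (real p) / real p) \<le> real N * ln (real N) + 3 * real N"
    using theta_le3[of N] by linarith
  then have "real N * (\<Sum>p\<in>?P. ln (real p) / real p) \<le> real N * (ln (real N) + 3)"
    by (simp add: algebra_simps)
  then show ?thesis using assms by simp
qed

section \<open>Partial summation: sums of reciprocals of primes\<close>

text \<open>This and \<open>ln_ln_step\<close> bound increments of \<open>ln ln\<close> through
  \<open>ln t \<le> t - 1\<close>. They take the place of the integral of
  \<open>1 / (t ln t)\<close> in the partial summations below.\<close>

lemma ln_ln_diff:
  assumes "1 < a" "a \<le> (b::real)"
  shows "(ln b - ln a) / ln b \<le> ln (ln b) - ln (ln a)"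
proof -
  have l: "0 < ln a" "0 < ln b" using assms by auto
  have "ln (ln a / ln b) \<le> ln a / ln b - 1" using l by (intro ln_le_minus_one) auto
  then show ?thesis using l by (simp add: ln_div diff_divide_distrib)
qed

lemma ln_ln_step: assumes "2 \<le> (m::nat)" shows "ln (ln (real m + 1)) - ln (ln (real m)) \<le> 1 / (real m * ln (real m))"
proof -
  have l: "0 < ln (real m)" "0 < ln (real m + 1)" using assms by auto
  have "ln (ln (real m + 1) / ln (real m)) \<le> ln (real m + 1) / ln (real m) - 1" using l by (intro ln_le_minus_one) auto
  then have "ln (ln (real m + 1)) - ln (ln (real m)) \<le> (ln (real m + 1) - ln (real m)) / ln (real m)"
    using l by (simp add: ln_div diff_divide_distrib)
  also have "ln (real m + 1) - ln (real m) \<le> 1 / real m"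
  proof -
    have "ln ((real m + 1) / real m) \<le> (real m + 1) / real m - 1"
      using assms by (intro ln_le_minus_one) auto
    also have "\<dots> = 1 / real m" using assms by (simp add: field_simps)
    finally show ?thesis using assms by (simp add: ln_div)
  qed
  finally show ?thesis using l by (simp add: divide_right_mono)
qed

lemma primes_between_Suc:
  "{p. prime p \<and> y < p \<and> p \<le> Suc N} =
     (if prime (Suc N) \<and> y < Suc N then insert (Suc N) {p. prime p \<and> y < p \<and> p \<le> N}
      else {p. prime p \<and> y < p \<and> p \<le> N})"
  using le_Suc_eq by auto

lemma finite_primes_between [simp]: "finite {p::nat. prime p \<and> y < p \<and> p \<le> N}"
  by (rule finite_subset[of _ "{..N}"]) auto

lemma sum_inverse_primes_le:
  fixes y N :: nat
  assumes "2 \<le> y" "y \<le> N"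
  shows "(\<Sum>p | prime p \<and> y < p \<and> p \<le> N. 1 / real p) \<le> ln (ln N) - ln (ln y) + 1 + 3 / ln y"
proof -
  define M where "M = (\<lambda>N. \<Sum>p | prime p \<and> y < p \<and> p \<le> N. ln (real p) / real p)"
  have M: "M m \<le> ln m + 3" if "m \<ge> 1" for m
  proof -
    have "M m \<le> (\<Sum>p | prime p \<and> p \<le> m. ln (real p) / real p)"
      unfolding M_def by (intro sum_mono2) (auto simp: Suc_le_eq prime_gt_0_nat)
    with sum_ln_div_primes[OF that] show ?thesis by linarith
  qed
  \<comment> \<open>Abel summation written as an induction: the boundary term
    \<open>M N / ln N\<close> is carried along, and a step only needs
    \<open>M N \<le> ln N + 3\<close> against the decrease of \<open>1 / ln\<close>.\<close>
  have "(\<Sum>p | prime p \<and> y < p \<and> p \<le> N. 1 / real p) \<le> M N / ln N + (ln (ln N) - ln (ln y)) + 3 * (1 / ln y - 1 / ln N)"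
    using assms(2)
  proof (induction N rule: dec_induct)
    case base
    have "{p. prime p \<and> y < p \<and> p \<le> y} = {}" by auto
    then show ?case by (simp add: M_def del: Collect_empty_eq)
  next
    case (step N)
    have lN: "0 < ln (real N)" "0 < ln (real (Suc N))" "ln (real N) \<le> ln (real (Suc N))"
      using step assms by auto
    have e1: "(\<Sum>p | prime p \<and> y < p \<and> p \<le> Suc N. 1 / real p) =
      (\<Sum>p | prime p \<and> y < p \<and> p \<le> N. 1 / real p) + (if prime (Suc N) then 1 / real (Suc N) else 0)"
      using step by (auto simp: primes_between_Suc)
    have e2: "M (Suc N) = M N + (if prime (Suc N) then ln (real (Suc N)) / real (Suc N) else 0)"
      unfolding M_def using step by (auto simp: primes_between_Suc)
    have e3: "M (Suc N) / ln (Suc N) = M N / ln (Suc N) + (if prime (Suc N) then 1 / real (Suc N) else 0)"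
      unfolding e2 using lN by (simp add: add_divide_distrib)
    have "M N / ln N - M N / ln (Suc N) = M N * (1 / ln N - 1 / ln (Suc N))" by (simp add: algebra_simps)
    also have "\<dots> \<le> (ln N + 3) * (1 / ln N - 1 / ln (Suc N))"
      using lN M[of N] step assms by (intro mult_right_mono) (auto simp: frac_le)
    also have "\<dots> = (ln (Suc N) - ln N) / ln (Suc N) + 3 * (1 / ln N - 1 / ln (Suc N))"
      using lN by (simp add: field_simps)
    also have "(ln (Suc N) - ln N) / ln (Suc N) \<le> ln (ln (Suc N)) - ln (ln N)"
      using step assms by (intro ln_ln_diff) auto
    finally show ?case using step.IH unfolding e1 e3 by (simp add: algebra_simps)
  qed
  also have "M N / ln N \<le> (ln N + 3) / ln N" using M[of N] assms by (intro divide_right_mono) auto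
  also have "\<dots> = 1 + 3 / ln N" using assms by (simp add: add_divide_distrib)
  finally show ?thesis by (simp add: algebra_simps)
qed

text \<open>Abel summation from below, for a set of primes of which only a Chebyshev bound is known.
  The weight \<open>w m = 1 / (m ln m)\<close> is made so that
  \<open>ln p * w p = 1 / p\<close>.\<close>

lemma sum_inverse_primes_ge:
  fixes R :: "nat set" and m0 N :: nat
  assumes R: "\<And>p. p \<in> R \<Longrightarrow> prime p" and "0 < \<alpha>" "2 \<le> m0" "m0 \<le> N"
    and th: "\<And>m. m0 \<le> m \<Longrightarrow> \<alpha> * real m \<le> (\<Sum>p | p \<in> R \<and> p \<le> m. ln (real p))"
  shows "\<alpha> * (ln (ln N) - ln (ln (real m0 + 1))) \<le> (\<Sum>p | p \<in> R \<and> p \<le> N. 1 / real p)"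
proof -
  define t where "t = (\<lambda>N. \<Sum>p | p \<in> R \<and> p \<le> N. ln (real p))"
  define w where "w = (\<lambda>m. 1 / (real m * ln (real m)))"
  have fin: "finite {p. p \<in> R \<and> p \<le> N}" for N by (rule finite_subset[of _ "{..N}"]) auto
  have RS: "{p. p \<in> R \<and> p \<le> Suc N} = (if Suc N \<in> R then insert (Suc N) {p. p \<in> R \<and> p \<le> N} else {p. p \<in> R \<and> p \<le> N})" for N
    using le_Suc_eq by auto
  have wpos: "0 < w m" if "2 \<le> m" for m using that by (simp add: w_def)
  have wle: "w (Suc m) \<le> w m" if "2 \<le> m" for m
    unfolding w_def using that by (intro divide_left_mono mult_mono mult_pos_pos) auto
  have tnn: "0 \<le> t N" for N unfolding t_def using R by (intro sum_nonneg) (auto simp: Suc_le_eq prime_gt_0_nat)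
  have "t N * w N + \<alpha> * (ln (ln (real N + 1)) - ln (ln (real m0 + 1))) \<le> (\<Sum>p | p \<in> R \<and> p \<le> N. 1 / real p)"
    using \<open>m0 \<le> N\<close>
  proof (induction N rule: dec_induct)
    case base
    have "t m0 * w m0 = (\<Sum>p | p \<in> R \<and> p \<le> m0. ln (real p) * w m0)"
      unfolding t_def by (simp add: sum_distrib_right)
    also have "\<dots> \<le> (\<Sum>p | p \<in> R \<and> p \<le> m0. 1 / real p)"
    proof (intro sum_mono)
      fix p assume p: "p \<in> {p. p \<in> R \<and> p \<le> m0}"
      then have p2: "2 \<le> p" using R prime_ge_2_nat by auto
      have "ln (real p) * w m0 \<le> ln (real p) * w p"
        unfolding w_def using p p2 by (intro mult_left_mono divide_left_mono mult_mono mult_pos_pos) auto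
      also have "\<dots> = 1 / real p" using p2 by (simp add: w_def)
      finally show "ln (real p) * w m0 \<le> 1 / real p" .
    qed
    finally show ?case by simp
  next
    case (step N)
    have N2: "2 \<le> N" using step assms by simp
    have e1: "(\<Sum>p | p \<in> R \<and> p \<le> Suc N. 1 / real p) =
      (\<Sum>p | p \<in> R \<and> p \<le> N. 1 / real p) + (if Suc N \<in> R then 1 / real (Suc N) else 0)"
      using fin by (auto simp: RS)
    have e2: "t (Suc N) = t N + (if Suc N \<in> R then ln (real (Suc N)) else 0)"
      unfolding t_def using fin by (auto simp: RS)
    have e3: "t (Suc N) * w (Suc N) = t N * w (Suc N) + (if Suc N \<in> R then 1 / real (Suc N) else 0)"
      unfolding e2 using N2 by (auto simp: w_def add_divide_distrib)
    have "\<alpha> * (ln (ln (real (Suc N) + 1)) - ln (ln (real (Suc N)))) \<le> \<alpha> * w (Suc N)"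
      using ln_ln_step[of "Suc N"] N2 assms unfolding w_def by (intro mult_left_mono) auto
    \<comment> \<open>Since \<open>m * w m = 1 / ln m\<close> decreases,
      \<open>(N + 1) * w (N + 1) \<le> N * w N\<close>.\<close>
    also have "w (Suc N) \<le> real N * (w N - w (Suc N))"
    proof -
      have lN: "0 < ln (real N)" "0 < ln (real N + 1)" "ln (real N) \<le> ln (real N + 1)" using N2 by auto
      have "real N * w N = 1 / ln (real N)" using N2 by (simp add: w_def)
      moreover have "(real N + 1) * w (Suc N) = 1 / ln (real N + 1)" by (simp add: w_def add.commute)
      ultimately have "real N * (w N - w (Suc N)) - w (Suc N) = 1 / ln (real N) - 1 / ln (real N + 1)"
        by (simp add: algebra_simps)
      also have "\<dots> \<ge> 0" using lN by (simp add: frac_le)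
      finally show ?thesis by simp
    qed
    then have "\<alpha> * w (Suc N) \<le> \<alpha> * real N * (w N - w (Suc N))" using assms by (simp add: mult.assoc mult_left_mono)
    also have "\<dots> \<le> t N * (w N - w (Suc N))"
      using th[of N] step wle[OF N2] unfolding t_def by (intro mult_right_mono) auto
    finally show ?case using step.IH unfolding e1 e3 by (simp add: algebra_simps)
  qed
  moreover have "0 \<le> t N * w N" using tnn wpos[of N] assms by (intro mult_nonneg_nonneg) (auto simp: less_imp_le)
  moreover have "\<alpha> * (ln (ln N)) \<le> \<alpha> * (ln (ln (real N + 1)))" using assms by (intro mult_left_mono) auto
  ultimately show ?thesis by (simp add: algebra_simps)
qed

text \<open>The \<open>j\<close>-th smallest element of \<open>T\<close> is at least
  \<open>j + 1\<close>, so the extreme case is \<open>{2..card T + 1}\<close>, where the product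
  telescopes. It serves for the primes dividing a modulus, the primes dividing a frequency, and the
  primes already chosen in \<open>esym_ge\<close>.\<close>

lemma reciprocal_sum_prod_le_card:
  fixes f :: "nat \<Rightarrow> real"
  assumes "finite T" "\<And>p. p \<in> T \<Longrightarrow> 2 \<le> p"
  shows "(\<Sum>p\<in>T. 1 / real p) \<le> ln (real (card T) + 1)"
    and "(\<Prod>p\<in>T. real p / (real p - 1)) \<le> real (card T) + 1"
proof -
  have *: "(\<Sum>p\<in>T. 1 / real p) \<le> ln (real (card T) + 1) \<and> (\<Prod>p\<in>T. real p / (real p - 1)) \<le> real (card T) + 1"
    using assms
  proof (induction "card T" arbitrary: T)
    case 0
    then show ?case by auto
  next
    case (Suc c)
    then have ne: "T \<noteq> {}" by auto
    define P where "P = Max T"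
    have P: "P \<in> T" using Suc ne by (simp add: P_def)
    have "T \<subseteq> {2..P}" using Suc by (auto simp: P_def)
    then have "card T \<le> card {2..P}" by (intro card_mono) auto
    then have cP: "Suc c + 1 \<le> P" using Suc.hyps(2) by simp
    define T' where "T' = T - {P}"
    have T': "finite T'" "card T' = c" "T = insert P T'" "P \<notin> T'" using Suc P by (auto simp: T'_def)
    have IH: "(\<Sum>p\<in>T'. 1 / real p) \<le> ln (real c + 1)" "(\<Prod>p\<in>T'. real p / (real p - 1)) \<le> real c + 1"
      using Suc.hyps(1)[of T'] T' Suc.prems by auto
    have a: "1 / real P \<le> ln (real c + 2) - ln (real c + 1)"
    proof -
      have "ln ((real c + 1) / (real c + 2)) \<le> (real c + 1) / (real c + 2) - 1"
        by (intro ln_le_minus_one) auto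
      also have "\<dots> = - (1 / (real c + 2))" by (simp add: field_simps)
      finally have "1 / (real c + 2) \<le> ln (real c + 2) - ln (real c + 1)" by (simp add: ln_div)
      moreover have "1 / real P \<le> 1 / (real c + 2)" using cP by (intro divide_left_mono) auto
      ultimately show ?thesis by linarith
    qed
    have b: "real P / (real P - 1) \<le> (real c + 2) / (real c + 1)"
      using cP by (simp add: field_simps)
    have "(\<Prod>p\<in>T. real p / (real p - 1)) = real P / (real P - 1) * (\<Prod>p\<in>T'. real p / (real p - 1))"
      using T' by simp
    also have "\<dots> \<le> (real c + 2) / (real c + 1) * (real c + 1)"
    proof (intro mult_mono b IH prod_nonneg)
      fix p assume "p \<in> T'"
      then have "2 \<le> p" using Suc.prems T' by auto
      then show "0 \<le> real p / (real p - 1)" by auto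
    qed auto
    finally have "(\<Prod>p\<in>T. real p / (real p - 1)) \<le> real c + 2" by simp
    moreover have "(\<Sum>p\<in>T. 1 / real p) \<le> ln (real c + 2)" using T' IH a by simp
    ultimately show ?case using Suc.hyps(2)[symmetric] by (simp add: add_ac)
  qed
  then show "(\<Sum>p\<in>T. 1 / real p) \<le> ln (real (card T) + 1)"
    "(\<Prod>p\<in>T. real p / (real p - 1)) \<le> real (card T) + 1" by auto
qed

section \<open>Selberg's sieve and the Brun--Titchmarsh inequality\<close>

text \<open>Moebius inversion on the lattice of subsets, obtained by expanding the product of
  \<open>-1 + 1\<close> over \<open>F - E\<close>.\<close>

lemma sum_signs_between:
  assumes "finite F" "E \<subseteq> F"
  shows "(\<Sum>T | E \<subseteq> T \<and> T \<subseteq> F. (-1) ^ card T) = (if E = F then (-1) ^ card E else (0::real))"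
proof -
  have fE: "finite E" "finite (F - E)" using assms finite_subset by auto
  have "(\<Sum>T | E \<subseteq> T \<and> T \<subseteq> F. (-1) ^ card T) = (\<Sum>X\<in>Pow (F - E). (-1) ^ card (E \<union> X) :: real)"
    using assms by (intro sum.reindex_bij_witness[of _ "\<lambda>X. E \<union> X" "\<lambda>T. T - E"]) (auto simp: Un_absorb1 Diff_partition)
  also have "\<dots> = (\<Sum>X\<in>Pow (F - E). (-1) ^ card E * (\<Prod>x\<in>X. -1) :: real)"
  proof (intro sum.cong refl)
    fix X assume "X \<in> Pow (F - E)"
    then have "card (E \<union> X) = card E + card X" using fE by (intro card_Un_disjoint) (auto intro: finite_subset)
    then show "(-1) ^ card (E \<union> X) = (-1) ^ card E * (\<Prod>x\<in>X. -1 :: real)" by (simp add: power_add)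
  qed
  also have "\<dots> = (-1) ^ card E * (\<Sum>X\<in>Pow (F - E). (\<Prod>x\<in>X. -1) * (\<Prod>x\<in>(F - E) - X. 1))"
    by (simp add: sum_distrib_left)
  also have "(\<Sum>X\<in>Pow (F - E). (\<Prod>x\<in>X. -1) * (\<Prod>x\<in>(F - E) - X. 1)) = (\<Prod>x\<in>F - E. -1 + 1 :: real)"
    by (rule prod_add[symmetric]) (use fE in auto)
  also have "\<dots> = (if E = F then 1 else 0)"
    using assms fE by auto
  finally show ?thesis by simp
qed

text \<open>Euler's function of the squarefree number \<open>\<Prod>T\<close>.\<close>

definition tot :: "nat set \<Rightarrow> real" where
  "tot T = (\<Prod>p\<in>T. real p - 1)"

text \<open>Squarefree integers up to \<open>D\<close> coprime to \<open>u\<close>, each encoded by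
  its set of prime divisors: gcd and lcm become intersection and union. With this encoding
  \<open>sieve_L\<close> is Selberg's sum of \<open>mu(d)^2 / phi(d)\<close>.\<close>

definition sieve_sets :: "nat \<Rightarrow> nat \<Rightarrow> nat set set" where
  "sieve_sets u D = {T. finite T \<and> (\<forall>p\<in>T. prime p \<and> \<not> p dvd u) \<and> \<Prod>T \<le> D}"

definition sieve_L :: "nat \<Rightarrow> nat \<Rightarrow> real" where
  "sieve_L u D = (\<Sum>T\<in>sieve_sets u D. 1 / tot T)"

text \<open>
  These weights minimise the quadratic form of \<open>sieve_quadratic_form\<close> subject to the weight of the
  empty set being 1.  The crude bound \<open>\<bar>\<lambda>\<^sub>T\<bar> \<le> \<Prod>T\<close> below suffices because the sieving level may be a small
  power of the length of the progression.
\<close>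

definition sieve_lam :: "nat \<Rightarrow> nat \<Rightarrow> nat set \<Rightarrow> real" where
  "sieve_lam u D T = (-1) ^ card T * real (\<Prod>T) * (\<Sum>F | F \<in> sieve_sets u D \<and> T \<subseteq> F. 1 / tot F) / sieve_L u D"

lemma tot_pos: "(\<And>p. p \<in> T \<Longrightarrow> prime p) \<Longrightarrow> 0 < tot T"
  unfolding tot_def by (intro prod_pos) (simp add: prime_gt_1_nat prime_gt_Suc_0_nat)

lemma prod_primes_inject:
  assumes "finite T" "finite F" "\<And>p. p \<in> T \<union> F \<Longrightarrow> prime (p::nat)" "\<Prod>T = \<Prod>F"
  shows "T = F"
proof -
  have *: "T = {p. prime p \<and> p dvd \<Prod>T}" if fT: "finite T" and pT: "\<And>p. p \<in> T \<Longrightarrow> prime (p::nat)" for T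
  proof (intro equalityI subsetI)
    fix p assume "p \<in> {p. prime p \<and> p dvd \<Prod>T}"
    then obtain q where "q \<in> T" "p dvd q"
      using prime_dvd_prod_iff[OF fT, of p "\<lambda>x. x"] \<open>p \<in> _\<close> by auto
    with pT \<open>p \<in> _\<close> show "p \<in> T" using primes_dvd_imp_eq by blast
  qed (use fT pT in auto)
  show ?thesis using *[of T] *[of F] assms by auto
qed

lemma card_residue_below:
  assumes "c < d"
  shows "\<bar>real (card {j. j < J \<and> j mod d = c}) - real J / real d\<bar> \<le> 1"
proof -
  \<comment> \<open>The number of \<open>i\<close> with \<open>d * i + c < J\<close>, that is
    \<open>\<lceil>(J - c) / d\<rceil>\<close>, written without a negative difference.\<close>
  define M where "M = (J + (d - 1 - c)) div d"
  have d: "d > 0" using assms by simp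
  have "{j. j < J \<and> j mod d = c} = (\<lambda>i. d * i + c) ` {..<M}"
  proof (intro equalityI subsetI)
    fix j assume j: "j \<in> {j. j < J \<and> j mod d = c}"
    then have e: "j = d * (j div d) + c" by (metis (mono_tags) mem_Collect_eq mult_div_mod_eq)
    have "Suc (j div d) \<le> M"
    proof -
      have "Suc (j div d) * d = d * (j div d) + d" by simp
      also have "\<dots> \<le> J + (d - 1 - c)" using j assms e by simp linarith
      finally show ?thesis unfolding M_def less_eq_div_iff_mult_less_eq[OF d] .
    qed
    then show "j \<in> (\<lambda>i. d * i + c) ` {..<M}" using e by auto
  next
    fix j assume "j \<in> (\<lambda>i. d * i + c) ` {..<M}"
    then obtain i where i: "j = d * i + c" "i < M" by auto
    then have "Suc i \<le> M" by simp
    then have "Suc i * d \<le> J + (d - 1 - c)" unfolding M_def less_eq_div_iff_mult_less_eq[OF d] by simp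
    then show "j \<in> {j. j < J \<and> j mod d = c}" using i assms by (simp add: mult.commute)
  qed
  then have "card {j. j < J \<and> j mod d = c} = M"
    using d by (simp add: card_image inj_on_def)
  moreover have "real J / real d - 1 \<le> real M"
  proof -
    have "J + (d - 1 - c) = M * d + (J + (d - 1 - c)) mod d" unfolding M_def by simp
    moreover have "(J + (d - 1 - c)) mod d < d" using d by simp
    ultimately have "J \<le> (M + 1) * d" by simp
    then have "real J \<le> (real M + 1) * real d" by (metis of_nat_1 of_nat_add of_nat_le_iff of_nat_mult)
    then show ?thesis using d by (simp add: field_simps)
  qed
  moreover have "real M \<le> real J / real d + 1"
  proof -
    have "M * d \<le> J + (d - 1 - c)" unfolding M_def by simp
    also have "\<dots> \<le> J + d" by simp
    finally have "real M * real d \<le> real J + real d" by (metis of_nat_add of_nat_le_iff of_nat_mult)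
    then show ?thesis using d by (simp add: field_simps)
  qed
  ultimately show ?thesis by (simp add: abs_le_iff)
qed

lemma card_progression_divisible:
  assumes "coprime d u" "d > 0"
  shows "\<bar>real (card {j. j < J \<and> d dvd (a + u * j)}) - real J / real d\<bar> \<le> 1"
proof -
  obtain v where v: "[u * v = 1] (mod d)" using cong_solve_coprime_nat[of u d] assms by (auto simp: coprime_commute)
  \<comment> \<open>The class of \<open>- a / u\<close> modulo \<open>d\<close>; the factor
    \<open>d - 1\<close> stands for \<open>-1\<close> among natural numbers.\<close>
  define c where "c = (v * (d - 1) * a) mod d"
  have inv: "[u * (v * (d - 1) * a) + a = 0] (mod d)"
  proof -
    have "[u * (v * (d - 1) * a) + a = 1 * ((d - 1) * a) + a] (mod d)"
      using cong_mult[OF v cong_refl[of "(d-1)*a"]] by (intro cong_add) (auto simp: mult_ac)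
    also have "1 * ((d - 1) * a) + a = d * a" using assms by (cases d) auto
    also have "[d * a = 0] (mod d)" by (simp add: cong_0_iff)
    finally show ?thesis .
  qed
  have "{j. j < J \<and> d dvd (a + u * j)} = {j. j < J \<and> j mod d = c}"
  proof (rule Collect_cong, rule conj_cong[OF refl])
    fix j
    have "d dvd (a + u * j) \<longleftrightarrow> [u * j + a = u * (v * (d - 1) * a) + a] (mod d)"
      using inv by (metis add.commute cong_0_iff cong_sym cong_trans)
    also have "\<dots> \<longleftrightarrow> [u * j = u * (v * (d - 1) * a)] (mod d)" by (rule cong_add_rcancel_nat)
    also have "\<dots> \<longleftrightarrow> [j = v * (d - 1) * a] (mod d)"
      using assms by (intro cong_mult_lcancel_nat) (simp add: coprime_commute)
    also have "\<dots> \<longleftrightarrow> j mod d = c" by (simp add: cong_def c_def)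
    finally show "d dvd (a + u * j) \<longleftrightarrow> j mod d = c" .
  qed
  then show ?thesis using card_residue_below[of c d J] assms by (simp add: c_def)
qed

lemma sum_inverse_squares_le: "(\<Sum>t=1..N. 1 / real t ^ 2) \<le> 2"
proof -
  have "(\<Sum>t=1..Suc N. 1 / real t ^ 2) \<le> 2 - 1 / real (Suc N)" for N
  proof (induction N)
    case (Suc N)
    have "1 / real (Suc (Suc N)) ^ 2 \<le> 1 / (real (Suc N) * real (Suc (Suc N)))"
      unfolding power2_eq_square by (intro divide_left_mono mult_right_mono) auto
    also have "\<dots> = 1 / real (Suc N) - 1 / real (Suc (Suc N))" by (simp add: field_simps)
    finally show ?case using Suc by simp
  qed simp
  from this[of "N - 1"] show ?thesis by (cases N) (auto intro: order_trans)
qed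

text \<open>Sieving by one more prime \<open>p\<close> removes at most the proportion
  \<open>1 / p\<close> of the sum, because a removed multiple \<open>p * i\<close> has
  \<open>i\<close> in the set before this step. There is no error term to accumulate, however many
  primes \<open>V\<close> contains.\<close>

lemma sum_inverse_coprime_ge:
  assumes "finite V" "\<And>p. p \<in> V \<Longrightarrow> prime (p::nat)"
  shows "(\<Prod>p\<in>V. 1 - 1 / real p) * (\<Sum>m=1..N. 1 / real m) \<le> (\<Sum>m | 1 \<le> m \<and> m \<le> N \<and> (\<forall>p\<in>V. \<not> p dvd m). 1 / real m)"
  using assms
proof (induction V rule: finite_induct)
  case empty
  then show ?case by (simp add: atLeastAtMost_def atLeast_def atMost_def Int_def)
next
  case (insert p V)
  let ?A = "{m. 1 \<le> m \<and> m \<le> N \<and> (\<forall>p\<in>V. \<not> p dvd m)}"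
  let ?B = "{m. 1 \<le> m \<and> m \<le> N \<and> (\<forall>p\<in>insert p V. \<not> p dvd m)}"
  let ?C = "{m. 1 \<le> m \<and> m \<le> N \<and> (\<forall>p\<in>V. \<not> p dvd m) \<and> p dvd m}"
  have p: "prime p" "2 \<le> p" using insert by (auto dest: prime_ge_2_nat)
  have fin: "finite ?A" by (rule finite_subset[of _ "{..N}"]) auto
  have "?A = ?B \<union> ?C" "?B \<inter> ?C = {}" by auto
  then have "(\<Sum>m\<in>?A. 1 / real m) = (\<Sum>m\<in>?B. 1 / real m) + (\<Sum>m\<in>?C. 1 / real m)"
    using fin sum.union_disjoint[of ?B ?C "\<lambda>m. 1 / real m"] by (simp only: finite_Un)
  also have "(\<Sum>m\<in>?C. 1 / real m) \<le> (\<Sum>m\<in>(\<lambda>i. p * i) ` ?A. 1 / real m)"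
  proof (intro sum_mono2)
    show "?C \<subseteq> (\<lambda>i. p * i) ` ?A"
    proof
      fix m assume m: "m \<in> ?C"
      then obtain i where i: "m = p * i" by (auto elim: dvdE)
      have "i \<le> p * i" using p by simp
      moreover have "1 \<le> i" using m i by (cases i) auto
      moreover have "i \<le> N" using m i \<open>i \<le> p * i\<close> by (metis (lifting) le_trans mem_Collect_eq)
      ultimately have "i \<in> ?A" using m i by auto
      then show "m \<in> (\<lambda>i. p * i) ` ?A" using i by auto
    qed
  qed (use fin in auto)
  also have "\<dots> = (\<Sum>m\<in>?A. 1 / real p * (1 / real m))"
    using p by (subst sum.reindex) (auto simp: inj_on_def)
  also have "\<dots> = 1 / real p * (\<Sum>m\<in>?A. 1 / real m)" by (simp only: sum_distrib_left)
  finally have "(1 - 1 / real p) * (\<Sum>m\<in>?A. 1 / real m) \<le> (\<Sum>m\<in>?B. 1 / real m)"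
    by (simp add: algebra_simps)
  moreover have "(\<Prod>p\<in>insert p V. 1 - 1 / real p) * (\<Sum>m=1..N. 1 / real m) =
     (1 - 1 / real p) * ((\<Prod>p\<in>V. 1 - 1 / real p) * (\<Sum>m=1..N. 1 / real m))"
    using insert by simp
  moreover have "\<dots> \<le> (1 - 1 / real p) * (\<Sum>m\<in>?A. 1 / real m)"
    using insert p by (intro mult_left_mono) auto
  ultimately show ?case by linarith
qed

section \<open>Selberg's weights and the diagonalised quadratic form\<close>

context
  fixes u D :: nat
  assumes D: "1 \<le> D"
begin

lemma prime_sieve_sets: "T \<in> sieve_sets u D \<Longrightarrow> p \<in> T \<Longrightarrow> prime p"
  by (auto simp: sieve_sets_def)

lemma inj_on_prod_sieve_sets: "inj_on Prod (sieve_sets u D)"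
  by (rule inj_onI, rule prod_primes_inject) (auto simp: sieve_sets_def)

lemma prod_sieve_sets_bounds: "T \<in> sieve_sets u D \<Longrightarrow> \<Prod>T \<in> {1..D}"
  using prod_primes_pos[of T] by (auto simp: sieve_sets_def Suc_le_eq)

lemma finite_sieve_sets: "finite (sieve_sets u D)"
  using inj_on_prod_sieve_sets prod_sieve_sets_bounds by (intro inj_on_finite[of Prod _ "{1..D}"]) auto

lemma card_sieve_sets: "card (sieve_sets u D) \<le> D"
proof -
  have "card (sieve_sets u D) \<le> card {1..D}"
    using inj_on_prod_sieve_sets prod_sieve_sets_bounds by (intro card_inj_on_le[of Prod]) auto
  then show ?thesis by simp
qed

lemma empty_in_sieve_sets: "{} \<in> sieve_sets u D"
  using D by (auto simp: sieve_sets_def)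

lemma subset_sieve_sets: "F \<in> sieve_sets u D \<Longrightarrow> T \<subseteq> F \<Longrightarrow> T \<in> sieve_sets u D"
proof -
  assume F: "F \<in> sieve_sets u D" "T \<subseteq> F"
  have "\<Prod>T dvd \<Prod>F" using F by (intro prod_dvd_prod_subset) (auto simp: sieve_sets_def)
  then have "\<Prod>T \<le> \<Prod>F" using F prod_primes_pos[of F] by (intro dvd_imp_le) (auto simp: sieve_sets_def)
  then show ?thesis using F by (auto simp: sieve_sets_def intro: finite_subset)
qed

lemma tot_sieve_pos: "T \<in> sieve_sets u D \<Longrightarrow> 0 < tot T"
  using prime_sieve_sets by (intro tot_pos)

lemma sieve_L_ge1: "1 \<le> sieve_L u D"
proof -
  have "(\<Sum>T\<in>{{}}. 1 / tot T) \<le> sieve_L u D" unfolding sieve_L_def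
    using empty_in_sieve_sets finite_sieve_sets by (intro sum_mono2) (auto dest!: tot_sieve_pos)
  then show ?thesis by (simp add: tot_def)
qed

lemma sieve_lam_empty: "sieve_lam u D {} = 1"
  using sieve_L_ge1 by (simp add: sieve_lam_def sieve_L_def)

lemma abs_sieve_lam_le: "\<bar>sieve_lam u D T\<bar> \<le> real (\<Prod>T)"
proof -
  have "(\<Sum>F | F \<in> sieve_sets u D \<and> T \<subseteq> F. 1 / tot F) \<le> sieve_L u D"
    unfolding sieve_L_def using finite_sieve_sets by (intro sum_mono2) (auto dest!: tot_sieve_pos)
  moreover have "0 \<le> (\<Sum>F | F \<in> sieve_sets u D \<and> T \<subseteq> F. 1 / tot F)"
    by (intro sum_nonneg) (auto dest!: tot_sieve_pos)
  ultimately have "(\<Sum>F | F \<in> sieve_sets u D \<and> T \<subseteq> F. 1 / tot F) / sieve_L u D \<in> {0..1}"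
    using sieve_L_ge1 by (auto simp: field_simps)
  then have r: "\<bar>(\<Sum>F | F \<in> sieve_sets u D \<and> T \<subseteq> F. 1 / tot F) / sieve_L u D\<bar> \<le> 1" by (simp only: atLeastAtMost_iff abs_of_nonneg)
  have "\<bar>sieve_lam u D T\<bar> = real (\<Prod>T) * \<bar>(\<Sum>F | F \<in> sieve_sets u D \<and> T \<subseteq> F. 1 / tot F) / sieve_L u D\<bar>"
    unfolding sieve_lam_def by (simp add: abs_mult power_abs del: of_nat_prod)
  also have "\<dots> \<le> real (\<Prod>T) * 1" by (intro mult_left_mono r) (auto intro: prod_nonneg)
  finally show ?thesis by simp
qed

text \<open>These sums are the variables that diagonalise the quadratic form. After interchanging
  summations, the alternating sum over \<open>E \<subseteq> T \<subseteq> F\<close> leaves only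
  \<open>F = E\<close>.\<close>

lemma sum_sieve_lam_superset:
  assumes E: "E \<in> sieve_sets u D"
  shows "(\<Sum>T | T \<in> sieve_sets u D \<and> E \<subseteq> T. sieve_lam u D T / real (\<Prod>T)) = (-1) ^ card E / (tot E * sieve_L u D)"
proof -
  let ?S = "sieve_sets u D"
  have "(\<Sum>T | T \<in> ?S \<and> E \<subseteq> T. sieve_lam u D T / real (\<Prod>T)) =
        (\<Sum>T | T \<in> ?S \<and> E \<subseteq> T. \<Sum>F | F \<in> ?S \<and> T \<subseteq> F. (-1) ^ card T / (tot F * sieve_L u D))"
  proof (intro sum.cong refl)
    fix T assume "T \<in> {T. T \<in> ?S \<and> E \<subseteq> T}"
    then have "\<Prod>T > 0" using prod_sieve_sets_bounds[of T] by auto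
    then show "sieve_lam u D T / real (\<Prod>T) = (\<Sum>F | F \<in> ?S \<and> T \<subseteq> F. (-1) ^ card T / (tot F * sieve_L u D))"
      unfolding sieve_lam_def by (simp add: sum_distrib_left sum_divide_distrib field_simps del: of_nat_prod)
  qed
  also have "\<dots> = (\<Sum>F\<in>?S. \<Sum>T\<in>{T\<in>{T\<in>?S. E \<subseteq> T}. T \<subseteq> F}. (-1) ^ card T / (tot F * sieve_L u D))"
    by (rule sum.swap_restrict) (use finite_sieve_sets in auto)
  also have "\<dots> = (\<Sum>F\<in>?S. if F = E then (-1) ^ card E / (tot E * sieve_L u D) else 0)"
  proof (intro sum.cong refl)
    fix F assume F: "F \<in> ?S"
    have "{T\<in>{T\<in>?S. E \<subseteq> T}. T \<subseteq> F} = {T. E \<subseteq> T \<and> T \<subseteq> F}" using F subset_sieve_sets by auto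
    then have "(\<Sum>T\<in>{T\<in>{T\<in>?S. E \<subseteq> T}. T \<subseteq> F}. (-1) ^ card T / (tot F * sieve_L u D)) =
      (\<Sum>T | E \<subseteq> T \<and> T \<subseteq> F. (-1) ^ card T) / (tot F * sieve_L u D)"
      by (simp add: sum_divide_distrib)
    also have "\<dots> = (if F = E then (-1) ^ card E / (tot E * sieve_L u D) else 0)"
    proof (cases "E \<subseteq> F")
      case True
      then show ?thesis using F by (subst sum_signs_between) (auto simp: sieve_sets_def)
    next
      case False
      then have "{T. E \<subseteq> T \<and> T \<subseteq> F} = {}" by auto
      then show ?thesis using False by (auto simp del: Collect_empty_eq)
    qed
    finally show "(\<Sum>T\<in>{T\<in>{T\<in>?S. E \<subseteq> T}. T \<subseteq> F}. (-1) ^ card T / (tot F * sieve_L u D)) = (if F = E then (-1) ^ card E / (tot E * sieve_L u D) else 0)" .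
  qed
  also have "\<dots> = (-1) ^ card E / (tot E * sieve_L u D)"
    using E finite_sieve_sets by simp
  finally show ?thesis .
qed

text \<open>\<open>\<Prod>(T \<union> T')\<close> is the lcm, so its reciprocal is the gcd divided
  by the product of the two numbers, and the gcd is the sum of Euler's function over its
  divisors.\<close>

lemma inverse_prod_Un:
  assumes "T \<in> sieve_sets u D" "T' \<in> sieve_sets u D"
  shows "1 / real (\<Prod>(T \<union> T')) = (\<Sum>E | E \<in> sieve_sets u D \<and> E \<subseteq> T \<and> E \<subseteq> T'. tot E) / (real (\<Prod>T) * real (\<Prod>T'))"
proof -
  have fin: "finite T" "finite T'" using assms by (auto simp: sieve_sets_def)
  have "real (\<Prod>(T \<inter> T')) = (\<Prod>p\<in>T \<inter> T'. (real p - 1) + 1)" by simp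
  also have "\<dots> = (\<Sum>E\<in>Pow (T \<inter> T'). (\<Prod>p\<in>E. real p - 1) * (\<Prod>p\<in>(T \<inter> T') - E. 1))"
    by (rule prod_add) (use fin in auto)
  also have "\<dots> = (\<Sum>E\<in>Pow (T \<inter> T'). tot E)" by (simp add: tot_def)
  also have "Pow (T \<inter> T') = {E. E \<in> sieve_sets u D \<and> E \<subseteq> T \<and> E \<subseteq> T'}"
    using assms subset_sieve_sets by auto
  finally have 1: "real (\<Prod>(T \<inter> T')) = (\<Sum>E | E \<in> sieve_sets u D \<and> E \<subseteq> T \<and> E \<subseteq> T'. tot E)" .
  have "\<Prod>(T \<union> T') * \<Prod>(T \<inter> T') = \<Prod>T * \<Prod>T'"
    using prod.union_inter[OF fin, of "\<lambda>x. x"] by simp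
  then have 2: "real (\<Prod>(T \<union> T')) * real (\<Prod>(T \<inter> T')) = real (\<Prod>T) * real (\<Prod>T')" by (metis of_nat_mult)
  have "\<Prod>T > 0" "\<Prod>T' > 0" "\<Prod>(T \<union> T') > 0"
    using assms by (intro prod_primes_pos; force simp: sieve_sets_def)+
  then show ?thesis unfolding 1[symmetric] using 2 by (simp add: field_simps del: of_nat_prod)
qed

text \<open>By \<open>inverse_prod_Un\<close> the form is a sum of squares with weights
  \<open>tot E\<close>; by \<open>sum_sieve_lam_superset\<close> the square belonging to
  \<open>E\<close> is \<open>1 / (tot E * sieve_L u D)^2\<close>.\<close>

lemma sieve_quadratic_form:
  "(\<Sum>T\<in>sieve_sets u D. \<Sum>T'\<in>sieve_sets u D. sieve_lam u D T * sieve_lam u D T' / real (\<Prod>(T \<union> T'))) = 1 / sieve_L u D"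
proof -
  let ?S = "sieve_sets u D" and ?g = "\<lambda>T. sieve_lam u D T / real (\<Prod>T)"
  have "(\<Sum>T\<in>?S. \<Sum>T'\<in>?S. sieve_lam u D T * sieve_lam u D T' / real (\<Prod>(T \<union> T'))) =
    (\<Sum>T\<in>?S. \<Sum>T'\<in>?S. \<Sum>E\<in>?S. if E \<subseteq> T \<and> E \<subseteq> T' then tot E * ?g T * ?g T' else 0)"
  proof (intro sum.cong refl)
    fix T T' assume T: "T \<in> ?S" "T' \<in> ?S"
    have "sieve_lam u D T * sieve_lam u D T' / real (\<Prod>(T \<union> T')) = sieve_lam u D T * sieve_lam u D T' * (1 / real (\<Prod>(T \<union> T')))" by simp
    also have "\<dots> = (\<Sum>E\<in>{E\<in>?S. E \<subseteq> T \<and> E \<subseteq> T'}. tot E) * ?g T * ?g T'"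
      unfolding inverse_prod_Un[OF T] by (simp del: of_nat_prod)
    also have "\<dots> = (\<Sum>E\<in>{E\<in>?S. E \<subseteq> T \<and> E \<subseteq> T'}. tot E * ?g T * ?g T')"
      by (simp only: sum_distrib_right)
    also have "\<dots> = (\<Sum>E\<in>?S. if E \<subseteq> T \<and> E \<subseteq> T' then tot E * ?g T * ?g T' else 0)"
      by (rule sum.inter_filter) (rule finite_sieve_sets)
    finally show "sieve_lam u D T * sieve_lam u D T' / real (\<Prod>(T \<union> T')) = (\<Sum>E\<in>?S. if E \<subseteq> T \<and> E \<subseteq> T' then tot E * ?g T * ?g T' else 0)" .
  qed
  also have "\<dots> = (\<Sum>T\<in>?S. \<Sum>E\<in>?S. \<Sum>T'\<in>?S. if E \<subseteq> T \<and> E \<subseteq> T' then tot E * ?g T * ?g T' else 0)"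
    by (rule sum.cong[OF refl], rule sum.swap)
  also have "\<dots> = (\<Sum>E\<in>?S. \<Sum>T\<in>?S. \<Sum>T'\<in>?S. if E \<subseteq> T \<and> E \<subseteq> T' then tot E * ?g T * ?g T' else 0)"
    by (rule sum.swap)
  also have "\<dots> = (\<Sum>E\<in>?S. tot E * ((\<Sum>T\<in>?S. if E \<subseteq> T then ?g T else 0) * (\<Sum>T\<in>?S. if E \<subseteq> T then ?g T else 0)))"
  proof (rule sum.cong[OF refl])
    fix E
    have "tot E * ((\<Sum>T\<in>?S. if E \<subseteq> T then ?g T else 0) * (\<Sum>T\<in>?S. if E \<subseteq> T then ?g T else 0)) =
      (\<Sum>T\<in>?S. \<Sum>T'\<in>?S. tot E * ((if E \<subseteq> T then ?g T else 0) * (if E \<subseteq> T' then ?g T' else 0)))"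
      by (subst sum_product) (simp only: sum_distrib_left)
    also have "\<dots> = (\<Sum>T\<in>?S. \<Sum>T'\<in>?S. if E \<subseteq> T \<and> E \<subseteq> T' then tot E * ?g T * ?g T' else 0)"
      by (intro sum.cong refl) simp
    finally show "(\<Sum>T\<in>?S. \<Sum>T'\<in>?S. if E \<subseteq> T \<and> E \<subseteq> T' then tot E * ?g T * ?g T' else 0) =
      tot E * ((\<Sum>T\<in>?S. if E \<subseteq> T then ?g T else 0) * (\<Sum>T\<in>?S. if E \<subseteq> T then ?g T else 0))" by simp
  qed
  also have "\<dots> = (\<Sum>E\<in>?S. tot E * ((-1) ^ card E / (tot E * sieve_L u D) * ((-1) ^ card E / (tot E * sieve_L u D))))"
  proof (intro sum.cong refl)
    fix E assume E: "E \<in> ?S"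
    have "(\<Sum>T\<in>?S. if E \<subseteq> T then ?g T else 0) = (\<Sum>T\<in>{T\<in>?S. E \<subseteq> T}. ?g T)"
      by (rule sum.inter_filter[symmetric]) (rule finite_sieve_sets)
    also have "\<dots> = (-1) ^ card E / (tot E * sieve_L u D)" using sum_sieve_lam_superset[OF E] by simp
    finally show "tot E * ((\<Sum>T\<in>?S. if E \<subseteq> T then ?g T else 0) * (\<Sum>T\<in>?S. if E \<subseteq> T then ?g T else 0)) = tot E * ((-1) ^ card E / (tot E * sieve_L u D) * ((-1) ^ card E / (tot E * sieve_L u D)))"
      by simp
  qed
  also have "\<dots> = (\<Sum>E\<in>?S. 1 / tot E / (sieve_L u D * sieve_L u D))"
  proof (intro sum.cong refl)
    fix E assume "E \<in> ?S"
    then have "tot E > 0" by (rule tot_sieve_pos)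
    moreover have "(-1 :: real) ^ card E * (-1) ^ card E = 1" by (simp flip: power_add mult_2)
    ultimately show "tot E * ((-1) ^ card E / (tot E * sieve_L u D) * ((-1) ^ card E / (tot E * sieve_L u D))) = 1 / tot E / (sieve_L u D * sieve_L u D)"
      by (simp add: field_simps)
  qed
  also have "\<dots> = 1 / sieve_L u D"
    using sieve_L_ge1 by (simp only: sum_divide_distrib[symmetric] sieve_L_def[symmetric]) simp
  finally show ?thesis .
qed

lemma prod_Un_dvd_iff:
  assumes "T \<in> sieve_sets u D" "T' \<in> sieve_sets u D"
  shows "\<Prod>T dvd m \<and> \<Prod>T' dvd m \<longleftrightarrow> \<Prod>(T \<union> T') dvd (m::nat)"
proof -
  have *: "\<Prod>F dvd m \<longleftrightarrow> (\<forall>p\<in>F. p dvd m)" if "finite F" "\<forall>p\<in>F. prime p" for F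
    using prod_primes_dvd[of F m] that by (meson dvd_prodI dvd_trans)
  show ?thesis using assms by (subst (1 2 3) *) (auto simp: sieve_sets_def)
qed

text \<open>The square of \<open>W\<close> majorises the indicator of the unsifted \<open>j\<close>:
  there only the empty set contributes and \<open>W j = 1\<close>. Each of the at most
  \<open>D^2\<close> pairs of sets causes a counting error of at most 1, weighted by at most
  \<open>\<Prod>T * \<Prod>T' \<le> D^2\<close>.\<close>

lemma selberg_sieve:
  "real (card {j. j < J \<and> (\<forall>p. prime p \<longrightarrow> p \<le> D \<longrightarrow> \<not> p dvd (a + u * j))}) \<le> real J / sieve_L u D + real D ^ 4"
proof -
  let ?S = "sieve_sets u D" and ?l = "sieve_lam u D"
  define W where "W = (\<lambda>j. \<Sum>T\<in>?S. if \<Prod>T dvd (a + u * j) then ?l T else 0)"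
  let ?A = "{j. j < J \<and> (\<forall>p. prime p \<longrightarrow> p \<le> D \<longrightarrow> \<not> p dvd (a + u * j))}"
  have "real (card ?A) = (\<Sum>j\<in>?A. (W j)\<^sup>2)"
  proof -
    have "W j = 1" if "j \<in> ?A" for j
    proof -
      have "W j = (\<Sum>T\<in>{{}}. if \<Prod>T dvd (a + u * j) then ?l T else 0)" unfolding W_def
      proof (rule sum.mono_neutral_right)
        show "\<forall>T\<in>?S - {{}}. (if \<Prod>T dvd (a + u * j) then ?l T else 0) = 0"
        proof
          fix T assume T: "T \<in> ?S - {{}}"
          then obtain p where p: "p \<in> T" by auto
          have "p dvd \<Prod>T" using T p by (auto simp: sieve_sets_def)
          moreover have "p \<le> D"
            using \<open>p dvd \<Prod>T\<close> prod_sieve_sets_bounds[of T] T dvd_imp_le[of p "\<Prod>T"] by auto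
          ultimately show "(if \<Prod>T dvd (a + u * j) then ?l T else 0) = 0"
            using that T p prime_sieve_sets[of T p] by (auto dest: dvd_trans)
        qed
      qed (use finite_sieve_sets empty_in_sieve_sets in auto)
      then show ?thesis by (simp add: sieve_lam_empty)
    qed
    then show ?thesis by simp
  qed
  also have "\<dots> \<le> (\<Sum>j<J. (W j)\<^sup>2)" by (intro sum_mono2) auto
  also have "\<dots> = (\<Sum>j<J. \<Sum>T\<in>?S. \<Sum>T'\<in>?S. if \<Prod>(T \<union> T') dvd (a + u * j) then ?l T * ?l T' else 0)"
    unfolding W_def power2_eq_square sum_product
    by (intro sum.cong refl) (auto simp: prod_Un_dvd_iff[symmetric])
  also have "\<dots> = (\<Sum>T\<in>?S. \<Sum>j<J. \<Sum>T'\<in>?S. if \<Prod>(T \<union> T') dvd (a + u * j) then ?l T * ?l T' else 0)"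
    by (rule sum.swap)
  also have "\<dots> = (\<Sum>T\<in>?S. \<Sum>T'\<in>?S. \<Sum>j<J. if \<Prod>(T \<union> T') dvd (a + u * j) then ?l T * ?l T' else 0)"
    by (rule sum.cong[OF refl], rule sum.swap)
  also have "\<dots> = (\<Sum>T\<in>?S. \<Sum>T'\<in>?S. ?l T * ?l T' * real (card {j. j < J \<and> \<Prod>(T \<union> T') dvd (a + u * j)}))"
  proof (intro sum.cong refl)
    fix T T'
    have "(\<Sum>j<J. if \<Prod>(T \<union> T') dvd (a + u * j) then ?l T * ?l T' else 0) =
      (\<Sum>j\<in>{j\<in>{..<J}. \<Prod>(T \<union> T') dvd (a + u * j)}. ?l T * ?l T')"
      by (rule sum.inter_filter[symmetric]) simp
    then show "(\<Sum>j<J. if \<Prod>(T \<union> T') dvd (a + u * j) then ?l T * ?l T' else 0) =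
       ?l T * ?l T' * real (card {j. j < J \<and> \<Prod>(T \<union> T') dvd (a + u * j)})" by simp
  qed
  also have "\<dots> \<le> (\<Sum>T\<in>?S. \<Sum>T'\<in>?S. real J * (?l T * ?l T' / real (\<Prod>(T \<union> T'))) + real (\<Prod>T) * real (\<Prod>T'))"
  proof (intro sum_mono)
    fix T T' assume T: "T \<in> ?S" "T' \<in> ?S"
    let ?c = "real (card {j. j < J \<and> \<Prod>(T \<union> T') dvd (a + u * j)})"
    have "coprime (\<Prod>(T \<union> T')) u"
      using T by (intro prod_coprime_left) (auto simp: sieve_sets_def intro: prime_imp_coprime)
    moreover have "\<Prod>(T \<union> T') > 0" using T by (intro prod_primes_pos) (auto simp: sieve_sets_def)
    ultimately have c: "\<bar>?c - real J / real (\<Prod>(T \<union> T'))\<bar> \<le> 1" by (rule card_progression_divisible)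
    have "?l T * ?l T' * (?c - real J / real (\<Prod>(T \<union> T'))) \<le> \<bar>?l T * ?l T' * (?c - real J / real (\<Prod>(T \<union> T')))\<bar>" by simp
    also have "\<dots> \<le> (real (\<Prod>T) * real (\<Prod>T')) * 1"
      unfolding abs_mult
      by (intro mult_mono abs_sieve_lam_le c) (auto intro!: mult_nonneg_nonneg prod_nonneg)
    finally show "?l T * ?l T' * ?c \<le> real J * (?l T * ?l T' / real (\<Prod>(T \<union> T'))) + real (\<Prod>T) * real (\<Prod>T')"
      by (simp add: algebra_simps)
  qed
  also have "\<dots> = real J * (1 / sieve_L u D) + (\<Sum>T\<in>?S. real (\<Prod>T)) * (\<Sum>T\<in>?S. real (\<Prod>T))"
    unfolding sum.distrib sum_distrib_left[symmetric] sieve_quadratic_form[symmetric] sum_product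
    by (simp add: sum_distrib_left)
  also have "\<dots> \<le> real J * (1 / sieve_L u D) + (real D * real D) * (real D * real D)"
  proof -
    have "(\<Sum>T\<in>?S. real (\<Prod>T)) \<le> (\<Sum>T\<in>?S. real D)"
      using prod_sieve_sets_bounds by (intro sum_mono) (auto simp del: of_nat_prod)
    also have "\<dots> \<le> real D * real D" using card_sieve_sets by (simp add: mult_right_mono)
    finally show ?thesis by (intro add_left_mono mult_mono) (auto intro!: sum_nonneg prod_nonneg)
  qed
  finally show ?thesis by (simp add: power4_eq_xxxx mult_ac)
qed

text \<open>Writing \<open>m\<close> as a squarefree number times a square costs a factor of at most
  2 for the squares. With \<open>1 / s \<le> 1 / phi(s)\<close> this bounds the harmonic sum over
  \<open>m \<le> D\<close> coprime to \<open>u\<close> by \<open>2 * sieve_L u D\<close>.\<close>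

lemma sieve_L_ge:
  assumes "u > 0"
  shows "(\<Prod>p\<in>prime_factors u. 1 - 1 / real p) * ln (real D) / 2 \<le> sieve_L u D"
proof -
  let ?A = "{m. 1 \<le> m \<and> m \<le> D \<and> (\<forall>p\<in>prime_factors u. \<not> p dvd m)}"
  let ?S = "{m \<in> ?A. squarefree m}"
  have fin: "finite ?A" "finite ?S" by (auto intro: finite_subset[of _ "{..D}"])
  have "(\<Sum>m\<in>?A. 1 / real m) = (\<Sum>m\<in>?A. (\<lambda>(s,t). 1 / real s * (1 / real t ^ 2)) (squarefree_part m, square_part m))"
  proof (intro sum.cong refl)
    fix m
    have "real m = real (squarefree_part m) * real (square_part m) ^ 2"
      by (metis squarefree_decompose of_nat_mult of_nat_power)
    then show "1 / real m = (\<lambda>(s,t). 1 / real s * (1 / real t ^ 2)) (squarefree_part m, square_part m)" by simp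
  qed
  also have "\<dots> = (\<Sum>z\<in>(\<lambda>m. (squarefree_part m, square_part m)) ` ?A. (\<lambda>(s,t). 1 / real s * (1 / real t ^ 2)) z)"
    by (subst sum.reindex) (auto simp: inj_on_def intro: squarefree_decomposition_unique)
  also have "\<dots> \<le> (\<Sum>z\<in>?S \<times> {1..D}. (\<lambda>(s,t). 1 / real s * (1 / real t ^ 2)) z)"
  proof (intro sum_mono2)
    show "(\<lambda>m. (squarefree_part m, square_part m)) ` ?A \<subseteq> ?S \<times> {1..D}"
    proof clarify
      fix m assume m: "1 \<le> m" "m \<le> D" "\<forall>p\<in>prime_factors u. \<not> p dvd m"
      have d: "squarefree_part m dvd m" "square_part m dvd m"
        by (metis squarefree_decompose dvd_triv_left, metis square_part_square_dvd dvd_mult_left power2_eq_square)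
      then have "squarefree_part m \<le> D" "square_part m \<le> D"
        using m dvd_imp_le[OF d(1)] dvd_imp_le[OF d(2)] by linarith+
      moreover have "squarefree_part m > 0" by (rule gr_zeroI) simp
      moreover have "square_part m > 0" by (rule gr_zeroI) (use m in simp)
      moreover have "\<forall>p\<in>prime_factors u. \<not> p dvd squarefree_part m"
        using m d by (meson dvd_trans)
      ultimately show "squarefree_part m \<in> ?S \<and> square_part m \<in> {1..D}" by auto
    qed
  qed (use fin in auto)
  also have "\<dots> = (\<Sum>s\<in>?S. 1 / real s) * (\<Sum>t=1..D. 1 / real t ^ 2)"
    by (simp add: sum_product sum.cartesian_product)
  also have "\<dots> \<le> (\<Sum>s\<in>?S. 1 / real s) * 2"
    by (intro mult_left_mono sum_inverse_squares_le sum_nonneg) auto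
  also have "(\<Sum>s\<in>?S. 1 / real s) \<le> sieve_L u D"
  proof -
    have prod_pf: "\<Prod>(prime_factors s) = s" if "squarefree s" "s \<noteq> 0" for s :: nat
    proof -
      have "\<Prod>(prime_factors s) = (\<Prod>p\<in>prime_factors s. p ^ multiplicity p s)"
        using that by (intro prod.cong refl) (auto simp: squarefree_factorial_semiring')
      also have "\<dots> = s" using prime_factorization_nat[of s] that by simp
      finally show ?thesis .
    qed
    have "(\<Sum>s\<in>?S. 1 / real s) = (\<Sum>s\<in>?S. 1 / real (\<Prod>(prime_factors s)))"
      by (intro sum.cong refl) (use prod_pf in \<open>auto simp del: of_nat_prod\<close>)
    also have "\<dots> = (\<Sum>T\<in>prime_factors ` ?S. 1 / real (\<Prod>T))"
    proof (subst sum.reindex)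
      show "inj_on prime_factors ?S"
      proof (rule inj_onI)
        fix s t assume s: "s \<in> ?S" and t: "t \<in> ?S" and e: "prime_factors s = prime_factors t"
        have "s = \<Prod>(prime_factors s)" using s by (intro prod_pf[symmetric]) auto
        also have "\<dots> = t" unfolding e using t by (intro prod_pf) auto
        finally show "s = t" .
      qed
    qed (simp add: o_def)
    also have "\<dots> \<le> (\<Sum>T\<in>sieve_sets u D. 1 / real (\<Prod>T))"
    proof (intro sum_mono2 finite_sieve_sets)
      show "prime_factors ` ?S \<subseteq> sieve_sets u D"
        using assms by (auto simp: sieve_sets_def prod_pf in_prime_factors_iff)
    qed (auto intro: prod_nonneg)
    also have "\<dots> \<le> sieve_L u D" unfolding sieve_L_def
    proof (intro sum_mono divide_left_mono)
      fix T assume T: "T \<in> sieve_sets u D"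
      have "\<Prod>T > 0" using prod_sieve_sets_bounds[OF T] by simp
      then show "0 < real (\<Prod>T) * tot T" using tot_sieve_pos[OF T] by (simp del: of_nat_prod)
      have "tot T \<le> (\<Prod>p\<in>T. real p)" unfolding tot_def
      proof (intro prod_mono conjI)
        fix p assume "p \<in> T"
        then show "0 \<le> real p - 1" using prime_ge_1_nat[OF prime_sieve_sets[OF T]] by simp
      qed simp
      then show "tot T \<le> real (\<Prod>T)" by simp
    qed auto
    finally show ?thesis .
  qed
  finally have "(\<Sum>m\<in>?A. 1 / real m) \<le> 2 * sieve_L u D" by simp
  moreover have "(\<Prod>p\<in>prime_factors u. 1 - 1 / real p) * ln (real D) \<le>
      (\<Prod>p\<in>prime_factors u. 1 - 1 / real p) * (\<Sum>m=1..D. 1 / real m)"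
  proof (intro mult_left_mono prod_nonneg)
    have "ln (real D) \<le> ln (real D + 1)" using D by simp
    also have "\<dots> \<le> harm D" by (rule ln_le_harm)
    finally show "ln (real D) \<le> (\<Sum>m=1..D. 1 / real m)" by (simp add: harm_def inverse_eq_divide)
  qed (auto simp: in_prime_factors_iff dest!: prime_ge_1_nat)
  moreover have "\<dots> \<le> (\<Sum>m\<in>?A. 1 / real m)" by (rule sum_inverse_coprime_ge) auto
  ultimately show ?thesis by simp
qed

end

section \<open>The Brun-Titchmarsh inequality in terms of the number of prime factors\<close>

text \<open>A bound for \<open>phi(u) / u\<close> by the number of prime factors alone. It is crude,
  but the moduli it is applied to have fewer than \<open>k\<close> prime factors, and a power of
  \<open>k\<close> is affordable.\<close>

lemma prod_prime_factors_ge: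
  assumes "u > 0"
  shows "1 / (real (card (prime_factors u)) + 1) \<le> (\<Prod>p\<in>prime_factors u. 1 - 1 / real p)"
proof -
  let ?V = "prime_factors u"
  have ge2: "\<And>p. p \<in> ?V \<Longrightarrow> 2 \<le> p" by (auto dest: in_prime_factors_imp_prime prime_ge_2_nat)
  have "(\<Prod>p\<in>?V. 1 - 1 / real p) * (\<Prod>p\<in>?V. real p / (real p - 1)) = 1"
    unfolding prod.distrib[symmetric]
  proof (intro prod.neutral ballI)
    fix p assume "p \<in> ?V" from ge2[OF this] show "(1 - 1 / real p) * (real p / (real p - 1)) = 1"
      by (simp add: field_simps)
  qed
  moreover have "(\<Prod>p\<in>?V. real p / (real p - 1)) \<le> real (card ?V) + 1"
    by (rule reciprocal_sum_prod_le_card) (use ge2 in auto)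
  moreover have "0 < (\<Prod>p\<in>?V. 1 - 1 / real p)"
    by (intro prod_pos) (auto dest!: ge2)
  ultimately have "1 \<le> (\<Prod>p\<in>?V. 1 - 1 / real p) * (real (card ?V) + 1)"
    using mult_left_mono[of "\<Prod>p\<in>?V. real p / (real p - 1)" "real (card ?V) + 1" "\<Prod>p\<in>?V. 1 - 1 / real p"] by linarith
  then show ?thesis by (simp add: field_simps)
qed

text \<open>The primes in question have the form \<open>a + u * j\<close> with \<open>j < J\<close>,
  and being larger than \<open>D\<close> they have no prime factor up to \<open>D\<close>. The level
  \<open>D\<close> stays free, to be chosen so small that \<open>D ^ 4\<close> is
  negligible.\<close>

theorem brun_titchmarsh:
  fixes u D Y a :: nat
  assumes "u > 0" "2 \<le> D"
  shows "real (card {p. prime p \<and> D < p \<and> p \<le> Y \<and> p mod u = a})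
    \<le> 2 * (real (card (prime_factors u)) + 1) * (real Y / real u + 1) / ln (real D) + real D ^ 4"
proof -
  define J where "J = Y div u + 1"
  let ?B = "{p. prime p \<and> D < p \<and> p \<le> Y \<and> p mod u = a}"
  let ?A = "{j. j < J \<and> (\<forall>p. prime p \<longrightarrow> p \<le> D \<longrightarrow> \<not> p dvd (a + u * j))}"
  have "card ?B \<le> card ?A"
  proof (rule card_inj_on_le)
    show "inj_on (\<lambda>p. p div u) ?B"
    proof (rule inj_onI)
      fix p q assume "p \<in> ?B" "q \<in> ?B" and e: "p div u = q div u"
      then have m: "p mod u = q mod u" by simp
      have "p = p div u * u + p mod u" by simp
      also have "\<dots> = q div u * u + q mod u" by (simp only: e m)
      also have "\<dots> = q" by simp
      finally show "p = q" .
    qed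
    show "(\<lambda>p. p div u) ` ?B \<subseteq> ?A"
    proof clarify
      fix p assume p: "prime p" "D < p" "p \<le> Y" "a = p mod u"
      have e: "p mod u + u * (p div u) = p" by simp
      have "p div u < J" using p by (simp add: J_def div_le_mono le_imp_less_Suc)
      moreover have "\<not> r dvd p" if "prime r" "r \<le> D" for r
        using that p primes_dvd_imp_eq[of r p] by auto
      ultimately show "p div u < J \<and> (\<forall>r. prime r \<longrightarrow> r \<le> D \<longrightarrow> \<not> r dvd (p mod u + u * (p div u)))"
        unfolding e by auto
    qed
  qed auto
  then have "real (card ?B) \<le> real (card ?A)" by simp
  also have "\<dots> \<le> real J / sieve_L u D + real D ^ 4" by (rule selberg_sieve) (use assms in auto)
  also have "real J / sieve_L u D \<le> (real Y / real u + 1) / (ln (real D) / (2 * (real (card (prime_factors u)) + 1)))"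
  proof (intro frac_le)
    have "real (Y div u) * real u \<le> real Y"
      by (metis div_times_less_eq_dividend of_nat_le_iff of_nat_mult)
    then show "real J \<le> real Y / real u + 1" using assms unfolding J_def by (simp add: field_simps)
    have "1 / (real (card (prime_factors u)) + 1) * ln (real D) / 2 \<le>
       (\<Prod>p\<in>prime_factors u. 1 - 1 / real p) * ln (real D) / 2"
      using assms by (intro divide_right_mono mult_right_mono prod_prime_factors_ge) auto
    also have "\<dots> \<le> sieve_L u D" using assms by (intro sieve_L_ge) auto
    finally show "ln (real D) / (2 * (real (card (prime_factors u)) + 1)) \<le> sieve_L u D" by (simp add: mult.commute)
  qed (use assms in auto)
  finally show ?thesis by (simp add: mult_ac)
qed

section \<open>Exponential sums and the Chinese remainder theorem\<close>

definition dotp :: "nat \<Rightarrow> (nat \<Rightarrow> int) \<Rightarrow> (nat \<Rightarrow> nat) \<Rightarrow> int" where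
  "dotp n h x = (\<Sum>i<n. h i * int (x i))"

definition chi :: "nat \<Rightarrow> int \<Rightarrow> complex" where
  "chi q m = cis (2 * pi * of_int m / of_nat q)"

text \<open>If \<open>rho n A q = 0\<close> the quotient is 0, so that the norm bounds below hold
  for every such \<open>q\<close> too.\<close>

definition weyl :: "nat \<Rightarrow> (nat \<Rightarrow> (nat \<Rightarrow> nat) set) \<Rightarrow> nat \<Rightarrow> (nat \<Rightarrow> int) \<Rightarrow> complex" where
  "weyl n A q h = (\<Sum>x\<in>crt_set n A q. chi q (dotp n h x)) / of_nat (rho n A q)"

lemma chi_add: "chi q (m + k) = chi q m * chi q k"
  by (simp add: chi_def cis_mult add_divide_distrib distrib_left)

lemma chi_0 [simp]: "chi q 0 = 1"
  by (simp add: chi_def)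

lemma norm_chi [simp]: "cmod (chi q m) = 1"
  by (simp add: chi_def)

lemma cnj_chi: "cnj (chi q m) = chi q (- m)"
  by (simp add: chi_def cis_cnj)

lemma chi_mult_period: "q > 0 \<Longrightarrow> chi q (int q * m) = 1"
proof -
  assume "q > 0"
  then have "2 * pi * of_int (int q * m) / of_nat q = 2 * pi * of_int m" by simp
  then show ?thesis unfolding chi_def by (simp only: cis_multiple_2pi[OF Ints_of_int])
qed

lemma chi_cong: "q > 0 \<Longrightarrow> int q dvd (m - k) \<Longrightarrow> chi q m = chi q k"
proof -
  assume q: "q > 0" "int q dvd (m - k)"
  then obtain t where "m = k + int q * t" by (metis add.commute diff_add_cancel dvdE)
  then show ?thesis using q by (simp add: chi_add chi_mult_period)
qed

lemma chi_eq_1_iff: "q > 0 \<Longrightarrow> chi q m = 1 \<longleftrightarrow> int q dvd m"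
proof
  assume q: "q > 0" and "chi q m = 1"
  then have "cos (2 * pi * of_int m / of_nat q) = 1" by (simp add: chi_def complex_eq_iff)
  then obtain t :: int where "2 * pi * of_int m / of_nat q = of_int t * 2 * pi" by (auto simp: cos_one_2pi_int)
  then have "real_of_int m = of_int t * of_nat q" using q by (simp add: field_simps)
  then have "m = t * int q" by (metis of_int_eq_iff of_int_mult of_int_of_nat_eq)
  then show "int q dvd m" by simp
next
  assume "q > 0" "int q dvd m" then show "chi q m = 1" using chi_cong[of q m 0] by simp
qed

lemma chi_power: "chi q m ^ a = chi q (int a * m)"
  by (induction a) (simp_all add: chi_add algebra_simps)

lemma sum_chi:
  assumes "q > 0"
  shows "(\<Sum>a<q. chi q (int a * m)) = (if int q dvd m then of_nat q else 0)"
proof (cases "int q dvd m")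
  case True
  then have "chi q (int a * m) = 1" for a using assms by (simp add: chi_eq_1_iff)
  then show ?thesis using True by simp
next
  case False
  then have "chi q m \<noteq> 1" using assms by (simp add: chi_eq_1_iff)
  moreover have "(\<Sum>a<q. chi q (int a * m)) = (\<Sum>a<q. chi q m ^ a)" by (simp add: chi_power)
  moreover have "chi q m ^ q = 1" using assms by (simp add: chi_power chi_mult_period)
  ultimately show ?thesis using False by (simp add: geometric_sum)
qed

text \<open>Partial fractions: \<open>1 / (u * s)\<close> is congruent to
  \<open>s' / u + u' / s\<close> modulo 1.\<close>

lemma chi_mult_modulus:
  assumes "u > 0" "s > 0" "int (u * s) dvd (int s * s' + int u * u' - 1)"
  shows "chi (u * s) m = chi u (s' * m) * chi s (u' * m)"
proof -
  have "chi u (s' * m) = chi (u * s) (int s * (s' * m))" "chi s (u' * m) = chi (u * s) (int u * (u' * m))"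
    using assms by (simp_all add: chi_def mult.assoc)
  then have "chi u (s' * m) * chi s (u' * m) = chi (u * s) (int s * (s' * m) + int u * (u' * m))"
    by (simp add: chi_add)
  also have "\<dots> = chi (u * s) m"
  proof (rule chi_cong)
    have "int s * (s' * m) + int u * (u' * m) - m = (int s * s' + int u * u' - 1) * m" by (simp add: algebra_simps)
    then show "int (u * s) dvd int s * (s' * m) + int u * (u' * m) - m" using assms by (metis dvd_mult2)
  qed (use assms in auto)
  finally show ?thesis by simp
qed

section \<open>The Chinese remainder theorem for residue vectors and Weyl sums\<close>

lemma finite_residue_vecs [simp]: "finite (residue_vecs n q)"
  by (simp add: residue_vecs_def finite_PiE)

lemma finite_crt_set [simp]: "finite (crt_set n A q)"
  by (rule finite_subset[OF _ finite_residue_vecs]) (auto simp: crt_set_def)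

lemma reduce_vec_residue: "q > 0 \<Longrightarrow> reduce_vec n q x \<in> residue_vecs n q"
  by (auto simp: reduce_vec_def residue_vecs_def)

lemma reduce_vec_reduce_vec: "d dvd u \<Longrightarrow> reduce_vec n d (reduce_vec n u x) = reduce_vec n d x"
  by (auto simp: reduce_vec_def mod_mod_cancel)

lemma dotp_reduce: "int u dvd (dotp n h x - dotp n h (reduce_vec n u x))"
proof -
  have "dotp n h x - dotp n h (reduce_vec n u x) = (\<Sum>i<n. h i * int (x i) - h i * int (x i mod u))"
    by (simp add: dotp_def reduce_vec_def sum_subtractf)
  also have "int u dvd \<dots>"
  proof (rule dvd_sum)
    fix i
    have "int (x i) - int (x i mod u) = int u * int (x i div u)"
      by (metis add_diff_cancel_right' mult_div_mod_eq of_nat_add of_nat_mult)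
    then show "int u dvd h i * int (x i) - h i * int (x i mod u)"
      by (metis dvd_mult dvd_triv_left right_diff_distrib)
  qed
  finally show ?thesis .
qed

lemma multiplicity_coprime_mult:
  assumes "coprime u s" "p \<in> prime_factors u" "u > 0" "s > (0::nat)"
  shows "multiplicity p (u * s) = multiplicity p u"
proof -
  have p: "prime p" "p dvd u" using assms by auto
  then have "\<not> p dvd s" using assms(1) by (meson coprime_common_divisor not_prime_unit)
  then show ?thesis using p assms
    by (simp add: prime_elem_multiplicity_mult_distrib not_dvd_imp_multiplicity_0)
qed

lemma prime_power_multiplicity_dvd: "p ^ multiplicity p u dvd (u::nat)"
  by (rule multiplicity_dvd)

lemma crt_set_mult_iff:
  assumes "coprime u s" "u > 0" "s > 0" "x \<in> residue_vecs n (u * s)"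
  shows "x \<in> crt_set n A (u * s) \<longleftrightarrow> reduce_vec n u x \<in> crt_set n A u \<and> reduce_vec n s x \<in> crt_set n A s"
proof -
  have *: "reduce_vec n u x \<in> crt_set n A u \<longleftrightarrow> (\<forall>p\<in>prime_factors u. reduce_vec n (p ^ multiplicity p (u * s)) x \<in> A (p ^ multiplicity p (u * s)))"
    if "coprime u s" "u > 0" "s > 0" for u s
    using that by (auto simp: crt_set_def reduce_vec_residue reduce_vec_reduce_vec prime_power_multiplicity_dvd multiplicity_coprime_mult)
  have "prime_factors (u * s) = prime_factors u \<union> prime_factors s"
    using assms by (intro prime_factors_product) auto
  then show ?thesis
    using *[OF assms(1-3)] *[of s u] assms by (auto simp: crt_set_def coprime_commute mult.commute)
qed

lemma bij_betw_crt_set: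
  assumes "coprime u s" "u > 0" "s > 0"
  shows "bij_betw (\<lambda>x. (reduce_vec n u x, reduce_vec n s x)) (crt_set n A (u * s)) (crt_set n A u \<times> crt_set n A s)"
  unfolding bij_betw_def
proof (intro conjI)
  let ?f = "\<lambda>x. (reduce_vec n u x, reduce_vec n s x)"
  show "inj_on ?f (crt_set n A (u * s))"
  proof (rule inj_onI)
    fix x y assume x: "x \<in> crt_set n A (u * s)" and y: "y \<in> crt_set n A (u * s)" and e: "?f x = ?f y"
    show "x = y"
    proof
      fix i show "x i = y i"
      proof (cases "i < n")
        case True
        have "x i mod u = y i mod u" "x i mod s = y i mod s"
          using e True by (auto simp: reduce_vec_def restrict_def fun_eq_iff split: if_splits)
        then have "[x i = y i] (mod (u * s))" using assms by (metis cong_def coprime_cong_mult_nat)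
        moreover have "x i < u * s" "y i < u * s" using x y True by (auto simp: crt_set_def residue_vecs_def PiE_def Pi_def)
        ultimately show ?thesis by (simp add: cong_def)
      next
        case False
        then show ?thesis using x y by (auto simp: crt_set_def residue_vecs_def PiE_def extensional_def)
      qed
    qed
  qed
  show "?f ` crt_set n A (u * s) = crt_set n A u \<times> crt_set n A s"
  proof (intro equalityI subsetI)
    fix z assume "z \<in> ?f ` crt_set n A (u * s)"
    then obtain x where x: "x \<in> crt_set n A (u * s)" "z = ?f x" by auto
    then have "x \<in> residue_vecs n (u * s)" by (auto simp: crt_set_def)
    then show "z \<in> crt_set n A u \<times> crt_set n A s" using x crt_set_mult_iff[OF assms, of x n A] by auto
  next
    fix z assume "z \<in> crt_set n A u \<times> crt_set n A s"
    then obtain a b where ab: "z = (a, b)" "a \<in> crt_set n A u" "b \<in> crt_set n A s" by auto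
    have ex: "\<exists>c. c < u * s \<and> c mod u = a i mod u \<and> c mod s = b i mod s" for i
    proof -
      obtain c where "c < u * s" "[c = a i] (mod u)" "[c = b i] (mod s)"
        using binary_chinese_remainder_unique_nat[OF assms(1), of "a i" "b i"] assms by auto
      then show ?thesis by (auto simp: cong_def)
    qed
    then obtain c where c: "c i < u * s" "c i mod u = a i mod u" "c i mod s = b i mod s" for i by metis
    define x where "x = restrict c {..<n}"
    have xr: "x \<in> residue_vecs n (u * s)" using c by (auto simp: x_def residue_vecs_def)
    have "reduce_vec n u x = a"
    proof
      fix i show "reduce_vec n u x i = a i"
        using ab(2) c[of i] by (cases "i < n") (auto simp: reduce_vec_def x_def crt_set_def residue_vecs_def PiE_def Pi_def extensional_def)
    qed
    moreover have "reduce_vec n s x = b"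
    proof
      fix i show "reduce_vec n s x i = b i"
        using ab(3) c[of i] by (cases "i < n") (auto simp: reduce_vec_def x_def crt_set_def residue_vecs_def PiE_def Pi_def extensional_def)
    qed
    ultimately have "?f x = z" "x \<in> crt_set n A (u * s)"
      using crt_set_mult_iff[OF assms xr, of A] ab by auto
    then show "z \<in> ?f ` crt_set n A (u * s)" by blast
  qed
qed

lemma rho_mult: "coprime u s \<Longrightarrow> u > 0 \<Longrightarrow> s > 0 \<Longrightarrow> rho n A (u * s) = rho n A u * rho n A s"
  unfolding rho_def using bij_betw_same_card[OF bij_betw_crt_set] by (metis card_cartesian_product)

lemma rho_1: "rho n A 1 = 1"
proof -
  have "crt_set n A 1 = {restrict (\<lambda>_. 0) {..<n}}"
    unfolding crt_set_def residue_vecs_def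
    by (auto simp: PiE_def extensional_def fun_eq_iff restrict_def Pi_def)
  then show ?thesis by (simp add: rho_def)
qed

lemma norm_weyl_le_1: "cmod (weyl n A q h) \<le> 1"
proof -
  have "cmod (\<Sum>x\<in>crt_set n A q. chi q (dotp n h x)) \<le> (\<Sum>x\<in>crt_set n A q. 1)"
    by (rule order_trans[OF norm_sum]) simp
  then show ?thesis by (auto simp: weyl_def norm_divide rho_def divide_le_eq_1)
qed

text \<open>The sum modulo \<open>u * s\<close> is a product of sums modulo \<open>u\<close> and
  modulo \<open>s\<close>, each frequency being multiplied by the inverse of the other modulus. The
  second factor is bounded by 1, so \<open>s\<close> enters only through its inverse
  \<open>s'\<close> modulo \<open>u\<close>.\<close>

lemma norm_weyl_mult_le:
  assumes "coprime u s" "u > 0" "s > 0" "int u dvd (int s * s' - 1)"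
  shows "cmod (weyl n A (u * s) h) \<le> cmod (weyl n A u (\<lambda>i. s' * h i))"
proof -
  from assms(1) have "coprime (int u) (int s)" by simp
  then obtain u' where u': "[int u * u' = 1] (mod int s)" using cong_solve_coprime_int by blast
  have "int s dvd int s * s' + int u * u' - 1" using u' by (auto simp: cong_iff_dvd_diff dvd_add_right_iff[of _ "int s * s'"] add_diff_eq[symmetric])
  moreover have "int u dvd int s * s' + int u * u' - 1"
    using assms(4) by (metis add_diff_eq add.commute dvd_add dvd_triv_left)
  ultimately have d: "int (u * s) dvd int s * s' + int u * u' - 1"
    using \<open>coprime (int u) (int s)\<close> by (simp add: divides_mult)
  have dm: "dotp n (\<lambda>i. c * h i) x = c * dotp n h x" for c x
    by (simp add: dotp_def sum_distrib_left mult.assoc)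
  have "(\<Sum>x\<in>crt_set n A (u * s). chi (u * s) (dotp n h x)) =
        (\<Sum>x\<in>crt_set n A (u * s). (\<lambda>(a, b). chi u (s' * dotp n h a) * chi s (u' * dotp n h b)) (reduce_vec n u x, reduce_vec n s x))"
  proof (intro sum.cong refl)
    fix x
    have "chi u (s' * dotp n h x) = chi u (s' * dotp n h (reduce_vec n u x))" for s' u
    proof (cases "u = 0")
      case False
      then show ?thesis by (intro chi_cong) (auto simp: right_diff_distrib[symmetric] intro!: dvd_mult dotp_reduce)
    qed (simp add: chi_def)
    then show "chi (u * s) (dotp n h x) = (\<lambda>(a, b). chi u (s' * dotp n h a) * chi s (u' * dotp n h b)) (reduce_vec n u x, reduce_vec n s x)"
      unfolding chi_mult_modulus[OF assms(2,3) d] by auto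
  qed
  also have "\<dots> = (\<Sum>(a,b)\<in>crt_set n A u \<times> crt_set n A s. chi u (s' * dotp n h a) * chi s (u' * dotp n h b))"
    by (rule sum.reindex_bij_betw[OF bij_betw_crt_set[OF assms(1-3)]])
  also have "\<dots> = (\<Sum>a\<in>crt_set n A u. chi u (s' * dotp n h a)) * (\<Sum>b\<in>crt_set n A s. chi s (u' * dotp n h b))"
    by (simp add: sum_product sum.cartesian_product)
  finally have "weyl n A (u * s) h = weyl n A u (\<lambda>i. s' * h i) * weyl n A s (\<lambda>i. u' * h i)"
    unfolding weyl_def dm rho_mult[OF assms(1-3)] by simp
  then show ?thesis
    using norm_weyl_le_1[of n A s "\<lambda>i. u' * h i"] by (simp add: norm_mult mult_left_le)
qed

section \<open>Moments of Weyl sums over all multiples of a frequency\<close>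

text \<open>By orthogonality the left side counts, up to normalisation, the pairs \<open>x\<close>,
  \<open>y\<close> with \<open>dotp n h x\<close> and \<open>dotp n h y\<close> congruent modulo
  \<open>u\<close>. For fixed \<open>x\<close> the admissible \<open>y\<close> form one fibre, which
  \<open>F\<close> controls.\<close>

lemma weyl_second_moment:
  fixes F :: real
  assumes "u > 0" "\<And>c. real (card {y\<in>crt_set n A u. int u dvd (dotp n h y - c)}) \<le> F * real (rho n A u)" "0 \<le> F"
  shows "(\<Sum>a<u. cmod (weyl n A u (\<lambda>i. int a * h i)) ^ 2) \<le> real u * F"
proof (cases "rho n A u = 0")
  case True
  then show ?thesis using assms by (simp add: weyl_def)
next
  case False
  let ?R = "crt_set n A u"
  have dm: "dotp n (\<lambda>i. c * h i) x = c * dotp n h x" for c x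
    by (simp add: dotp_def sum_distrib_left mult.assoc)
  have "complex_of_real (\<Sum>a<u. cmod (\<Sum>x\<in>?R. chi u (int a * dotp n h x)) ^ 2) =
     (\<Sum>a<u. (\<Sum>x\<in>?R. chi u (int a * dotp n h x)) * cnj (\<Sum>x\<in>?R. chi u (int a * dotp n h x)))"
    by (simp only: of_real_sum complex_norm_square)
  also have "\<dots> = (\<Sum>a<u. \<Sum>x\<in>?R. \<Sum>y\<in>?R. chi u (int a * (dotp n h y - dotp n h x)))"
  proof (intro sum.cong refl)
    fix a
    have "(\<Sum>x\<in>?R. chi u (int a * dotp n h x)) * cnj (\<Sum>x\<in>?R. chi u (int a * dotp n h x)) =
      (\<Sum>y\<in>?R. \<Sum>x\<in>?R. chi u (int a * (dotp n h y - dotp n h x)))"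
      by (simp add: sum_product cnj_chi chi_add[symmetric] right_diff_distrib)
    also have "\<dots> = (\<Sum>x\<in>?R. \<Sum>y\<in>?R. chi u (int a * (dotp n h y - dotp n h x)))" by (rule sum.swap)
    finally show "(\<Sum>x\<in>?R. chi u (int a * dotp n h x)) * cnj (\<Sum>x\<in>?R. chi u (int a * dotp n h x)) = (\<Sum>x\<in>?R. \<Sum>y\<in>?R. chi u (int a * (dotp n h y - dotp n h x)))" .
  qed
  also have "\<dots> = (\<Sum>x\<in>?R. \<Sum>y\<in>?R. \<Sum>a<u. chi u (int a * (dotp n h y - dotp n h x)))"
    by (subst sum.swap, rule sum.cong[OF refl], rule sum.swap)
  also have "\<dots> = (\<Sum>x\<in>?R. \<Sum>y\<in>?R. if int u dvd (dotp n h y - dotp n h x) then of_nat u else 0)"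
    using assms(1) by (simp add: sum_chi)
  also have "\<dots> = (\<Sum>x\<in>?R. \<Sum>y\<in>{y\<in>?R. int u dvd (dotp n h y - dotp n h x)}. of_nat u)"
    by (intro sum.cong refl sum.inter_filter[symmetric]) simp
  also have "\<dots> = complex_of_real (\<Sum>x\<in>?R. real u * real (card {y\<in>?R. int u dvd (dotp n h y - dotp n h x)}))"
    by (simp add: mult.commute)
  finally have "(\<Sum>a<u. cmod (\<Sum>x\<in>?R. chi u (int a * dotp n h x)) ^ 2) =
     (\<Sum>x\<in>?R. real u * real (card {y\<in>?R. int u dvd (dotp n h y - dotp n h x)}))"
    by (simp only: of_real_eq_iff)
  also have "\<dots> \<le> (\<Sum>x\<in>?R. real u * (F * real (rho n A u)))"
    by (intro sum_mono mult_left_mono assms) auto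
  also have "\<dots> = real u * F * real (rho n A u) ^ 2" by (simp add: rho_def power2_eq_square)
  finally have "(\<Sum>a<u. cmod (\<Sum>x\<in>?R. chi u (int a * dotp n h x)) ^ 2) / real (rho n A u) ^ 2 \<le> real u * F"
    using False by (simp add: divide_le_eq)
  then show ?thesis
    unfolding weyl_def dm norm_divide power_divide norm_of_nat sum_divide_distrib[symmetric] .
qed

text \<open>An upper bound for the proportion of \<open>A (p ^ v)\<close> on which
  \<open>dotp n h\<close> takes a given value modulo \<open>p ^ v\<close>. Hyperplanes give
  information only for \<open>v = 1\<close> and \<open>h\<close> nonzero modulo \<open>p\<close>;
  otherwise the bound is trivial. It is a bound for a mean square, hence the name.\<close>

definition gsq :: "nat \<Rightarrow> (nat \<Rightarrow> (nat \<Rightarrow> nat) set) \<Rightarrow> (nat \<Rightarrow> int) \<Rightarrow> nat \<Rightarrow> nat \<Rightarrow> real" where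
  "gsq n A h p v = (if v = 1 \<and> \<not> (\<forall>i<n. int p dvd h i) then real (lam n A p) / real (rho n A p) else 1)"

text \<open>Induction for multiplicative functions: one prime is split off to its full power, which
  leaves a smaller coprime cofactor.\<close>

lemma prime_power_nat_induct [consumes 1, case_names one prime_power mult]:
  fixes u :: nat
  assumes "u > 0" "P 1" "\<And>p v. prime p \<Longrightarrow> v \<ge> 1 \<Longrightarrow> P (p ^ v)"
    "\<And>a b. a > 0 \<Longrightarrow> b > 0 \<Longrightarrow> coprime a b \<Longrightarrow> P a \<Longrightarrow> P b \<Longrightarrow> P (a * b)"
  shows "P u"
  using assms(1)
proof (induction u rule: less_induct)
  case (less u)
  show ?case
  proof (cases "u = 1")
    case False
    then obtain p where p: "prime p" "p dvd u" using prime_factor_nat by blast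
    define v where "v = multiplicity p u"
    have v1: "v \<ge> 1" unfolding v_def using p less.prems by (simp add: Suc_le_eq prime_multiplicity_gt_zero_iff)
    obtain w where w: "u = p ^ v * w" "\<not> p dvd w"
      unfolding v_def using multiplicity_decompose'[of u p] less.prems p by (metis not_prime_unit not_gr_zero)
    have w0: "w > 0" using w less.prems by (cases w) auto
    have "p ^ v > 1" using p v1 by (metis not_less_eq_eq One_nat_def one_less_power prime_gt_1_nat le_eq_less_or_eq zero_less_one less_le_trans)
    then have "w < u" using w w0 by simp
    have "coprime (p ^ v) w" using w p by (simp add: prime_imp_coprime)
    then show ?thesis using assms(3)[OF p(1) v1] assms(4)[of "p^v" w] less.IH[OF \<open>w < u\<close> w0] w w0 p
      by (simp add: prime_gt_0_nat)
  qed (use assms in simp)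
qed

lemma prod_prime_factors_mult:
  assumes "coprime a b" "a > 0" "b > (0::nat)"
  shows "(\<Prod>p\<in>prime_factors (a * b). f p (multiplicity p (a * b))) =
     (\<Prod>p\<in>prime_factors a. f p (multiplicity p a)) * (\<Prod>p\<in>prime_factors b. (f p (multiplicity p b) :: 'c :: comm_monoid_mult))"
proof -
  have "prime_factors (a * b) = prime_factors a \<union> prime_factors b"
    using assms by (intro prime_factors_product) auto
  moreover have "prime_factors a \<inter> prime_factors b = {}"
    using assms(1) coprime_common_divisor[of a b] not_prime_unit
    by (metis disjoint_iff in_prime_factors_iff)
  ultimately have "(\<Prod>p\<in>prime_factors (a * b). f p (multiplicity p (a * b))) =
     (\<Prod>p\<in>prime_factors a. f p (multiplicity p (a * b))) * (\<Prod>p\<in>prime_factors b. f p (multiplicity p (a * b)))"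
    by (simp add: prod.union_disjoint)
  also have "(\<Prod>p\<in>prime_factors a. f p (multiplicity p (a * b))) = (\<Prod>p\<in>prime_factors a. f p (multiplicity p a))"
    using assms by (intro prod.cong refl) (simp add: multiplicity_coprime_mult)
  also have "(\<Prod>p\<in>prime_factors b. f p (multiplicity p (a * b))) = (\<Prod>p\<in>prime_factors b. f p (multiplicity p b))"
    using assms by (intro prod.cong refl) (simp add: mult.commute[of a b] multiplicity_coprime_mult coprime_commute)
  finally show ?thesis .
qed

lemma finite_affine_hyperplanes: "finite (affine_hyperplanes n p)"
  by (rule finite_subset[of _ "Pow (residue_vecs n p)"]) (auto simp: affine_hyperplanes_def)

lemma card_hyperplane_le_lam: "H \<in> affine_hyperplanes n p \<Longrightarrow> card (H \<inter> crt_set n A p) \<le> lam n A p"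
  unfolding lam_def using finite_affine_hyperplanes by (intro Max_ge) auto

lemma affine_hyperplanes_nonempty: "1 \<le> n \<Longrightarrow> 2 \<le> p \<Longrightarrow> affine_hyperplanes n p \<noteq> {}"
proof -
  assume n: "1 \<le> n" "2 \<le> p"
  have "(\<lambda>i\<in>{..<n}. 1) \<in> residue_vecs n p" using n by (auto simp: residue_vecs_def)
  moreover have "\<exists>i<n. (\<lambda>i\<in>{..<n}. 1 :: nat) i \<noteq> 0" using n by (intro exI[of _ 0]) auto
  ultimately have "{x \<in> residue_vecs n p. (\<Sum>i<n. (\<lambda>i\<in>{..<n}. 1) i * x i) mod p = 0} \<in> affine_hyperplanes n p"
    using n unfolding affine_hyperplanes_def by (intro CollectI exI[of _ "\<lambda>i\<in>{..<n}. 1"] exI[of _ 0]) auto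
  then show ?thesis by blast
qed

lemma lam_le_rho: "1 \<le> n \<Longrightarrow> 2 \<le> p \<Longrightarrow> lam n A p \<le> rho n A p"
  unfolding lam_def rho_def using finite_affine_hyperplanes affine_hyperplanes_nonempty
  by (subst Max_le_iff) (auto intro!: card_mono)

lemma card_fiber_prime_le:
  assumes "prime p" "\<not> (\<forall>i<n. int p dvd h i)"
  shows "card {y\<in>crt_set n A p. int p dvd (dotp n h y - c)} \<le> lam n A p"
proof -
  have p: "p > 0" using assms by (simp add: prime_gt_0_nat)
  \<comment> \<open>\<open>affine_hyperplanes\<close> is formulated with natural representatives, so
    the integers \<open>h i\<close> and \<open>c\<close> are reduced modulo \<open>p\<close>
    first.\<close>
  define g where "g = (\<lambda>i\<in>{..<n}. nat (h i mod int p))"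
  define a where "a = nat (c mod int p)"
  have g: "g \<in> residue_vecs n p" using p by (auto simp: g_def residue_vecs_def nat_less_iff)
  have a: "a < p" using p by (simp add: a_def nat_less_iff)
  obtain i where i: "i < n" "\<not> int p dvd h i" using assms by auto
  then have "h i mod int p > 0" using p by (simp add: dvd_eq_mod_eq_0 order.not_eq_order_implies_strict)
  then have gi: "\<exists>i<n. g i \<noteq> 0" using i by (intro exI[of _ i]) (simp add: g_def)
  let ?H = "{x \<in> residue_vecs n p. (\<Sum>i<n. g i * x i) mod p = a}"
  have "?H \<in> affine_hyperplanes n p" unfolding affine_hyperplanes_def using g gi a by blast
  moreover have "{y\<in>crt_set n A p. int p dvd (dotp n h y - c)} \<subseteq> ?H \<inter> crt_set n A p"
  proof (rule subsetI)
    fix y assume "y \<in> {y\<in>crt_set n A p. int p dvd (dotp n h y - c)}"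
    then have y: "y \<in> crt_set n A p" "int p dvd (dotp n h y - c)" by auto
    have "int ((\<Sum>i<n. g i * y i) mod p) = (\<Sum>i<n. (h i mod int p) * int (y i)) mod int p"
      using p by (simp add: zmod_int g_def)
    also have "\<dots> = (\<Sum>i<n. ((h i mod int p) * int (y i)) mod int p) mod int p" by (simp add: mod_sum_eq)
    also have "\<dots> = (\<Sum>i<n. (h i * int (y i)) mod int p) mod int p" by (simp add: mod_mult_left_eq)
    also have "\<dots> = dotp n h y mod int p" by (simp add: mod_sum_eq dotp_def)
    also have "\<dots> = c mod int p" using y by (simp add: mod_eq_dvd_iff)
    also have "\<dots> = int a" using p by (simp add: a_def)
    finally have "(\<Sum>i<n. g i * y i) mod p = a" by (simp only: of_nat_eq_iff)
    then show "y \<in> ?H \<inter> crt_set n A p" using y by (simp add: crt_set_def)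
  qed
  then have "card {y\<in>crt_set n A p. int p dvd (dotp n h y - c)} \<le> card (?H \<inter> crt_set n A p)"
    by (intro card_mono) auto
  ultimately show ?thesis using card_hyperplane_le_lam le_trans by blast
qed

text \<open>The Chinese remainder map sends a fibre modulo \<open>a * b\<close> injectively into the
  product of the fibres over the same \<open>c\<close>. The bound is thus multiplicative, and only
  primes require hyperplanes.\<close>

lemma card_fiber_le:
  assumes "u > 0"
  shows "real (card {y\<in>crt_set n A u. int u dvd (dotp n h y - c)})
    \<le> (\<Prod>p\<in>prime_factors u. gsq n A h p (multiplicity p u)) * real (rho n A u)"
  using assms
proof (induction u arbitrary: c rule: prime_power_nat_induct)
  case one
  show ?case by (simp add: rho_def)
next
  case (prime_power p v)
  then have pf: "prime_factors (p ^ v) = {p}" by (auto simp: prime_factorization_prime_power)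
  have m: "multiplicity p (p ^ v) = v" using prime_power by simp
  have triv: "card {y\<in>crt_set n A (p^v). int (p^v) dvd (dotp n h y - c)} \<le> rho n A (p^v)"
    unfolding rho_def by (intro card_mono) auto
  show ?case
  proof (cases "v = 1 \<and> \<not> (\<forall>i<n. int p dvd h i)")
    case True
    have "card {y\<in>crt_set n A p. int p dvd (dotp n h y - c)} \<le> lam n A p"
      using card_fiber_prime_le prime_power True by blast
    then show ?thesis using True pf m triv by (auto simp: gsq_def)
  next
    case False
    then show ?thesis using triv m unfolding pf by (auto simp: gsq_def)
  qed
next
  case (mult a b)
  let ?N = "\<lambda>u. {y\<in>crt_set n A u. int u dvd (dotp n h y - c)}"
  have "card (?N (a * b)) \<le> card (?N a \<times> ?N b)"
  proof (rule card_inj_on_le)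
    have bij: "bij_betw (\<lambda>x. (reduce_vec n a x, reduce_vec n b x)) (crt_set n A (a * b)) (crt_set n A a \<times> crt_set n A b)"
      by (rule bij_betw_crt_set) (use mult in auto)
    show "inj_on (\<lambda>x. (reduce_vec n a x, reduce_vec n b x)) (?N (a * b))"
      using bij by (auto simp: bij_betw_def intro: inj_on_subset)
    show "(\<lambda>x. (reduce_vec n a x, reduce_vec n b x)) ` ?N (a * b) \<subseteq> ?N a \<times> ?N b"
    proof (rule image_subsetI)
      fix x assume x: "x \<in> ?N (a * b)"
      have "int d dvd dotp n h (reduce_vec n d x) - c" if "int d dvd dotp n h x - c" for d
        using dvd_diff[OF that dotp_reduce[of d n h x]] by simp
      moreover have "int a dvd dotp n h x - c" "int b dvd dotp n h x - c"
        using x by (auto dest: dvd_mult_left dvd_mult_right)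
      moreover have "reduce_vec n a x \<in> crt_set n A a" "reduce_vec n b x \<in> crt_set n A b"
        using bij x by (auto simp: bij_betw_def)
      ultimately show "(reduce_vec n a x, reduce_vec n b x) \<in> ?N a \<times> ?N b" by simp
    qed
  qed auto
  then have "real (card (?N (a * b))) \<le> real (card (?N a)) * real (card (?N b))"
    by (simp add: card_cartesian_product flip: of_nat_mult)
  also have "\<dots> \<le> ((\<Prod>p\<in>prime_factors a. gsq n A h p (multiplicity p a)) * real (rho n A a)) *
     ((\<Prod>p\<in>prime_factors b. gsq n A h p (multiplicity p b)) * real (rho n A b))"
    using mult.IH by (intro mult_mono) (auto intro!: mult_nonneg_nonneg prod_nonneg simp: gsq_def)
  finally show ?case using mult by (simp add: prod_prime_factors_mult rho_mult mult_ac)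
qed

lemma rho_prod: "q > 0 \<Longrightarrow> rho n A q = (\<Prod>p\<in>prime_factors q. rho n A (p ^ multiplicity p q))"
proof (induction q rule: prime_power_nat_induct)
  case one show ?case using rho_1[of n A] by simp
next
  case (prime_power p v)
  then have pf: "prime_factors (p ^ v) = {p}" by (auto simp: prime_factorization_prime_power)
  have m: "multiplicity p (p ^ v) = v" using prime_power by simp
  show ?case unfolding pf by (simp add: m)
next
  case (mult a b)
  then show ?case
    by (simp add: prod_prime_factors_mult[where f = "\<lambda>p v. rho n A (p ^ v)"] rho_mult)
qed

text \<open>Membership is decided at the exact prime powers; \<open>p\<close> itself may lie outside
  \<open>Q_set n A\<close> although \<open>p ^ v\<close> lies inside.\<close>

lemma Q_set_iff: "q \<in> Q_set n A \<longleftrightarrow> q > 0 \<and> (\<forall>p\<in>prime_factors q. p ^ multiplicity p q \<in> Q_set n A)"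
proof (cases "q > 0")
  case True
  have "1 \<le> rho n A q \<longleftrightarrow> (\<forall>p\<in>prime_factors q. 1 \<le> rho n A (p ^ multiplicity p q))"
  proof -
    have "rho n A q = 0 \<longleftrightarrow> (\<exists>p\<in>prime_factors q. rho n A (p ^ multiplicity p q) = 0)"
      unfolding rho_prod[OF True] by (rule prod_zero_iff) simp
    then show ?thesis by (auto simp: Suc_le_eq)
  qed
  then show ?thesis using True by (auto simp: Q_set_def Suc_le_eq in_prime_factors_imp_prime prime_gt_0_nat)
qed (auto simp: Q_set_def)

lemma sqrt_prod: "sqrt (\<Prod>x\<in>I. f x) = (\<Prod>x\<in>I. sqrt (f x))"
  by (induction I rule: infinite_finite_induct) (simp_all add: real_sqrt_mult)

text \<open>Cauchy-Schwarz passes from the second to the first moment; this is where the square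
  roots of the local proportions come from.\<close>

lemma sum_norm_weyl_le:
  assumes "u > 0"
  shows "(\<Sum>a<u. cmod (weyl n A u (\<lambda>i. int a * h i))) \<le> real u * (\<Prod>p\<in>prime_factors u. sqrt (gsq n A h p (multiplicity p u)))"
proof -
  let ?F = "\<Prod>p\<in>prime_factors u. gsq n A h p (multiplicity p u)"
  have F: "0 \<le> ?F" by (intro prod_nonneg) (auto simp: gsq_def)
  have "(\<Sum>a<u. cmod (weyl n A u (\<lambda>i. int a * h i)) * 1) \<le> L2_set (\<lambda>a. cmod (weyl n A u (\<lambda>i. int a * h i))) {..<u} * L2_set (\<lambda>_. 1) {..<u}"
    using L2_set_mult_ineq[of "\<lambda>a. cmod (weyl n A u (\<lambda>i. int a * h i))" "\<lambda>_. 1" "{..<u}"] by simp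
  also have "\<dots> = sqrt (\<Sum>a<u. cmod (weyl n A u (\<lambda>i. int a * h i)) ^ 2) * sqrt (real u)"
    by (simp add: L2_set_def)
  also have "\<dots> \<le> sqrt (real u * ?F) * sqrt (real u)"
    by (intro mult_right_mono real_sqrt_le_mono weyl_second_moment card_fiber_le assms F) auto
  also have "\<dots> = real u * sqrt ?F" by (simp add: real_sqrt_mult)
  also have "sqrt ?F = (\<Prod>p\<in>prime_factors u. sqrt (gsq n A h p (multiplicity p u)))"
    by (rule sqrt_prod)
  finally show ?thesis by simp
qed

section \<open>A discrepancy inequality with finite Fourier analysis\<close>

text \<open>Residues of smallest absolute value: \<open>\<bar>h\<bar> / q\<close> is then the
  distance of \<open>h / q\<close> to the nearest integer, and coefficient bounds can decay in
  \<open>\<bar>h\<bar>\<close>.\<close>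

definition sres :: "nat \<Rightarrow> int set" where
  "sres q = {h. - int q < 2 * h \<and> 2 * h \<le> int q}"

lemma finite_sres [simp]: "finite (sres q)"
  by (rule finite_subset[of _ "{- int q..int q}"]) (auto simp: sres_def)

lemma zero_in_sres: "q > 0 \<Longrightarrow> 0 \<in> sres q"
  by (auto simp: sres_def)

lemma sum_chi_sres:
  assumes "q > 0"
  shows "(\<Sum>h\<in>sres q. chi q (h * m)) = (if int q dvd m then of_nat q else 0)"
proof -
  have "(\<Sum>h\<in>sres q. chi q (h * m)) = (\<Sum>a<q. chi q (int a * m))"
  proof (rule sum.reindex_bij_witness[of _ "\<lambda>a. if 2 * a \<le> q then int a else int a - int q" "\<lambda>h. nat (h mod int q)"])
    fix h assume h: "h \<in> sres q"
    show "nat (h mod int q) \<in> {..<q}" using assms by (simp add: nat_less_iff)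
    have "h mod int q = (if h \<ge> 0 then h else h + int q)"
    proof (cases "h \<ge> 0")
      case True then show ?thesis using h assms by (auto simp: sres_def intro!: mod_pos_pos_trivial)
    next
      case False
      have "(h + int q) mod int q = h + int q" using False h by (intro mod_pos_pos_trivial) (auto simp: sres_def)
      then show ?thesis using False by simp
    qed
    then show "(if 2 * nat (h mod int q) \<le> q then int (nat (h mod int q)) else int (nat (h mod int q)) - int q) = h"
      using h assms by (auto simp: sres_def split: if_splits)
    show "chi q (int (nat (h mod int q)) * m) = chi q (h * m)"
    proof (rule chi_cong)
      have "int (nat (h mod int q)) * m - h * m = (h mod int q - h) * m" using assms by (simp add: left_diff_distrib)
      moreover have "int q dvd h mod int q - h" by (simp add: mod_eq_dvd_iff[symmetric])
      ultimately show "int q dvd int (nat (h mod int q)) * m - h * m" by simp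
    qed (rule assms)
  next
    fix a assume a: "a \<in> {..<q}"
    then show "(if 2 * a \<le> q then int a else int a - int q) \<in> sres q" by (auto simp: sres_def)
    have "(int a - int q) mod int q = int a mod int q" by (rule minus_mod_self2)
    then show "nat ((if 2 * a \<le> q then int a else int a - int q) mod int q) = a" using a by auto
  qed
  then show ?thesis using sum_chi[OF assms] by simp
qed

text \<open>With \<open>x = pi m / q\<close> the left side is at most \<open>\<bar>x\<bar>\<close>
  and the right side is \<open>2 \<bar>sin x\<bar>\<close>. Here
  \<open>\<bar>x\<bar> \<le> pi / 2 < 1.6\<close>, and the Taylor remainder
  \<open>\<bar>x\<bar>^3 / 6\<close> is below \<open>\<bar>x\<bar> / 2\<close> because
  \<open>1.6^2 / 6 < 1/2\<close>.\<close>

lemma norm_chi_minus_1_ge: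
  assumes "q > 0" "2 * \<bar>m\<bar> \<le> int q"
  shows "2 * real_of_int \<bar>m\<bar> / real q \<le> cmod (chi q m - 1)"
proof -
  define x where "x = pi * real_of_int m / real q"
  have "2 * \<bar>real_of_int m\<bar> \<le> real q" using assms(2) by linarith
  then have "\<bar>x\<bar> \<le> pi / 2" unfolding x_def using assms(1) by (simp add: abs_mult field_simps)
  then have x: "\<bar>x\<bar> \<le> 1.6" using pi_less_4 pi_approx by simp
  have "\<bar>sin x - (\<Sum>m<3. sin_coeff m * x ^ m)\<bar> \<le> inverse (fact 3) * \<bar>x\<bar> ^ 3"
    by (rule Maclaurin_sin_bound)
  then have "\<bar>sin x - x\<bar> \<le> \<bar>x\<bar> * \<bar>x\<bar>\<^sup>2 / 6"
    by (simp add: eval_nat_numeral sin_coeff_def mult_ac)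
  also have "\<dots> \<le> \<bar>x\<bar> * (1.6\<^sup>2) / 6" using x by (intro divide_right_mono mult_left_mono power_mono) auto
  finally have "\<bar>sin x - x\<bar> \<le> \<bar>x\<bar> / 2" by (simp add: power2_eq_square)
  then have s: "\<bar>sin x\<bar> \<ge> \<bar>x\<bar> / 2" by linarith
  have "cmod (chi q m - 1) ^ 2 = (cos (2 * x) - 1)\<^sup>2 + (sin (2 * x))\<^sup>2"
    by (simp add: chi_def cmod_power2 x_def mult.assoc)
  also have "\<dots> = 2 - 2 * cos (2 * x)"
    using sin_cos_squared_add[of "2 * x"] by (simp add: power2_eq_square algebra_simps)
  also have "\<dots> = (2 * sin x)\<^sup>2" by (simp add: cos_double_sin power2_eq_square)
  finally have "cmod (chi q m - 1) ^ 2 = (2 * \<bar>sin x\<bar>)\<^sup>2" by (simp add: power2_eq_square)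
  then have e: "cmod (chi q m - 1) = 2 * \<bar>sin x\<bar>" by (metis abs_ge_zero mult_nonneg_nonneg norm_ge_zero power2_eq_imp_eq zero_le_numeral)
  have "2 * real_of_int \<bar>m\<bar> / real q \<le> pi * \<bar>real_of_int m\<bar> / real q"
    using mult_right_mono[OF pi_ge_two, of "\<bar>real_of_int m\<bar>"] by (intro divide_right_mono) auto
  also have "\<dots> = \<bar>x\<bar>" by (simp add: x_def abs_mult)
  finally show ?thesis using s e by linarith
qed

lemma norm_geometric_chi_le:
  assumes "q > 0" "h \<in> sres q" "h \<noteq> 0"
  shows "cmod (\<Sum>t<N. chi q (- h * int t)) \<le> real q / real_of_int \<bar>h\<bar>"
proof -
  define z where "z = chi q (- h)"
  have "2 * real_of_int \<bar>-h\<bar> / real q \<le> cmod (z - 1)" unfolding z_def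
    using assms by (intro norm_chi_minus_1_ge) (auto simp: sres_def)
  then have z: "2 * real_of_int \<bar>h\<bar> / real q \<le> cmod (z - 1)" by simp
  have pos: "0 < 2 * real_of_int \<bar>h\<bar> / real q" using assms by simp
  then have "z \<noteq> 1" using z by auto
  have "(\<Sum>t<N. chi q (- h * int t)) = (\<Sum>t<N. z ^ t)" by (simp add: z_def chi_power mult.commute)
  also have "\<dots> = (z ^ N - 1) / (z - 1)" using \<open>z \<noteq> 1\<close> by (rule geometric_sum)
  finally have "cmod (\<Sum>t<N. chi q (- h * int t)) = cmod (z ^ N - 1) / cmod (z - 1)" by (simp add: norm_divide)
  also have "\<dots> \<le> 2 / (2 * real_of_int \<bar>h\<bar> / real q)"
  proof (rule frac_le)
    have "cmod (z ^ N - 1) \<le> cmod (z ^ N) + cmod 1" by (rule norm_triangle_ineq4)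
    then show "cmod (z ^ N - 1) \<le> 2" by (simp add: z_def norm_power)
  qed (use pos z in auto)
  finally show ?thesis by simp
qed

text \<open>
  The indicator of \<open>N\<close> consecutive residues from \<open>s\<close>, convolved with the uniform distribution on
  \<open>{0..<L}\<close>: smoothing inside \<open>\<int>/q\<int>\<close> keeps all Fourier expansions finite, and the trapezoid
  lies above or below a given interval according to the choice of \<open>s\<close> and \<open>N\<close>.
\<close>

definition tent :: "nat \<Rightarrow> nat \<Rightarrow> int \<Rightarrow> nat \<Rightarrow> int \<Rightarrow> real" where
  "tent q L s N r = (\<Sum>l<L. \<Sum>t<N. if int q dvd (r - (s + int t + int l)) then 1 else 0) / real L"

definition tent_coeff :: "nat \<Rightarrow> nat \<Rightarrow> int \<Rightarrow> nat \<Rightarrow> int \<Rightarrow> complex" where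
  "tent_coeff q L s N h = (\<Sum>l<L. \<Sum>t<N. chi q (- h * (s + int t + int l))) / (of_nat q * of_nat L)"

text \<open>A common majorant for the Fourier coefficients of all trapezoids in use:
  \<open>1 / \<bar>h\<bar>\<close> comes from one geometric sum, \<open>1 / (h^2 \<eta>)\<close>
  from two, where \<open>\<eta>\<close> is the smoothing width relative to \<open>q\<close>. The
  value 3 at 0 allows for outer trapezoids, whose length may reach \<open>3 * q\<close>.\<close>

definition beta :: "real \<Rightarrow> int \<Rightarrow> real" where
  "beta \<eta> h = (if h = 0 then 3 else min (1 / real_of_int \<bar>h\<bar>) (1 / ((real_of_int h)\<^sup>2 * \<eta>)))"

lemma tent_nonneg: "0 \<le> tent q L s N r"
  unfolding tent_def by (intro divide_nonneg_nonneg sum_nonneg) auto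

lemma tent_expansion:
  assumes "q > 0"
  shows "complex_of_real (tent q L s N r) = (\<Sum>h\<in>sres q. tent_coeff q L s N h * chi q (h * r))"
proof -
  have "(\<Sum>h\<in>sres q. tent_coeff q L s N h * chi q (h * r)) =
     (\<Sum>h\<in>sres q. \<Sum>l<L. \<Sum>t<N. chi q (h * (r - (s + int t + int l)))) / (of_nat q * of_nat L)"
    unfolding sum_divide_distrib[of _ "sres q"]
  proof (rule sum.cong[OF refl])
    fix h
    have "(\<Sum>l<L. \<Sum>t<N. chi q (- h * (s + int t + int l))) * chi q (h * r) =
      (\<Sum>l<L. \<Sum>t<N. chi q (h * (r - (s + int t + int l))))"
      unfolding sum_distrib_right chi_add[symmetric] by (intro sum.cong refl arg_cong[of _ _ "chi q"]) (simp add: algebra_simps)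
    then show "tent_coeff q L s N h * chi q (h * r) =
      (\<Sum>l<L. \<Sum>t<N. chi q (h * (r - (s + int t + int l)))) / (of_nat q * of_nat L)"
      unfolding tent_coeff_def by simp
  qed
  also have "(\<Sum>h\<in>sres q. \<Sum>l<L. \<Sum>t<N. chi q (h * (r - (s + int t + int l)))) =
     (\<Sum>l<L. \<Sum>h\<in>sres q. \<Sum>t<N. chi q (h * (r - (s + int t + int l))))" by (rule sum.swap)
  also have "\<dots> = (\<Sum>l<L. \<Sum>t<N. \<Sum>h\<in>sres q. chi q (h * (r - (s + int t + int l))))"
    by (rule sum.cong[OF refl], rule sum.swap)
  also have "\<dots> = (\<Sum>l<L. \<Sum>t<N. of_nat q * complex_of_real (if int q dvd (r - (s + int t + int l)) then 1 else 0))"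
    unfolding sum_chi_sres[OF assms] by (intro sum.cong refl) auto
  also have "\<dots> / (of_nat q * of_nat L) = complex_of_real (tent q L s N r)"
    unfolding tent_def using assms by (simp add: sum_distrib_left[symmetric])
  finally show ?thesis by simp
qed

lemma tent_coeff_0: "q > 0 \<Longrightarrow> L > 0 \<Longrightarrow> tent_coeff q L s N 0 = of_real (real N / real q)"
  by (simp add: tent_coeff_def)

lemma norm_tent_coeff_le:
  assumes "q > 0" "L > 0" "h \<in> sres q" "real N \<le> 3 * real q" "0 < \<eta>" "\<eta> * real q \<le> real L"
  shows "cmod (tent_coeff q L s N h) \<le> beta \<eta> h"
proof (cases "h = 0")
  case True
  then show ?thesis using assms by (simp add: tent_coeff_0 beta_def field_simps norm_divide)
next
  case False
  have "(\<Sum>l<L. \<Sum>t<N. chi q (- h * (s + int t + int l))) =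
    chi q (- h * s) * ((\<Sum>l<L. chi q (- h * int l)) * (\<Sum>t<N. chi q (- h * int t)))"
  proof -
    have "(\<Sum>l<L. \<Sum>t<N. chi q (- h * (s + int t + int l))) =
      (\<Sum>l<L. \<Sum>t<N. chi q (- h * s) * (chi q (- h * int l) * chi q (- h * int t)))"
      unfolding chi_add[symmetric]
      by (intro sum.cong refl arg_cong[of _ _ "chi q"]) (simp add: algebra_simps)
    also have "\<dots> = chi q (- h * s) * ((\<Sum>l<L. chi q (- h * int l)) * (\<Sum>t<N. chi q (- h * int t)))"
      by (subst sum_product) (simp only: sum_distrib_left)
    finally show ?thesis .
  qed
  then have e: "cmod (tent_coeff q L s N h) =
     cmod (\<Sum>l<L. chi q (- h * int l)) * cmod (\<Sum>t<N. chi q (- h * int t)) / (real q * real L)"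
    unfolding tent_coeff_def by (simp add: norm_mult norm_divide)
  let ?b = "real q / real_of_int \<bar>h\<bar>"
  have 1: "cmod (\<Sum>l<L. chi q (- h * int l)) \<le> ?b" "cmod (\<Sum>t<N. chi q (- h * int t)) \<le> ?b"
    using assms False norm_geometric_chi_le by auto
  have 2: "cmod (\<Sum>l<L. chi q (- h * int l)) \<le> real L"
    by (rule order_trans[OF norm_sum]) simp
  have "cmod (tent_coeff q L s N h) \<le> real L * ?b / (real q * real L)"
    unfolding e using 1 2 by (intro divide_right_mono mult_mono) auto
  also have "\<dots> = 1 / real_of_int \<bar>h\<bar>" using assms by simp
  finally have a: "cmod (tent_coeff q L s N h) \<le> 1 / real_of_int \<bar>h\<bar>" .
  have "cmod (tent_coeff q L s N h) \<le> ?b * ?b / (real q * real L)"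
    unfolding e using 1 by (intro divide_right_mono mult_mono) auto
  also have "\<dots> \<le> ?b * ?b / (real q * (\<eta> * real q))"
    using assms by (intro divide_left_mono mult_left_mono) auto
  also have "\<dots> = 1 / ((real_of_int h)\<^sup>2 * \<eta>)" using assms False by (simp add: power2_eq_square field_simps)
  finally show ?thesis using a False by (simp add: beta_def)
qed

text \<open>The starting point is moved back by \<open>L - 1\<close>, so that each of the
  \<open>L\<close> translates still covers the whole of \<open>[M1, M2]\<close>.\<close>

lemma tent_ge_1:
  assumes "int q dvd (r - t0)" "M1 \<le> t0" "t0 \<le> M2" "L > 0"
  shows "1 \<le> tent q L (M1 - (int L - 1)) (nat (M2 - M1 + int L)) r"
proof -
  let ?s = "M1 - (int L - 1)" and ?N = "nat (M2 - M1 + int L)"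
  have "real L = (\<Sum>l<L. 1)" by simp
  also have "\<dots> \<le> (\<Sum>l<L. \<Sum>t<?N. if int q dvd (r - (?s + int t + int l)) then 1 else 0)"
  proof (rule sum_mono)
    fix l assume l: "l \<in> {..<L}"
    define t where "t = nat (t0 - int l - ?s)"
    have t: "?s + int t + int l = t0" "t < ?N" using assms l by (auto simp: t_def)
    have "(1::real) = (\<Sum>t\<in>{t}. if int q dvd (r - (?s + int t + int l)) then 1 else 0)" using t assms by simp
    also have "\<dots> \<le> (\<Sum>t<?N. if int q dvd (r - (?s + int t + int l)) then 1 else 0)"
      using t by (intro sum_mono2) auto
    finally show "(1::real) \<le> (\<Sum>t<?N. if int q dvd (r - (?s + int t + int l)) then 1 else 0)" .
  qed
  finally show ?thesis unfolding tent_def using assms by (simp add: le_divide_eq)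
qed

text \<open>The condition on \<open>N + L\<close> says that the last translate ends at
  \<open>M1 + (N - 1) + (L - 1) \<le> M2\<close>, and \<open>N \<le> q\<close> that a translate
  meets a residue class at most once. An interval too short for this receives the empty trapezoid
  \<open>N = 0\<close>.\<close>

lemma tent_le_indicator:
  assumes "N \<le> q" "L > 0" "int N + int L \<le> M2 - M1 + 2 \<or> N = 0"
  shows "tent q L M1 N r \<le> (if \<exists>t. M1 \<le> t \<and> t \<le> M2 \<and> int q dvd (r - t) then 1 else 0)"
proof (cases "\<exists>t. M1 \<le> t \<and> t \<le> M2 \<and> int q dvd (r - t)")
  case True
  have "(\<Sum>l<L. \<Sum>t<N. if int q dvd (r - (M1 + int t + int l)) then 1 else 0) \<le> (\<Sum>l<L. 1::real)"
  proof (rule sum_mono)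
    fix l assume "l \<in> {..<L}"
    have "(\<Sum>t<N. if int q dvd (r - (M1 + int t + int l)) then 1 else 0) =
       real (card {t\<in>{..<N}. int q dvd (r - (M1 + int t + int l))})"
      by (simp add: sum.inter_filter[symmetric])
    also have "card {t\<in>{..<N}. int q dvd (r - (M1 + int t + int l))} \<le> Suc 0"
    proof (subst card_le_Suc0_iff_eq; clarsimp)
      fix t t' assume t: "t < N" "int q dvd (r - (M1 + int t + int l))" "t' < N" "int q dvd (r - (M1 + int t' + int l))"
      have "int q dvd (int t' - int t)" using dvd_diff[OF t(2) t(4)] by simp
      then have "int t' - int t = 0" using t assms(1) dvd_imp_le_int[of "int t' - int t" "int q"] by fastforce
      then show "t = t'" by simp
    qed
    finally show "(\<Sum>t<N. if int q dvd (r - (M1 + int t + int l)) then 1 else 0) \<le> (1::real)" by simp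
  qed
  then show ?thesis using True assms by (simp add: tent_def divide_le_eq)
next
  case False
  have "\<not> int q dvd (r - (M1 + int t + int l))" if "l < L" "t < N" for l t
    using False[unfolded not_ex, rule_format, of "M1 + int t + int l"] that assms by auto
  then have "(\<Sum>l<L. \<Sum>t<N. if int q dvd (r - (M1 + int t + int l)) then 1 else 0) = (0::real)"
    by (intro sum.neutral ballI) auto
  then show ?thesis using False by (simp add: tent_def)
qed

section \<open>Boxes on the torus and their volumes\<close>

text \<open>Whether a fraction with denominator \<open>q\<close> lies on a closed arc depends only
  on the integers between \<open>q a\<close> and \<open>q b\<close>; arcs thereby become intervals
  of residues, to which the trapezoids apply.\<close>

lemma frac_in_image_iff:
  assumes "q > 0"
  shows "frac (real r / real q) \<in> frac ` {a..b} \<longleftrightarrow>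
    (\<exists>t. \<lceil>real q * a\<rceil> \<le> t \<and> t \<le> \<lfloor>real q * b\<rfloor> \<and> int q dvd (int r - t))"
proof
  assume "frac (real r / real q) \<in> frac ` {a..b}"
  then obtain y where y: "a \<le> y" "y \<le> b" "frac (real r / real q) = frac y" by auto
  define k where "k = \<lfloor>y\<rfloor> - \<lfloor>real r / real q\<rfloor>"
  have "y = real r / real q + of_int k" using y(3) by (simp add: k_def frac_def)
  then have "real q * y = of_int (int r + int q * k)" using assms by (simp add: field_simps)
  moreover have "real q * a \<le> real q * y" "real q * y \<le> real q * b" using y by (auto intro: mult_left_mono)
  ultimately have "\<lceil>real q * a\<rceil> \<le> int r + int q * k" "int r + int q * k \<le> \<lfloor>real q * b\<rfloor>"
    by (simp_all add: ceiling_le_iff le_floor_iff)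
  then show "\<exists>t. \<lceil>real q * a\<rceil> \<le> t \<and> t \<le> \<lfloor>real q * b\<rfloor> \<and> int q dvd (int r - t)"
    by (intro exI[of _ "int r + int q * k"]) auto
next
  assume "\<exists>t. \<lceil>real q * a\<rceil> \<le> t \<and> t \<le> \<lfloor>real q * b\<rfloor> \<and> int q dvd (int r - t)"
  then obtain t where t: "\<lceil>real q * a\<rceil> \<le> t" "t \<le> \<lfloor>real q * b\<rfloor>" "int q dvd (int r - t)" by blast
  from t(3) obtain k where k: "int r = t + int q * k" by (metis add.commute diff_add_cancel dvdE)
  then have "real r = of_int t + real q * of_int k" by (metis of_int_add of_int_mult of_int_of_nat_eq)
  then have "real r / real q = of_int t / real q + of_int k" using assms by (simp add: field_simps)
  then have "frac (real r / real q) = frac (of_int t / real q)" by simp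
  moreover have "of_int t / real q \<in> {a..b}"
    using t(1,2) assms by (auto simp: ceiling_le_iff le_floor_iff field_simps)
  ultimately show "frac (real r / real q) \<in> frac ` {a..b}" by auto
qed

text \<open>Three shapes occur inside \<open>[0, 1)\<close>: the full circle, an arc within one unit
  interval, and an arc through an integer, which falls into two disjoint pieces of total length
  \<open>b - a\<close>.\<close>

lemma emeasure_frac_image:
  fixes a b :: real
  assumes "a \<le> b" "b - a \<le> 1"
  shows "frac ` {a..b} \<in> sets borel" "emeasure lborel (frac ` {a..b}) = ennreal (b - a)"
proof -
  have "frac ` {a..b} \<in> sets borel \<and> emeasure lborel (frac ` {a..b}) = ennreal (b - a)"
  proof (cases "b - a = 1")
    case True
    have "frac ` {a..b} = {0..<1}"
    proof (intro equalityI subsetI)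
      fix y :: real assume y: "y \<in> {0..<1}"
      define k where "k = \<lceil>a - y\<rceil>"
      have "y + of_int k \<in> {a..b}" using True unfolding k_def by (auto; linarith)
      moreover have "frac (y + of_int k) = y" using y by (simp add: frac_eq)
      ultimately show "y \<in> frac ` {a..b}" by force
    qed (auto simp: frac_lt_1)
    then show ?thesis using True by simp
  next
    case False
    then have lt: "b - a < 1" using assms by simp
    show ?thesis
    proof (cases "\<lfloor>a\<rfloor> = \<lfloor>b\<rfloor>")
      case True
      have "frac ` {a..b} = {frac a..frac b}"
      proof (intro equalityI subsetI)
        fix y assume "y \<in> frac ` {a..b}"
        then obtain w where w: "y = frac w" "a \<le> w" "w \<le> b" by auto
        have "\<lfloor>w\<rfloor> = \<lfloor>a\<rfloor>" using w True floor_mono by (metis antisym)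
        then show "y \<in> {frac a..frac b}" using w True by (simp add: frac_def)
      next
        fix y assume y: "y \<in> {frac a..frac b}"
        then have "y + of_int \<lfloor>a\<rfloor> \<in> {a..b}" using True by (auto simp: frac_def)
        moreover have "frac (y + of_int \<lfloor>a\<rfloor>) = y"
          using y frac_lt_1[of b] frac_ge_0[of a] by (simp add: frac_eq del: frac_ge_0)
        ultimately show "y \<in> frac ` {a..b}" by force
      qed
      then show ?thesis using True assms by (simp add: frac_def)
    next
      case neq: False
      have fl: "\<lfloor>b\<rfloor> = \<lfloor>a\<rfloor> + 1"
        using neq lt assms floor_mono[of a b] by linarith
      have fb: "frac b < frac a" using fl lt by (simp add: frac_def)
      have "frac ` {a..b} = {frac a..<1} \<union> {0..frac b}"
      proof (intro equalityI subsetI)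
        fix y assume "y \<in> frac ` {a..b}"
        then obtain w where w: "y = frac w" "a \<le> w" "w \<le> b" by auto
        then have "\<lfloor>a\<rfloor> \<le> \<lfloor>w\<rfloor>" "\<lfloor>w\<rfloor> \<le> \<lfloor>b\<rfloor>" by (auto intro: floor_mono)
        then have "\<lfloor>w\<rfloor> = \<lfloor>a\<rfloor> \<or> \<lfloor>w\<rfloor> = \<lfloor>b\<rfloor>" using fl by auto
        then show "y \<in> {frac a..<1} \<union> {0..frac b}"
        proof
          assume "\<lfloor>w\<rfloor> = \<lfloor>a\<rfloor>"
          then have "frac a \<le> frac w" using w by (simp add: frac_def)
          then show ?thesis using w frac_lt_1[of w] by simp
        next
          assume "\<lfloor>w\<rfloor> = \<lfloor>b\<rfloor>"
          then have "frac w \<le> frac b" using w by (simp add: frac_def)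
          then show ?thesis using w by simp
        qed
      next
        fix y assume y: "y \<in> {frac a..<1} \<union> {0..frac b}"
        have fy: "frac (y + of_int k) = y" for k
          using y frac_lt_1[of b] frac_ge_0[of a] by (auto simp: frac_eq simp del: frac_ge_0)
        show "y \<in> frac ` {a..b}"
        proof (cases "y \<ge> frac a")
          case True
          then have "y + of_int \<lfloor>a\<rfloor> \<in> {a..b}" using y fl fb frac_lt_1[of b] of_int_floor_le[of b]
            by (auto simp: frac_def)
          then show ?thesis using fy[of "\<lfloor>a\<rfloor>"] by (metis image_eqI)
        next
          case False
          then have y': "y \<in> {0..frac b}" using y by auto
          have "a < of_int \<lfloor>a\<rfloor> + 1" by linarith
          then have "a \<le> y + (of_int \<lfloor>a\<rfloor> + 1)" using y' by (simp only: atLeastAtMost_iff) linarith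
          then have "y + of_int \<lfloor>b\<rfloor> \<in> {a..b}" using y' fl by (auto simp: frac_def)
          then show ?thesis using fy[of "\<lfloor>b\<rfloor>"] by (metis image_eqI)
        qed
      qed
      moreover have "emeasure lborel ({frac a..<1} \<union> {0..frac b}) = emeasure lborel {frac a..<1} + emeasure lborel {0..frac b}"
        using fb by (intro plus_emeasure[symmetric]) auto
      moreover have "\<dots> = ennreal (b - a)"
        using fl frac_lt_1[of a] by (simp add: less_imp_le ennreal_plus[symmetric] del: ennreal_plus) (simp add: frac_def)
      ultimately show ?thesis by simp
    qed
  qed
  then show "frac ` {a..b} \<in> sets borel" "emeasure lborel (frac ` {a..b}) = ennreal (b - a)" by auto
qed

lemma torus_proj_box:
  "torus_proj n ` (\<Pi>\<^sub>E i\<in>{..<n}. {a i..b i}) = (\<Pi>\<^sub>E i\<in>{..<n}. frac ` {a i..b i :: real})"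
proof (intro equalityI subsetI)
  fix y assume y: "y \<in> (\<Pi>\<^sub>E i\<in>{..<n}. frac ` {a i..b i})"
  then have "\<forall>i\<in>{..<n}. \<exists>w. w \<in> {a i..b i} \<and> y i = frac w" by (force simp: PiE_iff)
  then obtain w where w: "\<And>i. i < n \<Longrightarrow> w i \<in> {a i..b i} \<and> y i = frac (w i)" by (metis lessThan_iff)
  have "y = torus_proj n (restrict w {..<n})"
    using w y by (auto simp: torus_proj_def fun_eq_iff PiE_iff extensional_def)
  moreover have "restrict w {..<n} \<in> (\<Pi>\<^sub>E i\<in>{..<n}. {a i..b i})" using w by auto
  ultimately show "y \<in> torus_proj n ` (\<Pi>\<^sub>E i\<in>{..<n}. {a i..b i})" by blast
qed (auto simp: torus_proj_def PiE_iff)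

lemma torus_vol_box:
  assumes "\<And>i. i < n \<Longrightarrow> a i \<le> b i \<and> b i - a i \<le> 1"
  shows "torus_vol n (\<Pi>\<^sub>E i\<in>{..<n}. frac ` {a i..b i}) = (\<Prod>i<n. b i - a i)"
proof -
  interpret product_sigma_finite "\<lambda>_::nat. lborel :: real measure" ..
  have "emeasure (\<Pi>\<^sub>M i\<in>{..<n}. lborel) (\<Pi>\<^sub>E i\<in>{..<n}. frac ` {a i..b i}) = (\<Prod>i<n. emeasure lborel (frac ` {a i..b i}))"
    using assms by (intro emeasure_PiM) (auto intro: emeasure_frac_image)
  also have "\<dots> = (\<Prod>i<n. ennreal (b i - a i))" using assms by (intro prod.cong refl emeasure_frac_image) auto
  also have "\<dots> = ennreal (\<Prod>i<n. b i - a i)" using assms by (intro prod_ennreal) auto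
  finally show ?thesis using assms unfolding torus_vol_def measure_def
    by (simp only:) (rule enn2real_ennreal, intro prod_nonneg, auto)
qed

section \<open>Fourier expansion of smoothed counting functions\<close>

lemma chi_dotp: "chi q (dotp n h x) = (\<Prod>i<n. chi q (h i * int (x i)))"
proof -
  have "chi q (\<Sum>i\<in>I. f i) = (\<Prod>i\<in>I. chi q (f i))" for I and f :: "nat \<Rightarrow> int"
    by (induction I rule: infinite_finite_induct) (simp_all add: chi_add)
  then show ?thesis by (simp add: dotp_def)
qed

text \<open>Extensional, so that it is the zero frequency inside the \<open>PiE\<close> sets over
  which frequencies run.\<close>

definition zvec :: "nat \<Rightarrow> nat \<Rightarrow> int" where "zvec n = (\<lambda>i\<in>{..<n}. 0)"

text \<open>When the coordinate expansions are multiplied out, the zero frequency contributes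
  exactly the product of the mean values \<open>d i\<close>; every other frequency carries a Weyl
  sum.\<close>

lemma fourier_main_term:
  fixes f :: "nat \<Rightarrow> int \<Rightarrow> real" and c :: "nat \<Rightarrow> int \<Rightarrow> complex"
  assumes q: "q > 0" and rho: "rho n A q > 0"
    and f: "\<And>i r. i < n \<Longrightarrow> complex_of_real (f i r) = (\<Sum>h\<in>sres q. c i h * chi q (h * r))"
    and c0: "\<And>i. i < n \<Longrightarrow> c i 0 = of_real (d i)"
    and cb: "\<And>i h. i < n \<Longrightarrow> h \<in> sres q \<Longrightarrow> cmod (c i h) \<le> B h"
  shows "\<bar>(\<Sum>x\<in>crt_set n A q. \<Prod>i<n. f i (int (x i))) / real (rho n A q) - (\<Prod>i<n. d i)\<bar>
    \<le> (\<Sum>h\<in>PiE {..<n} (\<lambda>_. sres q) - {zvec n}. (\<Prod>i<n. B (h i)) * cmod (weyl n A q h))"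
proof -
  let ?H = "PiE {..<n} (\<lambda>_. sres q)"
  let ?R = "crt_set n A q"
  have finH: "finite ?H" by (intro finite_PiE) auto
  have z: "zvec n \<in> ?H" using zero_in_sres[OF q] by (auto simp: zvec_def)
  have "complex_of_real (\<Sum>x\<in>?R. \<Prod>i<n. f i (int (x i))) = (\<Sum>x\<in>?R. \<Prod>i<n. \<Sum>h\<in>sres q. c i h * chi q (h * int (x i)))"
    by (simp add: f)
  also have "\<dots> = (\<Sum>x\<in>?R. \<Sum>h\<in>?H. \<Prod>i<n. c i (h i) * chi q (h i * int (x i)))"
    by (simp add: prod_sum_PiE)
  also have "\<dots> = (\<Sum>h\<in>?H. \<Sum>x\<in>?R. \<Prod>i<n. c i (h i) * chi q (h i * int (x i)))" by (rule sum.swap)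
  also have "\<dots> = (\<Sum>h\<in>?H. (\<Prod>i<n. c i (h i)) * (\<Sum>x\<in>?R. chi q (dotp n h x)))"
    by (simp add: prod.distrib chi_dotp sum_distrib_left)
  also have "\<dots> = (\<Sum>h\<in>?H. (\<Prod>i<n. c i (h i)) * weyl n A q h * of_nat (rho n A q))"
    using rho by (simp add: weyl_def)
  also have "\<dots> = (\<Sum>h\<in>?H. (\<Prod>i<n. c i (h i)) * weyl n A q h) * of_nat (rho n A q)"
    by (simp add: sum_distrib_right)
  finally have "complex_of_real ((\<Sum>x\<in>?R. \<Prod>i<n. f i (int (x i))) / real (rho n A q)) = (\<Sum>h\<in>?H. (\<Prod>i<n. c i (h i)) * weyl n A q h)"
    using rho by simp
  also have "\<dots> = (\<Prod>i<n. c i (zvec n i)) * weyl n A q (zvec n) + (\<Sum>h\<in>?H - {zvec n}. (\<Prod>i<n. c i (h i)) * weyl n A q h)"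
    by (rule sum.remove[OF finH z])
  also have "(\<Prod>i<n. c i (zvec n i)) = complex_of_real (\<Prod>i<n. d i)" by (simp add: zvec_def c0)
  also have "weyl n A q (zvec n) = 1"
  proof -
    have "dotp n (zvec n) x = 0" for x by (simp add: dotp_def zvec_def)
    then show ?thesis using rho by (simp add: weyl_def flip: rho_def)
  qed
  finally have E: "complex_of_real ((\<Sum>x\<in>?R. \<Prod>i<n. f i (int (x i))) / real (rho n A q) - (\<Prod>i<n. d i)) =
     (\<Sum>h\<in>?H - {zvec n}. (\<Prod>i<n. c i (h i)) * weyl n A q h)" by simp
  have "\<bar>(\<Sum>x\<in>?R. \<Prod>i<n. f i (int (x i))) / real (rho n A q) - (\<Prod>i<n. d i)\<bar> = cmod (\<Sum>h\<in>?H - {zvec n}. (\<Prod>i<n. c i (h i)) * weyl n A q h)"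
    unfolding E[symmetric] by (rule norm_of_real[symmetric])
  also have "\<dots> \<le> (\<Sum>h\<in>?H - {zvec n}. cmod ((\<Prod>i<n. c i (h i)) * weyl n A q h))" by (rule norm_sum)
  also have "\<dots> \<le> (\<Sum>h\<in>?H - {zvec n}. (\<Prod>i<n. B (h i)) * cmod (weyl n A q h))"
  proof (intro sum_mono)
    fix h assume h: "h \<in> ?H - {zvec n}"
    have "cmod (\<Prod>i<n. c i (h i)) \<le> (\<Prod>i<n. B (h i))"
      unfolding prod_norm[symmetric] using h by (intro prod_mono) (auto intro!: cb)
    then show "cmod ((\<Prod>i<n. c i (h i)) * weyl n A q h) \<le> (\<Prod>i<n. B (h i)) * cmod (weyl n A q h)"
      by (simp add: norm_mult mult_right_mono)
  qed
  finally show ?thesis .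
qed

text \<open>Division by 3 brings all factors into the unit ball, where a product changes by at most
  the sum of the changes of its factors.\<close>

lemma abs_prod_diff_le:
  fixes x y :: "nat \<Rightarrow> real"
  assumes "\<And>i. i < n \<Longrightarrow> \<bar>x i\<bar> \<le> 3 \<and> \<bar>y i\<bar> \<le> 3 \<and> \<bar>x i - y i\<bar> \<le> e"
  shows "\<bar>(\<Prod>i<n. x i) - (\<Prod>i<n. y i)\<bar> \<le> real n * 3 ^ n * e"
proof -
  have "norm ((\<Prod>i<n. x i / 3) - (\<Prod>i<n. y i / 3)) \<le> (\<Sum>i<n. norm (x i / 3 - y i / 3))"
    using assms by (intro norm_prod_diff) auto
  also have "\<dots> \<le> (\<Sum>i<n. e)"
  proof (rule sum_mono)
    fix i assume "i \<in> {..<n}"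
    then have "\<bar>x i - y i\<bar> \<le> e" using assms by auto
    moreover have "\<bar>x i - y i\<bar> / 3 \<le> \<bar>x i - y i\<bar>" by simp
    ultimately have "\<bar>x i - y i\<bar> / 3 \<le> e" by (rule order_trans[rotated])
    then show "norm (x i / 3 - y i / 3) \<le> e" by (simp flip: diff_divide_distrib)
  qed
  finally have "\<bar>(\<Prod>i<n. x i) / 3 ^ n - (\<Prod>i<n. y i) / 3 ^ n\<bar> \<le> real n * e"
    by (simp add: prod_dividef)
  then have "\<bar>(\<Prod>i<n. x i) - (\<Prod>i<n. y i)\<bar> / 3 ^ n \<le> real n * e"
    by (simp flip: diff_divide_distrib)
  then show ?thesis by (simp add: field_simps)
qed

section \<open>Sums of the coefficient majorant\<close>

lemma beta_nonneg: "0 \<le> \<eta> \<Longrightarrow> 0 \<le> beta \<eta> h"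
  by (simp add: beta_def)

lemma sum_inverse_squares_tail:
  assumes "1 \<le> H" "H \<le> K"
  shows "(\<Sum>m\<in>{H<..K}. 1 / (real m)\<^sup>2) \<le> 1 / real H - 1 / real K"
  using assms(2)
proof (induction K rule: dec_induct)
  case (step K)
  have "{H<..Suc K} = insert (Suc K) {H<..K}" using step by auto
  moreover have "1 / (real (Suc K))\<^sup>2 \<le> 1 / (real K * real (Suc K))"
    unfolding power2_eq_square using step assms by (intro divide_left_mono mult_right_mono) auto
  moreover have "1 / (real K * real (Suc K)) = 1 / real K - 1 / real (Suc K)"
    using step assms by (simp add: field_simps)
  ultimately show ?case using step by simp
qed simp

text \<open>Beyond \<open>H\<close> the quadratic decay gained by smoothing is used; up to
  \<open>H\<close>, in \<open>sum_beta_box\<close>, only the bound \<open>1 / \<bar>h\<bar>\<close>,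
  at the price of a logarithm.\<close>

lemma sum_beta_tail:
  assumes "finite J" "1 \<le> H" "0 < \<eta>" and J: "\<And>h. h \<in> J \<Longrightarrow> int H < \<bar>h\<bar>"
  shows "(\<Sum>h\<in>J. beta \<eta> h) \<le> 2 / (real H * \<eta>)"
proof -
  obtain K where K: "\<And>h. h \<in> J \<Longrightarrow> \<bar>h\<bar> \<le> int K" "H \<le> K"
  proof -
    have "\<bar>h\<bar> \<le> int (nat (\<Sum>h\<in>J. \<bar>h\<bar>) + H)" if "h \<in> J" for h
      using member_le_sum[of h J abs] assms(1) that by auto
    then show ?thesis using that[of "nat (\<Sum>h\<in>J. \<bar>h\<bar>) + H"] by auto
  qed
  have "(\<Sum>h\<in>J. beta \<eta> h) \<le> (\<Sum>h\<in>J. 1 / ((real_of_int h)\<^sup>2 * \<eta>))"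
    using J assms by (intro sum_mono) (force simp: beta_def)
  also have "\<dots> \<le> (\<Sum>h\<in>int ` {H<..K} \<union> (\<lambda>m. - int m) ` {H<..K}. 1 / ((real_of_int h)\<^sup>2 * \<eta>))"
  proof (intro sum_mono2)
    show "J \<subseteq> int ` {H<..K} \<union> (\<lambda>m. - int m) ` {H<..K}"
    proof
      fix h assume h: "h \<in> J"
      then have "nat \<bar>h\<bar> \<in> {H<..K}" "h = int (nat \<bar>h\<bar>) \<or> h = - int (nat \<bar>h\<bar>)" using J[OF h] K(1)[OF h] by auto
      then show "h \<in> int ` {H<..K} \<union> (\<lambda>m. - int m) ` {H<..K}" by blast
    qed
  qed (use assms in auto)
  also have "\<dots> \<le> (\<Sum>h\<in>int ` {H<..K}. 1 / ((real_of_int h)\<^sup>2 * \<eta>)) + (\<Sum>h\<in>(\<lambda>m. - int m) ` {H<..K}. 1 / ((real_of_int h)\<^sup>2 * \<eta>))"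
    using assms sum.union_inter[of "int ` {H<..K}" "(\<lambda>m. - int m) ` {H<..K}" "\<lambda>h. 1 / ((real_of_int h)\<^sup>2 * \<eta>)"]
      sum_nonneg[of "int ` {H<..K} \<inter> (\<lambda>m. - int m) ` {H<..K}" "\<lambda>h. 1 / ((real_of_int h)\<^sup>2 * \<eta>)"] by simp
  also have "\<dots> = 2 * ((\<Sum>m\<in>{H<..K}. 1 / (real m)\<^sup>2) / \<eta>)"
    by (subst (1 2) sum.reindex) (auto simp: inj_on_def sum_divide_distrib)
  also have "\<dots> \<le> 2 * ((1 / real H) / \<eta>)"
  proof -
    have "(\<Sum>m\<in>{H<..K}. 1 / (real m)\<^sup>2) \<le> 1 / real H - 1 / real K" by (rule sum_inverse_squares_tail) (use assms K in auto)
    also have "\<dots> \<le> 1 / real H" by simp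
    finally show ?thesis using assms by (intro mult_left_mono divide_right_mono) auto
  qed
  finally show ?thesis by (simp add: mult.commute)
qed

lemma harm_le_ln: "1 \<le> H \<Longrightarrow> (\<Sum>m=1..H. 1 / real m) \<le> 1 + ln (real H)"
proof (induction H rule: dec_induct)
  case (step H)
  have "ln (real H / real (Suc H)) \<le> real H / real (Suc H) - 1" using step by (intro ln_le_minus_one) auto
  then have "1 / real (Suc H) \<le> ln (real (Suc H)) - ln (real H)"
    using step by (simp add: ln_div field_simps)
  then show ?case using step by simp
qed simp

lemma sum_beta_box:
  assumes "1 \<le> H" "0 < \<eta>"
  shows "(\<Sum>h\<in>{- int H..int H}. beta \<eta> h) \<le> 5 + 2 * ln (real H)"
proof -
  have e: "{- int H..int H} = insert 0 (int ` {1..H} \<union> (\<lambda>m. - int m) ` {1..H})"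
  proof (intro equalityI subsetI)
    fix h assume h: "h \<in> {- int H..int H}"
    show "h \<in> insert 0 (int ` {1..H} \<union> (\<lambda>m. - int m) ` {1..H})"
    proof (cases "h = 0")
      case False
      then have "nat \<bar>h\<bar> \<in> {1..H}" "h = int (nat \<bar>h\<bar>) \<or> h = - int (nat \<bar>h\<bar>)" using h by auto
      then show ?thesis by blast
    qed simp
  qed auto
  have "(\<Sum>h\<in>{- int H..int H}. beta \<eta> h) = 3 + (\<Sum>h\<in>int ` {1..H}. beta \<eta> h) + (\<Sum>h\<in>(\<lambda>m. - int m) ` {1..H}. beta \<eta> h)"
    unfolding e by (subst sum.insert, force, force, subst sum.union_disjoint) (auto simp: beta_def)
  also have "\<dots> = 3 + (\<Sum>m=1..H. beta \<eta> (int m)) + (\<Sum>m=1..H. beta \<eta> (- int m))"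
    by (subst (1 2) sum.reindex) (auto simp: inj_on_def)
  also have "\<dots> \<le> 3 + (\<Sum>m=1..H. 1 / real m) + (\<Sum>m=1..H. 1 / real m)"
    by (intro add_mono sum_mono) (auto simp: beta_def)
  also have "\<dots> \<le> 5 + 2 * ln (real H)" using harm_le_ln[OF assms(1)] by simp
  finally show ?thesis .
qed

lemma sum_le_UN:
  fixes f :: "'a \<Rightarrow> real"
  assumes "finite I" "\<And>i. i \<in> I \<Longrightarrow> finite (U i)" "\<And>x. 0 \<le> f x"
  shows "(\<Sum>x\<in>(\<Union>i\<in>I. U i). f x) \<le> (\<Sum>i\<in>I. \<Sum>x\<in>U i. f x)"
  using assms
proof (induction I rule: finite_induct)
  case (insert i I)
  have "0 \<le> sum f (U i \<inter> (\<Union>i\<in>I. U i))" using insert by (intro sum_nonneg)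
  then have "sum f (U i \<union> (\<Union>i\<in>I. U i)) \<le> sum f (U i) + sum f (\<Union>i\<in>I. U i)"
    using insert sum.union_inter[of "U i" "\<Union>i\<in>I. U i" f] by simp
  then show ?case using insert by simp
qed simp

text \<open>A frequency outside the box has a coordinate beyond \<open>H\<close>. There
  \<open>F\<close>, a Weyl sum in the application, is bounded by 1, that coordinate contributes at
  most \<open>2 / (H \<eta>) \<le> 2 * \<eta>\<close>, and each of the other \<open>n - 1\<close> at
  most \<open>7 + 2 * ln H\<close>. The condition on \<open>\<eta>^2 * H\<close> balances truncation
  against smoothing.\<close>

lemma sum_prod_beta_split:
  fixes F :: "(nat \<Rightarrow> int) \<Rightarrow> real"
  assumes H: "1 \<le> H" and eta: "0 < \<eta>" "\<eta> \<le> 1" "1 \<le> \<eta>\<^sup>2 * real H" and F: "\<And>h. 0 \<le> F h \<and> F h \<le> 1" and n: "1 \<le> n"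
  shows "(\<Sum>h\<in>PiE {..<n} (\<lambda>_. sres q) - {zvec n}. (\<Prod>i<n. beta \<eta> (h i)) * F h) \<le>
    (\<Sum>h\<in>PiE {..<n} (\<lambda>_. {- int H..int H}) - {zvec n}. (\<Prod>i<n. beta \<eta> (h i)) * F h)
    + real n * (7 + 2 * ln (real H)) ^ (n - 1) * (2 * \<eta>)"
proof -
  let ?P = "PiE {..<n} (\<lambda>_. sres q)" and ?B = "PiE {..<n} (\<lambda>_. {- int H..int H})"
  let ?w = "\<lambda>h. \<Prod>i<n. beta \<eta> (h i)"
  have bn: "0 \<le> beta \<eta> h" for h using eta by (simp add: beta_nonneg)
  have wn: "0 \<le> ?w h" for h by (intro prod_nonneg) (simp add: bn)
  have fin: "finite ?P" "finite ?B" by (auto intro: finite_PiE)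
  define T where "T = {h \<in> sres q. int H < \<bar>h\<bar>}"
  define U where "U = (\<lambda>j. PiE {..<n} (\<lambda>i. if i = j then T else sres q))"
  have finU: "finite (U j)" for j unfolding U_def by (intro finite_PiE) (auto simp: T_def)
  have sumT: "(\<Sum>h\<in>T. beta \<eta> h) \<le> 2 * \<eta>"
  proof -
    have "(\<Sum>h\<in>T. beta \<eta> h) \<le> 2 / (real H * \<eta>)"
      by (rule sum_beta_tail) (use H eta in \<open>auto simp: T_def\<close>)
    also have "\<dots> \<le> 2 * \<eta>" using eta H by (simp add: field_simps power2_eq_square)
    finally show ?thesis .
  qed
  have sumS: "(\<Sum>h\<in>sres q. beta \<eta> h) \<le> 7 + 2 * ln (real H)"
  proof -
    have "(\<Sum>h\<in>sres q. beta \<eta> h) \<le> (\<Sum>h\<in>{- int H..int H} \<union> T. beta \<eta> h)"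
      using bn by (intro sum_mono2) (auto simp: T_def)
    also have "\<dots> = (\<Sum>h\<in>{- int H..int H}. beta \<eta> h) + (\<Sum>h\<in>T. beta \<eta> h)"
      by (intro sum.union_disjoint) (auto simp: T_def)
    also have "\<dots> \<le> 5 + 2 * ln (real H) + 2 * 1" using sum_beta_box[OF H eta(1)] sumT eta by linarith
    finally show ?thesis by simp
  qed
  have "(\<Sum>h\<in>?P - {zvec n}. ?w h * F h) \<le> (\<Sum>h\<in>(?B - {zvec n}) \<union> (\<Union>j<n. U j). ?w h * F h)"
  proof (intro sum_mono2)
    show "?P - {zvec n} \<subseteq> (?B - {zvec n}) \<union> (\<Union>j<n. U j)"
    proof
      fix h assume h: "h \<in> ?P - {zvec n}"
      show "h \<in> (?B - {zvec n}) \<union> (\<Union>j<n. U j)"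
      proof (cases "\<exists>j<n. int H < \<bar>h j\<bar>")
        case True
        then obtain j where "j < n" "int H < \<bar>h j\<bar>" by auto
        then have "h \<in> U j" using h by (auto simp: U_def T_def PiE_iff)
        then show ?thesis using \<open>j < n\<close> by auto
      next
        case False
        then have "h \<in> ?B" using h
          proof -
            have "h i \<in> {- int H..int H}" if "i < n" for i
            proof -
              have "\<bar>h i\<bar> \<le> int H" using False that by (meson not_less)
              then show ?thesis by auto
            qed
            then show ?thesis using h by (auto simp: PiE_iff)
          qed
        then show ?thesis using h by auto
      qed
    qed
  qed (use fin finU F wn in \<open>auto intro!: mult_nonneg_nonneg\<close>)
  also have "\<dots> \<le> (\<Sum>h\<in>?B - {zvec n}. ?w h * F h) + (\<Sum>h\<in>(\<Union>j<n. U j). ?w h * F h)"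
  proof -
    have "0 \<le> (\<Sum>h\<in>(?B - {zvec n}) \<inter> (\<Union>j<n. U j). ?w h * F h)"
      using F wn by (intro sum_nonneg mult_nonneg_nonneg) auto
    then show ?thesis using fin finU sum.union_inter[of "?B - {zvec n}" "\<Union>j<n. U j" "\<lambda>h. ?w h * F h"] by simp
  qed
  also have "(\<Sum>h\<in>(\<Union>j<n. U j). ?w h * F h) \<le> (\<Sum>h\<in>(\<Union>j<n. U j). ?w h)"
    using F wn by (intro sum_mono) (auto simp: mult_left_le)
  also have "\<dots> \<le> (\<Sum>j<n. \<Sum>h\<in>U j. ?w h)"
    using finU wn sum_le_UN[of "{..<n}" U ?w] by auto
  also have "\<dots> \<le> (\<Sum>j<n. (7 + 2 * ln (real H)) ^ (n - 1) * (2 * \<eta>))"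
  proof (intro sum_mono)
    fix j assume j: "j \<in> {..<n}"
    have "(\<Sum>h\<in>U j. ?w h) = (\<Prod>i<n. \<Sum>h\<in>(if i = j then T else sres q). beta \<eta> h)"
      unfolding U_def by (rule prod_sum_PiE[symmetric]) (auto simp: T_def)
    also have "\<dots> = (\<Sum>h\<in>T. beta \<eta> h) * (\<Prod>i\<in>{..<n} - {j}. \<Sum>h\<in>(if i = j then T else sres q). beta \<eta> h)"
      using j by (subst prod.remove[of _ j]) auto
    also have "(\<Prod>i\<in>{..<n} - {j}. \<Sum>h\<in>(if i = j then T else sres q). beta \<eta> h) = (\<Prod>i\<in>{..<n} - {j}. \<Sum>h\<in>sres q. beta \<eta> h)"
      by (intro prod.cong) auto
    also have "\<dots> = (\<Sum>h\<in>sres q. beta \<eta> h) ^ (n - 1)" using j by simp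
    also have "(\<Sum>h\<in>T. beta \<eta> h) * \<dots> \<le> (2 * \<eta>) * (7 + 2 * ln (real H)) ^ (n - 1)"
      using sumT sumS eta bn by (intro mult_mono power_mono) (auto intro!: sum_nonneg zero_le_power)
    finally show "(\<Sum>h\<in>U j. ?w h) \<le> (7 + 2 * ln (real H)) ^ (n - 1) * (2 * \<eta>)" by (simp add: mult.commute)
  qed
  also have "\<dots> = real n * (7 + 2 * ln (real H)) ^ (n - 1) * (2 * \<eta>)" by simp
  finally show ?thesis by simp
qed

section \<open>The discrepancy inequality\<close>

text \<open>Each side of a box is squeezed between two trapezoids whose relative lengths differ from
  it by at most \<open>\<eta> + 2 / q\<close>. The surviving frequencies lie in a box that does not
  depend on \<open>q\<close>, so the average over \<open>q\<close> can later be taken separately for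
  each of them.\<close>

lemma disc_le:
  assumes n: "1 \<le> n" and q: "2 \<le> q" and rho: "1 \<le> rho n A q"
    and H: "1 \<le> H" and eta: "0 < \<eta>" "\<eta> \<le> 1" "1 \<le> \<eta>\<^sup>2 * real H"
  shows "disc n (Delta n A q) \<le> real n * 3 ^ n * (\<eta> + 2 / real q)
    + real n * (7 + 2 * ln (real H)) ^ (n - 1) * (2 * \<eta>)
    + (\<Sum>h\<in>PiE {..<n} (\<lambda>_. {- int H..int H}) - {zvec n}. (\<Prod>i<n. beta \<eta> (h i)) * cmod (weyl n A q h))"
proof -
  let ?R = "crt_set n A q"
  let ?e = "\<eta> + 2 / real q"
  define S where "S = (\<Sum>h\<in>PiE {..<n} (\<lambda>_. sres q) - {zvec n}. (\<Prod>i<n. beta \<eta> (h i)) * cmod (weyl n A q h))"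
  \<comment> \<open>The extra 1 gives \<open>L \<ge> 2\<close>. Then the outer length is nonnegative
    even if a side contains no multiple of \<open>1 / q\<close>, where \<open>M2 - M1 = -1\<close>,
    and the inner length is at most \<open>q\<close>.\<close>
  define L where "L = nat \<lceil>\<eta> * real q\<rceil> + 1"
  have q0: "q > 0" using q by simp
  have etaq: "0 < \<eta> * real q" using eta q by simp
  have "0 < \<lceil>\<eta> * real q\<rceil>" using etaq by simp
  then have L2: "2 \<le> L" unfolding L_def by linarith
  have Lge: "\<eta> * real q \<le> real L" unfolding L_def using real_nat_ceiling_ge[of "\<eta> * real q"] by simp
  have Lle: "real L \<le> \<eta> * real q + 2" unfolding L_def using etaq by (simp; linarith)
  have Lq: "real L / real q \<le> ?e"
  proof -
    have "real L / real q \<le> (\<eta> * real q + 2) / real q" using Lle by (intro divide_right_mono) auto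
    then show ?thesis using q0 by (simp add: add_divide_distrib)
  qed
  have e2: "?e \<le> 2"
  proof -
    have "2 / real q \<le> 1" using q by simp
    then show ?thesis using eta by linarith
  qed
  have bound: "\<bar>Delta n A q B - torus_vol n B\<bar> \<le> real n * 3 ^ n * ?e + S" if B: "B \<in> torus_boxes n" for B
  proof -
    obtain a b where ab: "B = torus_proj n ` (\<Pi>\<^sub>E i\<in>{..<n}. {a i..b i})" "\<And>i. i < n \<Longrightarrow> a i \<le> b i \<and> b i - a i \<le> 1"
      using B by (auto simp: torus_boxes_def)
    define M1 where "M1 = (\<lambda>i. \<lceil>real q * a i\<rceil>)"
    define M2 where "M2 = (\<lambda>i. \<lfloor>real q * b i\<rfloor>)"
    \<comment> \<open>Outer and inner lengths; \<open>nat\<close> turns a negative inner length into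
      0, the empty trapezoid.\<close>
    define N where "N = (\<lambda>i. nat (M2 i - M1 i + int L))"
    define N' where "N' = (\<lambda>i. nat (M2 i - M1 i + 2 - int L))"
    define f where "f = (\<lambda>i. tent q L (M1 i - (int L - 1)) (N i))"
    define f' where "f' = (\<lambda>i. tent q L (M1 i) (N' i))"
    define ind where "ind = (\<lambda>i (r::nat). if \<exists>t. M1 i \<le> t \<and> t \<le> M2 i \<and> int q dvd (int r - t) then 1 else 0 :: real)"
    have vol: "torus_vol n B = (\<Prod>i<n. b i - a i)"
      unfolding ab torus_proj_box by (rule torus_vol_box) (use ab in auto)
    have Mb: "real_of_int (M2 i - M1 i) \<le> real q * (b i - a i)" "real q * (b i - a i) - 2 < real_of_int (M2 i - M1 i)" for i
      unfolding M1_def M2_def by (simp_all add: right_diff_distrib; linarith)+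
    have len: "real q * (b i - a i) \<le> real q" "0 \<le> real q * (b i - a i)" if "i < n" for i
      using ab(2)[OF that] by (auto simp: mult_left_le)
    have MM: "- 1 \<le> M2 i - M1 i" "M2 i - M1 i \<le> int q" if "i < n" for i
      using Mb[of i] len[OF that] by linarith+
    have Nr: "real (N i) = real_of_int (M2 i - M1 i) + real L" if "i < n" for i
      using MM[OF that] L2 by (simp add: N_def)
    have N3: "real (N i) \<le> 3 * real q" if "i < n" for i
    proof -
      have "real L \<le> 2 * real q" using Lq e2 q0 by (simp add: field_simps)
      moreover have "real_of_int (M2 i - M1 i) \<le> real q" using MM[OF that] by linarith
      ultimately show ?thesis unfolding Nr[OF that] by linarith
    qed
    have N'q: "N' i \<le> q" if "i < n" for i using MM[OF that] L2 by (simp add: N'_def)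
    have Nd: "\<bar>real (N i) / real q - (b i - a i)\<bar> \<le> ?e" if "i < n" for i
    proof -
      have "\<bar>real (N i) - real q * (b i - a i)\<bar> \<le> real L" unfolding Nr[OF that] using Mb[of i] L2 by linarith
      then have "\<bar>real (N i) - real q * (b i - a i)\<bar> / real q \<le> real L / real q" by (rule divide_right_mono) simp
      moreover have "\<bar>real (N i) - real q * (b i - a i)\<bar> / real q = \<bar>real (N i) / real q - (b i - a i)\<bar>"
        using q0 by (simp add: abs_divide diff_divide_distrib[symmetric] field_simps)
      ultimately show ?thesis using Lq by linarith
    qed
    have N'd: "\<bar>real (N' i) / real q - (b i - a i)\<bar> \<le> ?e" if "i < n" for i
    proof -
      have "\<bar>real (N' i) - real q * (b i - a i)\<bar> \<le> real L"
      proof (cases "M2 i - M1 i + 2 - int L \<ge> 0")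
        case True
        then have "real (N' i) = real_of_int (M2 i - M1 i) + 2 - real L" by (simp add: N'_def)
        then show ?thesis using Mb[of i] L2 by linarith
      next
        case False
        then have "N' i = 0" "real_of_int (M2 i - M1 i) + 2 < real L" by (auto simp: N'_def)
        then show ?thesis using Mb[of i] L2 len[OF that] by linarith
      qed
      then have "\<bar>real (N' i) - real q * (b i - a i)\<bar> / real q \<le> real L / real q" by (rule divide_right_mono) simp
      moreover have "\<bar>real (N' i) - real q * (b i - a i)\<bar> / real q = \<bar>real (N' i) / real q - (b i - a i)\<bar>"
        using q0 by (simp add: abs_divide diff_divide_distrib[symmetric] field_simps)
      ultimately show ?thesis using Lq by linarith
    qed
    have Delta: "Delta n A q B = (\<Sum>x\<in>?R. \<Prod>i<n. ind i (x i)) / real (rho n A q)"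
    proof -
      have "indicator B (torus_proj n (\<lambda>i. real (x i) / real q)) = (\<Prod>i<n. ind i (x i))" for x
      proof -
        have "torus_proj n (\<lambda>i. real (x i) / real q) \<in> B \<longleftrightarrow> (\<forall>i<n. frac (real (x i) / real q) \<in> frac ` {a i..b i})"
          unfolding ab(1) torus_proj_box by (auto simp: PiE_iff torus_proj_def simp del: image_iff)
        also have "\<dots> \<longleftrightarrow> (\<forall>i<n. ind i (x i) = 1)"
          unfolding frac_in_image_iff[OF q0] by (auto simp: ind_def M1_def M2_def)
        finally have iff: "torus_proj n (\<lambda>i. real (x i) / real q) \<in> B \<longleftrightarrow> (\<forall>i<n. ind i (x i) = 1)" .
        show ?thesis
        proof (cases "\<forall>i<n. ind i (x i) = 1")
          case True
          then show ?thesis using iff by simp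
        next
          case False
          then obtain i where "i < n" "ind i (x i) = 0" by (auto simp: ind_def split: if_splits)
          then have "(\<Prod>i<n. ind i (x i)) = 0" by (intro prod_zero) auto
          then show ?thesis using iff False by (simp add: indicator_def)
        qed
      qed
      then show ?thesis unfolding Delta_def by simp
    qed
    have ind_nn: "0 \<le> ind i r" for i r by (simp add: ind_def)
    have up: "Delta n A q B \<le> (\<Sum>x\<in>?R. \<Prod>i<n. f i (int (x i))) / real (rho n A q)"
      unfolding Delta
    proof (intro divide_right_mono sum_mono prod_mono conjI ind_nn)
      fix x i assume "i \<in> {..<n}"
      show "ind i (x i) \<le> f i (int (x i))"
        using tent_ge_1[of q "int (x i)" _ "M1 i" "M2 i" L] L2
        by (auto simp: ind_def f_def N_def tent_nonneg)
    qed auto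
    have lo: "(\<Sum>x\<in>?R. \<Prod>i<n. f' i (int (x i))) / real (rho n A q) \<le> Delta n A q B"
      unfolding Delta
    proof (intro divide_right_mono sum_mono prod_mono conjI)
      fix x i assume i: "i \<in> {..<n}"
      show "f' i (int (x i)) \<le> ind i (x i)"
        unfolding f'_def ind_def using i L2 N'q
        by (intro tent_le_indicator) (auto simp: N'_def)
    qed (auto simp: f'_def tent_nonneg)
    have 1: "\<bar>(\<Sum>x\<in>?R. \<Prod>i<n. f i (int (x i))) / real (rho n A q) - (\<Prod>i<n. real (N i) / real q)\<bar> \<le> S"
      unfolding S_def
    proof (rule fourier_main_term[where c = "\<lambda>i. tent_coeff q L (M1 i - (int L - 1)) (N i)"])
      show "complex_of_real (f i r) = (\<Sum>h\<in>sres q. tent_coeff q L (M1 i - (int L - 1)) (N i) h * chi q (h * r))" for i r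
        unfolding f_def by (rule tent_expansion[OF q0])
      show "tent_coeff q L (M1 i - (int L - 1)) (N i) 0 = complex_of_real (real (N i) / real q)" for i
        using q0 L2 by (intro tent_coeff_0) auto
    qed (use q0 L2 rho N3 eta Lge in \<open>auto intro!: norm_tent_coeff_le\<close>)
    have 2: "\<bar>(\<Sum>x\<in>?R. \<Prod>i<n. f' i (int (x i))) / real (rho n A q) - (\<Prod>i<n. real (N' i) / real q)\<bar> \<le> S"
      unfolding S_def
    proof (rule fourier_main_term[where c = "\<lambda>i. tent_coeff q L (M1 i) (N' i)"])
      show "complex_of_real (f' i r) = (\<Sum>h\<in>sres q. tent_coeff q L (M1 i) (N' i) h * chi q (h * r))" for i r
        unfolding f'_def by (rule tent_expansion[OF q0])
      show "cmod (tent_coeff q L (M1 i) (N' i) h) \<le> beta \<eta> h" if "i < n" "h \<in> sres q" for i h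
        using N'q[OF that(1)] that q0 L2 eta Lge by (intro norm_tent_coeff_le) auto
      show "tent_coeff q L (M1 i) (N' i) 0 = complex_of_real (real (N' i) / real q)" for i
        using q0 L2 by (intro tent_coeff_0) auto
    qed (use q0 L2 rho in auto)
    have 3: "\<bar>(\<Prod>i<n. real (N i) / real q) - (\<Prod>i<n. b i - a i)\<bar> \<le> real n * 3 ^ n * ?e"
      using N3 Nd ab(2) q0 by (intro abs_prod_diff_le) (force simp: field_simps)
    have 4: "\<bar>(\<Prod>i<n. real (N' i) / real q) - (\<Prod>i<n. b i - a i)\<bar> \<le> real n * 3 ^ n * ?e"
    proof (intro abs_prod_diff_le conjI N'd)
      fix i assume i: "i < n"
      have "real (N' i) / real q \<le> 1" using N'q[OF i] q0 by simp
      then show "\<bar>real (N' i) / real q\<bar> \<le> 3" by simp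
      show "\<bar>b i - a i\<bar> \<le> 3" using ab(2)[OF i] by simp
    qed
    show ?thesis using up lo 1 2 3 4 unfolding vol by linarith
  qed
  have ne: "torus_boxes n \<noteq> {}"
    unfolding torus_boxes_def by (auto intro!: exI[of _ "\<lambda>_. 0"])
  have "disc n (Delta n A q) \<le> real n * 3 ^ n * ?e + S"
    unfolding disc_def by (rule cSUP_least[OF ne]) (rule bound)
  also have "S \<le> (\<Sum>h\<in>PiE {..<n} (\<lambda>_. {- int H..int H}) - {zvec n}. (\<Prod>i<n. beta \<eta> (h i)) * cmod (weyl n A q h))
    + real n * (7 + 2 * ln (real H)) ^ (n - 1) * (2 * \<eta>)"
    unfolding S_def by (rule sum_prod_beta_split) (use H eta n norm_weyl_le_1 in auto)
  finally show ?thesis by simp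
qed

section \<open>Elementary symmetric sums\<close>

definition esym :: "('a \<Rightarrow> real) \<Rightarrow> 'a set \<Rightarrow> nat \<Rightarrow> real" where
  "esym f P j = (\<Sum>T | T \<subseteq> P \<and> card T = j. \<Prod>p\<in>T. f p)"

lemma finite_subsets_card [simp]: "finite P \<Longrightarrow> finite {T. T \<subseteq> P \<and> card T = j}"
  by (rule finite_subset[of _ "Pow P"]) auto

lemma esym_0 [simp]: "finite P \<Longrightarrow> esym f P 0 = 1"
proof -
  assume "finite P"
  then have "{T. T \<subseteq> P \<and> card T = 0} = {{}}" by (auto dest: finite_subset)
  then show ?thesis by (simp add: esym_def)
qed

lemma esym_nonneg: "(\<And>p. p \<in> P \<Longrightarrow> 0 \<le> f p) \<Longrightarrow> 0 \<le> esym f P j"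
  unfolding esym_def by (intro sum_nonneg prod_nonneg) auto

text \<open>Both sides sum over a set with a marked element: it is one of the elements of a set of
  size \<open>j + 1\<close>, or is adjoined to a set of size \<open>j\<close>.\<close>

lemma esym_Suc:
  assumes "finite P"
  shows "real (Suc j) * esym f P (Suc j) = (\<Sum>T | T \<subseteq> P \<and> card T = j. (\<Prod>p\<in>T. f p) * (\<Sum>p\<in>P - T. f p))"
proof -
  let ?A = "\<lambda>j. {T. T \<subseteq> P \<and> card T = j}"
  have fin: "finite T" if "T \<subseteq> P" for T using that assms by (rule finite_subset)
  have "real (Suc j) * esym f P (Suc j) = (\<Sum>T\<in>?A (Suc j). \<Sum>p\<in>T. \<Prod>p\<in>T. f p)"
    by (simp add: esym_def sum_distrib_left)
  also have "\<dots> = (\<Sum>(T, p)\<in>Sigma (?A (Suc j)) (\<lambda>T. T). \<Prod>p\<in>T. f p)"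
    by (rule sum.Sigma[OF finite_subsets_card[OF assms]]) (use fin in blast)
  also have "\<dots> = (\<Sum>(T, p)\<in>Sigma (?A j) (\<lambda>T. P - T). (\<Prod>p\<in>T. f p) * f p)"
  proof (rule sum.reindex_bij_witness[of _ "\<lambda>(T, p). (insert p T, p)" "\<lambda>(T, p). (T - {p}, p)"])
    fix a assume a: "a \<in> Sigma (?A (Suc j)) (\<lambda>T. T)"
    obtain T p where Tp: "a = (T, p)" by (cases a)
    with a have T: "T \<subseteq> P" "card T = Suc j" "p \<in> T" by auto
    note T = T fin[OF T(1)]
    show "(\<lambda>(T, p). (insert p T, p)) ((\<lambda>(T, p). (T - {p}, p)) a) = a" using Tp T by auto
    show "(\<lambda>(T, p). (T - {p}, p)) a \<in> Sigma (?A j) (\<lambda>T. P - T)" using Tp T by auto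
    show "(\<lambda>(T, p). (\<Prod>p\<in>T. f p) * f p) ((\<lambda>(T, p). (T - {p}, p)) a) = (case a of (T, p) \<Rightarrow> \<Prod>p\<in>T. f p)"
      using Tp T prod.remove[of T p f] by (simp add: mult.commute)
  next
    fix b assume b: "b \<in> Sigma (?A j) (\<lambda>T. P - T)"
    obtain T p where Tp: "b = (T, p)" by (cases b)
    with b have T: "T \<subseteq> P" "card T = j" "p \<notin> T" "p \<in> P" by auto
    note T = T fin[OF T(1)]
    show "(\<lambda>(T, p). (T - {p}, p)) ((\<lambda>(T, p). (insert p T, p)) b) = b" using Tp T by auto
    show "(\<lambda>(T, p). (insert p T, p)) b \<in> Sigma (?A (Suc j)) (\<lambda>T. T)" using Tp T by auto
  qed
  also have "\<dots> = (\<Sum>T\<in>?A j. \<Sum>p\<in>P - T. (\<Prod>p\<in>T. f p) * f p)"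
    by (rule sum.Sigma[OF finite_subsets_card[OF assms], symmetric]) (use assms in simp)
  finally show ?thesis by (simp add: sum_distrib_left)
qed

lemma esym_le:
  assumes "finite P" "\<And>p. p \<in> P \<Longrightarrow> 0 \<le> f p"
  shows "esym f P j \<le> (\<Sum>p\<in>P. f p) ^ j / fact j"
proof (induction j)
  case (Suc j)
  have nn: "0 \<le> (\<Prod>p\<in>T. f p)" if "T \<subseteq> P" for T using that assms by (intro prod_nonneg) auto
  have "real (Suc j) * esym f P (Suc j) \<le> (\<Sum>T | T \<subseteq> P \<and> card T = j. (\<Prod>p\<in>T. f p) * (\<Sum>p\<in>P. f p))"
    unfolding esym_Suc[OF assms(1)] using assms nn by (intro sum_mono mult_left_mono sum_mono2) auto
  also have "\<dots> = esym f P j * (\<Sum>p\<in>P. f p)" by (simp add: esym_def sum_distrib_right)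
  also have "\<dots> \<le> (\<Sum>p\<in>P. f p) ^ j / fact j * (\<Sum>p\<in>P. f p)"
    using Suc assms by (intro mult_right_mono sum_nonneg) auto
  finally have "esym f P (Suc j) \<le> (\<Sum>p\<in>P. f p) ^ j / fact j * (\<Sum>p\<in>P. f p) / real (Suc j)"
    by (subst pos_le_divide_eq) (simp_all add: mult.commute)
  then show ?case by (simp add: mult_ac)
qed (use assms in simp)

text \<open>When a set is built up element by element, fewer than \<open>k\<close> elements are
  excluded at each step, and by assumption their weights add up to at most \<open>c\<close>.\<close>

lemma esym_ge:
  assumes "finite P" "\<And>p. p \<in> P \<Longrightarrow> 0 \<le> f p"
    and c: "\<And>T. T \<subseteq> P \<Longrightarrow> card T < k \<Longrightarrow> (\<Sum>p\<in>T. f p) \<le> c" and "c \<le> (\<Sum>p\<in>P. f p)"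
  shows "j \<le> k \<Longrightarrow> ((\<Sum>p\<in>P. f p) - c) ^ j / fact j \<le> esym f P j"
proof (induction j)
  case (Suc j)
  have nn: "0 \<le> (\<Prod>p\<in>T. f p)" if "T \<subseteq> P" for T using that assms by (intro prod_nonneg) auto
  have "((\<Sum>p\<in>P. f p) - c) ^ j / fact j * ((\<Sum>p\<in>P. f p) - c) \<le> esym f P j * ((\<Sum>p\<in>P. f p) - c)"
    using Suc assms by (intro mult_right_mono) auto
  also have "\<dots> = (\<Sum>T | T \<subseteq> P \<and> card T = j. (\<Prod>p\<in>T. f p) * ((\<Sum>p\<in>P. f p) - c))"
    by (simp add: esym_def sum_distrib_right)
  also have "\<dots> \<le> (\<Sum>T | T \<subseteq> P \<and> card T = j. (\<Prod>p\<in>T. f p) * (\<Sum>p\<in>P - T. f p))"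
  proof (intro sum_mono mult_left_mono)
    fix T assume T: "T \<in> {T. T \<subseteq> P \<and> card T = j}"
    then have "(\<Sum>p\<in>T. f p) \<le> c" using Suc.prems by (intro c) auto
    moreover have "(\<Sum>p\<in>P - T. f p) = (\<Sum>p\<in>P. f p) - (\<Sum>p\<in>T. f p)"
      using T assms by (intro sum_diff) auto
    ultimately show "(\<Sum>p\<in>P. f p) - c \<le> (\<Sum>p\<in>P - T. f p)" by simp
  qed (use nn in auto)
  also have "\<dots> = real (Suc j) * esym f P (Suc j)" by (rule esym_Suc[OF assms(1), symmetric])
  finally have "((\<Sum>p\<in>P. f p) - c) ^ j / fact j * ((\<Sum>p\<in>P. f p) - c) / real (Suc j) \<le> esym f P (Suc j)"
    by (subst pos_divide_le_eq) (simp_all add: mult.commute)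
  then show ?case by (simp add: mult_ac)
qed (use assms in simp)

section \<open>Sums over integers and over primes in residue classes\<close>

lemma nat_eq_prod_prime_powers: "u > 0 \<Longrightarrow> (u::nat) = (\<Prod>p\<in>prime_factors u. p ^ multiplicity p u)"
  by (simp add: prime_factorization_nat)

text \<open>An integer with prime factors \<open>T\<close> is determined by its exponents, so the
  sum embeds into one over functions from \<open>T\<close> to \<open>{1..V}\<close>, which
  factorises.\<close>

lemma sum_fixed_prime_factors_le:
  fixes f :: "nat \<Rightarrow> nat \<Rightarrow> real"
  assumes "finite M" "finite T" and M: "\<And>u. u \<in> M \<Longrightarrow> u > 0 \<and> prime_factors u = T"
    and V: "\<And>u p. u \<in> M \<Longrightarrow> p \<in> T \<Longrightarrow> multiplicity p u \<le> V" and f: "\<And>p v. p \<in> T \<Longrightarrow> 0 \<le> f p v"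
  shows "(\<Sum>u\<in>M. \<Prod>p\<in>T. f p (multiplicity p u)) \<le> (\<Prod>p\<in>T. \<Sum>v=1..V. f p v)"
proof -
  let ?e = "\<lambda>u. \<lambda>p\<in>T. multiplicity p u"
  have inj: "inj_on ?e M"
  proof (rule inj_onI)
    fix u w assume u: "u \<in> M" and w: "w \<in> M" and e: "?e u = ?e w"
    have "multiplicity p u = multiplicity p w" if "p \<in> T" for p using fun_cong[OF e, of p] that by simp
    then have "(\<Prod>p\<in>prime_factors u. p ^ multiplicity p u) = (\<Prod>p\<in>prime_factors w. p ^ multiplicity p w)"
      using M[OF u] M[OF w] by (intro prod.cong) auto
    then show "u = w" using nat_eq_prod_prime_powers M[OF u] M[OF w] by metis
  qed
  have "(\<Sum>u\<in>M. \<Prod>p\<in>T. f p (multiplicity p u)) = (\<Sum>g\<in>?e ` M. \<Prod>p\<in>T. f p (g p))"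
    by (subst sum.reindex[OF inj]) simp
  also have "\<dots> \<le> (\<Sum>g\<in>PiE T (\<lambda>_. {1..V}). \<Prod>p\<in>T. f p (g p))"
  proof (intro sum_mono2)
    show "?e ` M \<subseteq> PiE T (\<lambda>_. {1..V})"
    proof (rule image_subsetI)
      fix u assume u: "u \<in> M"
      have "1 \<le> multiplicity p u" if "p \<in> T" for p
        using M[OF u] that by (metis One_nat_def Suc_leI prime_factors_multiplicity mem_Collect_eq)
      then show "?e u \<in> PiE T (\<lambda>_. {1..V})" using V[OF u] by auto
    qed
  qed (use assms in \<open>auto intro!: finite_PiE prod_nonneg\<close>)
  also have "\<dots> = (\<Prod>p\<in>T. \<Sum>v=1..V. f p v)" using assms by (intro prod_sum_PiE[symmetric]) auto
  finally show ?thesis .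
qed

lemma sum_geometric_tail:
  assumes "2 \<le> (p::nat)"
  shows "(\<Sum>v=2..V. 1 / real p ^ v) \<le> 1 / (real p * (real p - 1))"
proof -
  have p: "real p > 1" using assms by simp
  have "(\<Sum>v=2..V. 1 / real p ^ v) \<le> 1 / (real p * (real p - 1)) - 1 / (real p ^ V * (real p - 1))" if "1 \<le> V" for V
    using that
  proof (induction V rule: dec_induct)
    case base then show ?case using p by simp
  next
    case (step V)
    have "1 / real p ^ Suc V = (real p - 1) / (real p ^ Suc V * (real p - 1))" using p by simp
    also have "\<dots> = real p / (real p ^ Suc V * (real p - 1)) - 1 / (real p ^ Suc V * (real p - 1))"
      by (rule diff_divide_distrib)
    also have "real p / (real p ^ Suc V * (real p - 1)) = 1 / (real p ^ V * (real p - 1))" using p by simp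
    finally have "1 / real p ^ Suc V = 1 / (real p ^ V * (real p - 1)) - 1 / (real p ^ Suc V * (real p - 1))" .
    then show ?case using step by simp
  qed
  note * = this
  have nn: "0 \<le> 1 / (real p ^ V * (real p - 1))" using p by simp
  show ?thesis
  proof (cases "1 \<le> V")
    case True
    then show ?thesis using *[of V] nn by linarith
  next
    case False
    then show ?thesis using p by simp
  qed
qed

lemma sum_inverse_consecutive_le:
  assumes "finite T" "\<And>p. p \<in> T \<Longrightarrow> 2 \<le> (p::nat)"
  shows "(\<Sum>p\<in>T. 1 / (real p * (real p - 1))) \<le> 1"
proof -
  obtain K where K: "T \<subseteq> {2..K}" "1 \<le> K"
  proof -
    have "T \<subseteq> {2..Max (insert 1 T)}" using assms by (auto intro: Max_ge)
    moreover have "1 \<le> Max (insert 1 T)" using assms by (intro Max_ge) auto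
    ultimately show ?thesis using that by blast
  qed
  have "(\<Sum>p\<in>T. 1 / (real p * (real p - 1))) \<le> (\<Sum>p=2..K. 1 / (real p * (real p - 1)))"
    using K by (intro sum_mono2) auto
  also have "\<dots> = 1 - 1 / real K" using K(2)
  proof (induction K rule: dec_induct)
    case (step K)
    have "1 / (real (Suc K) * (real (Suc K) - 1)) = 1 / real K - 1 / real (Suc K)"
      using step by (simp add: field_simps)
    then show ?case using step by simp
  qed simp
  finally show ?thesis by (smt (verit) divide_nonneg_nonneg of_nat_0_le_iff)
qed

text \<open>\<open>b P\<close> is the inverse of \<open>s * P\<close> modulo \<open>u\<close>, the
  multiplier of the frequency produced by the Chinese remainder theorem. It determines the class of
  \<open>P\<close> modulo \<open>u\<close>, so each multiplier occurs at most \<open>M\<close>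
  times, and the sum over all multipliers is the first moment.\<close>

lemma sum_weyl_progression:
  fixes M :: real
  assumes u: "u > 0" and PP: "finite PP" "\<And>P. P \<in> PP \<Longrightarrow> P > 0 \<and> coprime u (s * P)" and s: "s > 0"
    and M: "\<And>a. real (card {P \<in> PP. P mod u = a}) \<le> M"
  shows "(\<Sum>P\<in>PP. cmod (weyl n A (u * (s * P)) h))
    \<le> M * (real u * (\<Prod>p\<in>prime_factors u. sqrt (gsq n A h p (multiplicity p u))))"
proof -
  have "\<exists>b. b < u \<and> [s * P * b = 1] (mod u)" if P: "P \<in> PP" for P
  proof -
    obtain b where "[s * P * b = 1] (mod u)"
      using cong_solve_coprime_nat[of "s * P" u] PP(2)[OF P] by (auto simp: coprime_commute)
    then have "[s * P * (b mod u) = 1] (mod u)" by (simp add: cong_def mod_mult_right_eq)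
    then show ?thesis using u by (intro exI[of _ "b mod u"]) auto
  qed
  then obtain b where b: "\<And>P. P \<in> PP \<Longrightarrow> b P < u \<and> [s * P * b P = 1] (mod u)" by metis
  let ?w = "\<lambda>c. cmod (weyl n A u (\<lambda>i. int c * h i))"
  have "(\<Sum>P\<in>PP. cmod (weyl n A (u * (s * P)) h)) \<le> (\<Sum>P\<in>PP. ?w (b P))"
  proof (rule sum_mono)
    fix P assume P: "P \<in> PP"
    have "[int (s * P * b P) = int 1] (mod int u)" using b[OF P] by (simp only: cong_int_iff)
    then have "int u dvd int (s * P) * int (b P) - 1" by (simp add: cong_iff_dvd_diff)
    then show "cmod (weyl n A (u * (s * P)) h) \<le> ?w (b P)"
      using PP(2)[OF P] u s by (intro norm_weyl_mult_le) auto
  qed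
  also have "\<dots> = (\<Sum>c<u. \<Sum>P\<in>{P \<in> PP. b P = c}. ?w (b P))"
    by (rule sum.group[symmetric]) (use PP b in auto)
  also have "\<dots> = (\<Sum>c<u. real (card {P \<in> PP. b P = c}) * ?w c)"
    by (intro sum.cong refl) simp
  also have "\<dots> \<le> (\<Sum>c<u. M * ?w c)"
  proof (intro sum_mono mult_right_mono)
    fix c
    show "real (card {P \<in> PP. b P = c}) \<le> M"
    proof (cases "{P \<in> PP. b P = c} = {}")
      case True
      have "0 \<le> real (card {P \<in> PP. P mod u = 0})" by simp
      also have "\<dots> \<le> M" by (rule M)
      finally show ?thesis unfolding True by simp
    next
      case False
      then obtain P0 where P0: "P0 \<in> PP" "b P0 = c" by auto
      have "{P \<in> PP. b P = c} \<subseteq> {P \<in> PP. P mod u = P0 mod u}"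
      proof safe
        fix P assume P: "P \<in> PP" "c = b P"
        have e: "[P * (s * b P) = P0 * (s * b P)] (mod u)"
          using b[OF P(1)] b[OF P0(1)] P0 P by (metis (no_types, opaque_lifting) cong_sym cong_trans mult.assoc mult.commute)
        have "coprime (P * (s * b P)) u"
          using b[OF P(1)] coprime_iff_invertible_nat by (metis cong_imp_coprime coprime_1_left cong_sym mult.assoc mult.commute)
        then have "coprime (s * b P) u" by simp
        then have "[P = P0] (mod u)" using e by (simp add: cong_mult_rcancel_nat)
        then show "P mod u = P0 mod u" by (simp add: cong_def)
      qed
      then have "card {P \<in> PP. b P = c} \<le> card {P \<in> PP. P mod u = P0 mod u}"
        using PP by (intro card_mono) auto
      then show ?thesis using M[of "P0 mod u"] by linarith
    qed
  qed auto
  also have "\<dots> = M * (\<Sum>c<u. ?w c)" by (simp add: sum_distrib_left)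
  also have "\<dots> \<le> M * (real u * (\<Prod>p\<in>prime_factors u. sqrt (gsq n A h p (multiplicity p u))))"
  proof (intro mult_left_mono sum_norm_weyl_le u)
    have "0 \<le> real (card {P \<in> PP. P mod u = 0})" by simp
    then show "0 \<le> M" using M[of 0] by linarith
  qed
  finally show ?thesis .
qed

section \<open>Upper bound for the sum of Weyl sums\<close>

definition Qprimes :: "nat \<Rightarrow> (nat \<Rightarrow> (nat \<Rightarrow> nat) set) \<Rightarrow> nat set" where
  "Qprimes n A = {p. prime p \<and> p \<in> Q_set n A}"

definition small_primes :: "nat \<Rightarrow> (nat \<Rightarrow> (nat \<Rightarrow> nat) set) \<Rightarrow> real \<Rightarrow> nat set" where
  "small_primes n A y = {p \<in> Qprimes n A. real p \<le> y}"

definition large_primes :: "nat \<Rightarrow> (nat \<Rightarrow> (nat \<Rightarrow> nat) set) \<Rightarrow> real \<Rightarrow> real \<Rightarrow> nat set" where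
  "large_primes n A y x = {p \<in> Qprimes n A. y < real p \<and> real p \<le> x}"

text \<open>The factor \<open>w\<close> of the overview, encoded by its set of primes. The bound
  \<open>X\<close> will be \<open>x / z\<close>, which leaves room for a prime of size at least
  \<open>z\<close>.\<close>

definition rough_sets :: "nat set \<Rightarrow> real \<Rightarrow> nat \<Rightarrow> nat set set" where
  "rough_sets P X i = {T. T \<subseteq> P \<and> card T = i \<and> real (\<Prod>T) \<le> X}"

text \<open>The bound \<open>y\<close> is put on full prime powers and not just on primes; this
  yields \<open>u \<le> y^j\<close> and keeps \<open>u\<close> small against the range of
  \<open>P\<close>.\<close>

definition smooth_nums :: "nat \<Rightarrow> (nat \<Rightarrow> (nat \<Rightarrow> nat) set) \<Rightarrow> real \<Rightarrow> nat \<Rightarrow> nat set" where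
  "smooth_nums n A y j = {u. u \<in> Q_set n A \<and> card (prime_factors u) = j \<and>
      (\<forall>p\<in>prime_factors u. real (p ^ multiplicity p u) \<le> y)}"

definition gfun :: "nat \<Rightarrow> (nat \<Rightarrow> (nat \<Rightarrow> nat) set) \<Rightarrow> (nat \<Rightarrow> int) \<Rightarrow> nat \<Rightarrow> real" where
  "gfun n A h u = (\<Prod>p\<in>prime_factors u. sqrt (gsq n A h p (multiplicity p u)))"

definition Fsum :: "nat set \<Rightarrow> real \<Rightarrow> nat \<Rightarrow> real" where
  "Fsum P X i = (\<Sum>T\<in>rough_sets P X i. 1 / real (\<Prod>T))"

definition Esum :: "nat \<Rightarrow> (nat \<Rightarrow> (nat \<Rightarrow> nat) set) \<Rightarrow> (nat \<Rightarrow> int) \<Rightarrow> real \<Rightarrow> nat \<Rightarrow> real" where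
  "Esum n A h y j = (\<Sum>u\<in>smooth_nums n A y j. gfun n A h u / real u)"

lemma finite_nat_le_real [simp]: "finite {p::nat. P p \<and> real p \<le> y}"
  by (rule finite_subset[of _ "{..nat \<lfloor>y\<rfloor>}"]) (auto simp: le_nat_floor)

lemma finite_small_primes [simp]: "finite (small_primes n A y)"
  unfolding small_primes_def by (rule finite_subset[OF _ finite_nat_le_real[of "\<lambda>_. True" y]]) auto

lemma finite_large_primes [simp]: "finite (large_primes n A y x)"
  unfolding large_primes_def by (rule finite_subset[OF _ finite_nat_le_real[of "\<lambda>_. True" x]]) auto

lemma finite_rough_sets: "finite P \<Longrightarrow> finite (rough_sets P X i)"
  unfolding rough_sets_def by (rule finite_subset[of _ "Pow P"]) auto

lemma gsq_nonneg: "0 \<le> gsq n A h p v"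
  by (simp add: gsq_def)

lemma gfun_nonneg: "0 \<le> gfun n A h u"
  unfolding gfun_def by (intro prod_nonneg) (auto simp: gsq_nonneg)

lemma real_eq_prod_prime_powers: "u > 0 \<Longrightarrow> real u = (\<Prod>p\<in>prime_factors u. real p ^ multiplicity p u)"
  using arg_cong[OF nat_eq_prod_prime_powers[of u], of real] by simp

lemma smooth_nums_le: "u \<in> smooth_nums n A y j \<Longrightarrow> real u \<le> y ^ j"
proof -
  assume u: "u \<in> smooth_nums n A y j"
  then have "u > 0" by (simp add: smooth_nums_def Q_set_def)
  then have "real u = (\<Prod>p\<in>prime_factors u. real p ^ multiplicity p u)" by (rule real_eq_prod_prime_powers)
  also have "\<dots> \<le> (\<Prod>p\<in>prime_factors u. y)"
    using u by (intro prod_mono) (auto simp: smooth_nums_def)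
  finally show ?thesis using u by (simp add: smooth_nums_def)
qed

lemma finite_smooth_nums [simp]: "finite (smooth_nums n A y j)"
  by (rule finite_subset[OF _ finite_nat_le_real[of "\<lambda>_. True" "y ^ j"]]) (auto dest: smooth_nums_le)

lemma prime_factors_prod_primes:
  assumes "finite V" "\<And>p. p \<in> V \<Longrightarrow> prime (p::nat)"
  shows "prime_factors (\<Prod>V) = V" "\<And>p. p \<in> V \<Longrightarrow> multiplicity p (\<Prod>V) = 1"
proof -
  have m: "multiplicity p (\<Prod>V) = (if p \<in> V then 1 else 0)" if "prime p" for p
    using multiplicity_prod_prime_powers[of V p "\<lambda>_. 1"] assms that by simp
  then show "\<And>p. p \<in> V \<Longrightarrow> multiplicity p (\<Prod>V) = 1" using assms by simp
  have "\<Prod>V > 0" using assms by (rule prod_primes_pos)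
  then show "prime_factors (\<Prod>V) = V"
    using m assms by (auto simp: prime_factors_multiplicity split: if_splits)
qed

lemma prod_Qprimes_in_Q_set:
  assumes "finite V" "V \<subseteq> Qprimes n A"
  shows "\<Prod>V \<in> Q_set n A"
proof -
  have pr: "\<And>p. p \<in> V \<Longrightarrow> prime p" using assms by (auto simp: Qprimes_def)
  note pf = prime_factors_prod_primes[OF assms(1) pr]
  have "\<Prod>V > 0" using assms(1) pr by (rule prod_primes_pos)
  moreover have "p ^ multiplicity p (\<Prod>V) \<in> Q_set n A" if "p \<in> prime_factors (\<Prod>V)" for p
  proof -
    have "p \<in> V" using that pf(1) by simp
    then have "p ^ multiplicity p (\<Prod>V) = p" "p \<in> Q_set n A" using pf(2)[of p] assms(2) by (auto simp: Qprimes_def)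
    then show ?thesis by simp
  qed
  ultimately show ?thesis using Q_set_iff by blast
qed

lemma esym_inverse_eq:
  "esym (\<lambda>p. 1 / real p) P j = (\<Sum>T | T \<subseteq> P \<and> card T = j. 1 / real (\<Prod>T))"
  unfolding esym_def by (intro sum.cong refl) (simp add: prod_dividef)

lemma Fsum_le:
  assumes "finite P"
  shows "Fsum P X i \<le> (\<Sum>p\<in>P. 1 / real p) ^ i / fact i"
proof -
  have "Fsum P X i \<le> esym (\<lambda>p. 1 / real p) P i"
    unfolding Fsum_def esym_inverse_eq rough_sets_def
    using assms by (intro sum_mono2) (auto intro: prod_nonneg)
  also have "\<dots> \<le> (\<Sum>p\<in>P. 1 / real p) ^ i / fact i" by (rule esym_le) (use assms in auto)
  finally show ?thesis .
qed

lemma Fsum_nonneg: "0 \<le> Fsum P X i"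
  unfolding Fsum_def by (intro sum_nonneg) (auto intro: prod_nonneg)

lemma Fsum_0: "finite P \<Longrightarrow> 1 \<le> X \<Longrightarrow> Fsum P X 0 = 1"
proof -
  assume "finite P" "1 \<le> X"
  then have "rough_sets P X 0 = {{}}" by (auto simp: rough_sets_def dest: finite_subset)
  then show ?thesis by (simp add: Fsum_def)
qed

lemma Esum_nonneg: "0 \<le> Esum n A h y j"
  unfolding Esum_def by (intro sum_nonneg divide_nonneg_nonneg gfun_nonneg) auto

text \<open>
  A prime \<open>p\<close> outside \<open>Q\<close> may divide an element of \<open>Q\<close> to a higher power; such \<open>p\<close>, and all
  exponents \<open>v \<ge> 2\<close>, are absorbed in the summand 1 of \<open>B\<close>.
\<close>

lemma Esum_le:
  assumes "B = (\<Sum>p\<in>small_primes n A y. sqrt (gsq n A h p 1) / real p) + 1"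
  shows "Esum n A h y j \<le> B ^ j / fact j"
proof -
  let ?S = "smooth_nums n A y j" and ?R = "{p. prime p \<and> real p \<le> y}"
  define f where "f = (\<lambda>p v. if p ^ v \<in> Q_set n A then sqrt (gsq n A h p v) / real p ^ v else 0)"
  \<comment> \<open>Since \<open>v < p ^ v \<le> y\<close>, no exponent exceeds \<open>V\<close>,
    and the sums over exponents are finite.\<close>
  define V where "V = nat \<lfloor>y\<rfloor>"
  define b where "b = (\<lambda>p. \<Sum>v=1..V. f p v)"
  have f0: "0 \<le> f p v" for p v by (simp add: f_def gsq_nonneg)
  have SS: "prime_factors u \<in> {T. T \<subseteq> ?R \<and> card T = j}" if u: "u \<in> ?S" for u
  proof -
    have "real p \<le> y" if p: "p \<in> prime_factors u" for p
    proof -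
      have "p dvd p ^ multiplicity p u" using p u by (intro dvd_power) (auto simp: prime_factors_multiplicity)
      then have "p \<le> p ^ multiplicity p u" using p by (intro dvd_imp_le) (auto simp: prime_gt_0_nat in_prime_factors_imp_prime)
      then have "real p \<le> real (p ^ multiplicity p u)" by (simp only: of_nat_le_iff)
      also have "\<dots> \<le> y" using u p by (simp add: smooth_nums_def)
      finally show ?thesis .
    qed
    then show ?thesis using u by (auto simp: smooth_nums_def in_prime_factors_imp_prime)
  qed
  have "Esum n A h y j = (\<Sum>u\<in>?S. \<Prod>p\<in>prime_factors u. f p (multiplicity p u))"
    unfolding Esum_def
  proof (intro sum.cong refl)
    fix u assume u: "u \<in> ?S"
    then have "u > 0" by (simp add: smooth_nums_def Q_set_def)
    have "gfun n A h u / real u = (\<Prod>p\<in>prime_factors u. sqrt (gsq n A h p (multiplicity p u)) / real p ^ multiplicity p u)"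
      unfolding gfun_def prod_dividef using real_eq_prod_prime_powers[OF \<open>u > 0\<close>] by simp
    also have "\<dots> = (\<Prod>p\<in>prime_factors u. f p (multiplicity p u))"
    proof (intro prod.cong refl)
      fix p assume "p \<in> prime_factors u"
      then have "p ^ multiplicity p u \<in> Q_set n A" using u Q_set_iff[of u n A] by (auto simp: smooth_nums_def)
      then show "sqrt (gsq n A h p (multiplicity p u)) / real p ^ multiplicity p u = f p (multiplicity p u)"
        by (simp add: f_def)
    qed
    finally show "gfun n A h u / real u = (\<Prod>p\<in>prime_factors u. f p (multiplicity p u))" .
  qed
  also have "\<dots> = (\<Sum>T | T \<subseteq> ?R \<and> card T = j. \<Sum>u\<in>{u\<in>?S. prime_factors u = T}. \<Prod>p\<in>prime_factors u. f p (multiplicity p u))"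
    by (rule sum.group[symmetric]) (use SS in auto)
  also have "\<dots> \<le> (\<Sum>T | T \<subseteq> ?R \<and> card T = j. \<Prod>p\<in>T. b p)"
  proof (rule sum_mono)
    fix T assume T: "T \<in> {T. T \<subseteq> ?R \<and> card T = j}"
    have "(\<Sum>u\<in>{u\<in>?S. prime_factors u = T}. \<Prod>p\<in>prime_factors u. f p (multiplicity p u)) =
       (\<Sum>u\<in>{u\<in>?S. prime_factors u = T}. \<Prod>p\<in>T. f p (multiplicity p u))"
      by (intro sum.cong refl) auto
    also have "\<dots> \<le> (\<Prod>p\<in>T. b p)" unfolding b_def
    proof (rule sum_fixed_prime_factors_le)
      show "finite {u\<in>?S. prime_factors u = T}" by simp
      show "finite T" using T by (auto intro: finite_subset)
      fix u p assume u: "u \<in> {u\<in>?S. prime_factors u = T}" and p: "p \<in> T"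
      have "prime p" using T p by auto
      then have "p > 1" by (rule prime_gt_1_nat)
      then have "multiplicity p u < p ^ multiplicity p u" using power_gt_expt[of p "multiplicity p u"] by simp
      moreover have "real (p ^ multiplicity p u) \<le> y" using u p by (auto simp: smooth_nums_def)
      ultimately show "multiplicity p u \<le> V" unfolding V_def by (intro le_nat_floor) linarith
    qed (use f0 in \<open>auto simp: smooth_nums_def Q_set_def\<close>)
    finally show "(\<Sum>u\<in>{u\<in>?S. prime_factors u = T}. \<Prod>p\<in>prime_factors u. f p (multiplicity p u)) \<le> (\<Prod>p\<in>T. b p)" .
  qed
  also have "\<dots> = esym b ?R j" by (simp add: esym_def)
  also have "\<dots> \<le> (\<Sum>p\<in>?R. b p) ^ j / fact j"
    by (rule esym_le) (auto simp: b_def intro: sum_nonneg f0)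
  also have "\<dots> \<le> B ^ j / fact j"
  proof (intro divide_right_mono power_mono)
    have bp: "b p \<le> (if p \<in> Q_set n A then sqrt (gsq n A h p 1) / real p else 0) + 1 / (real p * (real p - 1))"
      if "p \<in> ?R" for p
    proof (cases "1 \<le> V")
      case True
      have p2: "2 \<le> p" using that by (auto dest: prime_ge_2_nat)
      have "{1..V} = insert 1 {2..V}" using True by auto
      then have "b p = f p 1 + (\<Sum>v=2..V. f p v)" by (simp add: b_def)
      also have "(\<Sum>v=2..V. f p v) \<le> (\<Sum>v=2..V. 1 / real p ^ v)"
        by (intro sum_mono) (auto simp: f_def gsq_def)
      also have "\<dots> \<le> 1 / (real p * (real p - 1))" by (rule sum_geometric_tail[OF p2])
      finally have "b p \<le> f p 1 + 1 / (real p * (real p - 1))" by simp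
      moreover have "f p 1 = (if p \<in> Q_set n A then sqrt (gsq n A h p 1) / real p else 0)" by (simp add: f_def)
      ultimately show ?thesis by simp
    next
      case False
      have "2 \<le> p" using that by (auto dest: prime_ge_2_nat)
      then show ?thesis using False by (auto simp: b_def gsq_nonneg intro!: add_nonneg_nonneg)
    qed
    have "(\<Sum>p\<in>?R. b p) \<le> (\<Sum>p\<in>?R. (if p \<in> Q_set n A then sqrt (gsq n A h p 1) / real p else 0)) + (\<Sum>p\<in>?R. 1 / (real p * (real p - 1)))"
      unfolding sum.distrib[symmetric] by (intro sum_mono bp)
    also have "(\<Sum>p\<in>?R. 1 / (real p * (real p - 1))) \<le> 1"
      by (rule sum_inverse_consecutive_le) (auto dest: prime_ge_2_nat)
    also have "(\<Sum>p\<in>?R. (if p \<in> Q_set n A then sqrt (gsq n A h p 1) / real p else 0)) = (\<Sum>p\<in>{p\<in>?R. p \<in> Q_set n A}. sqrt (gsq n A h p 1) / real p)"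
      by (rule sum.inter_filter[symmetric]) simp
    also have "{p\<in>?R. p \<in> Q_set n A} = small_primes n A y" by (auto simp: small_primes_def Qprimes_def)
    finally show "(\<Sum>p\<in>?R. b p) \<le> B" unfolding assms by simp
  qed (auto simp: b_def intro!: sum_nonneg f0)
  finally show ?thesis .
qed

section \<open>Averaging over the large prime\<close>

text \<open>\<open>r\<close> bounds \<open>u\<close>, and its integer part is the sieve level. The
  exponent 1/16 is generous: what matters is that the sieve remainder times \<open>u\<close>, at
  most \<open>r ^ 5\<close>, is below \<open>z / ln z\<close>.\<close>

lemma floor_root_bounds:
  fixes z r :: real
  assumes r: "r = z powr (1/16)" "4 \<le> r" and z: "0 < z"
  shows "2 \<le> nat \<lfloor>r\<rfloor>" "ln z / 32 \<le> ln (real (nat \<lfloor>r\<rfloor>))" "real (nat \<lfloor>r\<rfloor>) \<le> r" "z = r ^ 16" "r \<le> z" "0 < ln z" "r ^ 5 * ln z \<le> z"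
proof -
  show z16: "z = r ^ 16" using z unfolding r by (simp add: powr_powr flip: powr_realpow)
  show le: "real (nat \<lfloor>r\<rfloor>) \<le> r" using r(2) by simp
  show "2 \<le> nat \<lfloor>r\<rfloor>" using r(2) by linarith
  have lnz: "ln z = 16 * ln r" unfolding z16 by (simp add: ln_realpow)
  show "0 < ln z" unfolding lnz using r(2) by simp
  have "r * 1 \<le> r * r ^ 15" using r(2) by (intro mult_left_mono one_le_power) auto
  then show "r \<le> z" unfolding z16 by (simp flip: power_Suc)
  have "sqrt r \<le> r / 2" using r(2) by (intro real_le_lsqrt) (auto simp: power2_eq_square field_simps)
  also have "\<dots> \<le> real (nat \<lfloor>r\<rfloor>)" using r(2) by linarith
  finally have "ln (sqrt r) \<le> ln (real (nat \<lfloor>r\<rfloor>))" using r(2) by (subst ln_le_cancel_iff) auto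
  then show "ln z / 32 \<le> ln (real (nat \<lfloor>r\<rfloor>))" using r(2) by (simp add: lnz ln_sqrt)
  have "ln r \<le> r" using ln_le_minus_one[of r] r(2) by linarith
  then have "ln z \<le> 16 * r" unfolding lnz by simp
  also have "\<dots> \<le> r * r * r" using mult_mono[of 4 r 4 r] r(2) by (intro mult_right_mono) auto
  finally have "r ^ 5 * ln z \<le> r ^ 5 * (r * r * r)" using r(2) by (intro mult_left_mono) auto
  also have "\<dots> = r ^ 8" by (simp add: eval_nat_numeral)
  also have "\<dots> \<le> r ^ 16" using r(2) by (intro power_increasing) auto
  finally show "r ^ 5 * ln z \<le> z" using z16 by simp
qed

text \<open>For fixed \<open>u\<close> and \<open>T\<close> the primes \<open>P\<close> run up to
  \<open>t = x / (\<Prod>T * u)\<close>, which is at least \<open>z\<close> unless there are none.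
  Each class modulo \<open>u\<close> receives a number of them of order at most
  \<open>k * t / (u * ln z)\<close>, and the mean over classes turns the Weyl sum into
  \<open>gfun n A h u\<close>.\<close>

lemma sum_weyl_over_prime:
  fixes x y z r :: real
  assumes u: "u > 0" "card (prime_factors u) < k" "real u \<le> r" and uy: "\<And>p. p \<in> prime_factors u \<Longrightarrow> real p \<le> y"
    and T: "finite T" "\<And>p. p \<in> T \<Longrightarrow> prime p \<and> y < real p"
    and r: "r = z powr (1/16)" "4 \<le> r" and z: "0 < z" "y < z" and x: "0 \<le> x"
    and PP: "PP = {P. prime P \<and> P \<notin> T \<and> z \<le> real P \<and> real (\<Prod>T) * real u * real P \<le> x}"
  shows "(\<Sum>P\<in>PP. cmod (weyl n A (u * (\<Prod>T * P)) h)) \<le> 130 * real k / ln z * x * (1 / real (\<Prod>T) * (gfun n A h u / real u))"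
proof (cases "PP = {}")
  case True
  have "0 \<le> 130 * real k / ln z * x * (1 / real (\<Prod>T) * (gfun n A h u / real u))"
    using floor_root_bounds[OF r z(1)] x
    by (intro mult_nonneg_nonneg divide_nonneg_nonneg gfun_nonneg) (auto intro: prod_nonneg)
  then show ?thesis unfolding True by simp
next
  case False
  note fb = floor_root_bounds[OF r z(1)]
  define D where "D = nat \<lfloor>r\<rfloor>"
  have T0: "\<Prod>T > 0" using T by (intro prod_primes_pos) auto
  define t where "t = x / (real (\<Prod>T) * real u)"
  have den: "0 < real (\<Prod>T) * real u" using T0 u by (simp del: of_nat_prod)
  have PPt: "real P \<le> t" if "P \<in> PP" for P
  proof -
    have "real P * (real (\<Prod>T) * real u) \<le> x" using that unfolding PP by (simp only: mem_Collect_eq mult_ac)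
    then show ?thesis unfolding t_def using den by (simp only: pos_le_divide_eq)
  qed
  obtain P0 where P0: "P0 \<in> PP" using False by blast
  then have "z \<le> real P0" unfolding PP by simp
  then have "z \<le> t" using PPt[OF P0] by linarith
  define Y where "Y = nat \<lfloor>t\<rfloor>"
  have Yt: "real Y \<le> t" using \<open>z \<le> t\<close> z unfolding Y_def by simp
  have finPP: "finite PP"
    by (rule finite_subset[OF _ finite_nat_le_real[of "\<lambda>_. True" t]]) (use PPt in auto)
  define M where "M = 2 * real k * (real Y / real u + 1) / ln (real D) + real D ^ 4"
  have lnD: "0 < ln (real D)" using fb(2,6) unfolding D_def by linarith
  have M: "real (card {P \<in> PP. P mod u = a}) \<le> M" for a
  proof -
    have "{P \<in> PP. P mod u = a} \<subseteq> {p. prime p \<and> D < p \<and> p \<le> Y \<and> p mod u = a}"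
    proof safe
      fix P assume P: "P \<in> PP"
      then show "prime P" by (simp add: PP)
      show "P \<le> Y" unfolding Y_def using PPt[OF P] by (rule le_nat_floor)
      have "r < z"
      proof -
        have "r * 1 < r * r ^ 15" using r(2) by (intro mult_strict_left_mono one_less_power) auto
        then show ?thesis unfolding fb(4) by (simp flip: power_Suc)
      qed
      moreover have "real D \<le> r" using fb(3) by (simp add: D_def)
      moreover have "z \<le> real P" using P by (simp add: PP)
      ultimately have "real D < real P" by linarith
      then show "D < P" by simp
    qed
    moreover have "finite {p. prime p \<and> D < p \<and> p \<le> Y \<and> p mod u = a}"
      by (rule finite_subset[of _ "{..Y}"]) auto
    ultimately have "card {P \<in> PP. P mod u = a} \<le> card {p. prime p \<and> D < p \<and> p \<le> Y \<and> p mod u = a}"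
      by (intro card_mono)
    then have "real (card {P \<in> PP. P mod u = a}) \<le> real (card {p. prime p \<and> D < p \<and> p \<le> Y \<and> p mod u = a})" by simp
    also have "\<dots> \<le> 2 * (real (card (prime_factors u)) + 1) * (real Y / real u + 1) / ln (real D) + real D ^ 4"
      using u fb(1) unfolding D_def by (intro brun_titchmarsh) auto
    also have "\<dots> \<le> M" unfolding M_def
      using u lnD by (intro add_right_mono divide_right_mono mult_right_mono mult_left_mono) auto
    finally show ?thesis .
  qed
  have cop: "P > 0 \<and> coprime u (\<Prod>T * P)" if P: "P \<in> PP" for P
  proof -
    have "coprime u q" if "prime q" "y < real q" for q
    proof -
      have "\<not> q dvd u"
      proof
        assume "q dvd u"
        then have "q \<in> prime_factors u" using that u by (simp add: in_prime_factors_iff)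
        then show False using uy[of q] that by simp
      qed
      then show ?thesis using that by (metis coprime_commute prime_imp_coprime)
    qed
    then have "coprime u (\<Prod>T)" "coprime u P" using T P z by (auto intro!: prod_coprime_right simp: PP)
    then show ?thesis using P by (auto simp: PP prime_gt_0_nat)
  qed
  have "(\<Sum>P\<in>PP. cmod (weyl n A (u * (\<Prod>T * P)) h)) \<le> M * (real u * gfun n A h u)"
    unfolding gfun_def by (rule sum_weyl_progression[OF u(1) finPP cop T0 M])
  also have "\<dots> = (M * real u) * gfun n A h u" by simp
  also have "\<dots> \<le> (130 * real k / ln z * t) * gfun n A h u"
  proof (intro mult_right_mono gfun_nonneg)
    have k1: "1 \<le> real k" using u(2) by simp
    \<comment> \<open>Thus the summand 1 in \<open>Y / u + 1\<close> at most doubles the main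
      term.\<close>
    have rz: "real u \<le> t" using u(3) fb(5) \<open>z \<le> t\<close> by linarith
    have "M * real u = 2 * real k * (real Y + real u) / ln (real D) + real D ^ 4 * real u"
    proof -
      have "(real Y / real u + 1) * real u = real Y + real u" using u(1) by (simp add: field_simps)
      then have "2 * real k * ((real Y / real u + 1) * real u) / ln (real D) = 2 * real k * (real Y + real u) / ln (real D)" by simp
      then show ?thesis unfolding M_def by (simp add: distrib_right)
    qed
    \<comment> \<open>The constant 130 is \<open>2 * 2 * 32\<close> from the main term, by
      \<open>Y + u \<le> 2 * t\<close> and \<open>ln D \<ge> ln z / 32\<close>, plus 2 for the sieve
      remainder.\<close>
    also have "\<dots> \<le> 2 * real k * (t + t) / (ln z / 32) + r ^ 4 * r"
      using fb Yt rz k1 u(3) r(2) unfolding D_def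
      by (intro add_mono frac_le mult_mono mult_left_mono power_mono) auto
    also have "r ^ 4 * r \<le> t / ln z"
      using fb(6,7) \<open>z \<le> t\<close> by (simp add: pos_le_divide_eq eval_nat_numeral mult_ac)
    also have "t / ln z \<le> 2 * real k * t / ln z"
    proof (intro divide_right_mono)
      have "1 * t \<le> 2 * real k * t" using k1 \<open>z \<le> t\<close> z by (intro mult_right_mono) auto
      then show "t \<le> 2 * real k * t" by simp
    qed (use fb(6) in auto)
    also have "2 * real k * (t + t) / (ln z / 32) + 2 * real k * t / ln z = 130 * real k / ln z * t"
      using fb(6) by (simp add: field_simps)
    finally show "M * real u \<le> 130 * real k / ln z * t" by simp
  qed
  finally show ?thesis unfolding t_def by (simp add: mult_ac del: of_nat_prod)
qed

section \<open>Decomposition of the good moduli\<close>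

lemma prod_split_primes:
  assumes q: "q > (0::nat)" and TP: "finite T" "P \<notin> T" "insert P T = {p \<in> prime_factors q. \<not> S p}"
    and m: "\<forall>p\<in>insert P T. multiplicity p q = 1"
    and u: "u = (\<Prod>p\<in>{p \<in> prime_factors q. S p}. p ^ multiplicity p q)"
  shows "q = u * (\<Prod>T * P)" "u > 0" "prime_factors u = {p \<in> prime_factors q. S p}"
    "\<And>p. p \<in> prime_factors u \<Longrightarrow> multiplicity p u = multiplicity p q"
proof -
  let ?U = "{p \<in> prime_factors q. S p}"
  have "q = (\<Prod>p\<in>prime_factors q. p ^ multiplicity p q)" using q by (rule nat_eq_prod_prime_powers)
  also have "prime_factors q = ?U \<union> insert P T" unfolding TP(3) by auto
  also have "(\<Prod>p\<in>?U \<union> insert P T. p ^ multiplicity p q) = u * (\<Prod>p\<in>insert P T. p ^ multiplicity p q)"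
    unfolding u using TP by (intro prod.union_disjoint) auto
  also have "(\<Prod>p\<in>insert P T. p ^ multiplicity p q) = (\<Prod>p\<in>insert P T. p)"
    by (intro prod.cong refl) (use m in auto)
  also have "\<dots> = \<Prod>T * P" using TP(1,2) by (simp add: mult.commute)
  finally show "q = u * (\<Prod>T * P)" .
  then show u0: "u > 0" using q by (cases u) auto
  have mu: "multiplicity p u = (if p \<in> ?U then multiplicity p q else 0)" if "prime p" for p
    unfolding u using that by (intro multiplicity_prod_prime_powers) auto
  show pu: "prime_factors u = ?U"
    using mu u0 q by (auto simp: prime_factors_multiplicity split: if_splits)
  show "\<And>p. p \<in> prime_factors u \<Longrightarrow> multiplicity p u = multiplicity p q"
    using mu pu by (auto simp: in_prime_factors_imp_prime)
qed

text \<open>Each good \<open>q\<close> is assigned one quadruple \<open>(i, T, u, P)\<close> from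
  which \<open>q\<close> is recovered as a product. The assignment is therefore injective, and since
  all terms are nonnegative the sum may be extended to all quadruples, where it factorises.\<close>

lemma sum_weyl_good_le:
  fixes x y z r :: real
  assumes k: "1 \<le> k" and yk: "1 \<le> y" "y ^ k \<le> r" and r: "r = z powr (1/16)" "4 \<le> r" and z: "0 < z" "y < z" and x: "0 \<le> x"
    and G: "G \<subseteq> Q_k_upto n A k x"
    and Gz: "\<And>q. q \<in> G \<Longrightarrow> \<exists>P\<in>prime_factors q. z \<le> real P"
    and Gm: "\<And>q p. q \<in> G \<Longrightarrow> p \<in> prime_factors q \<Longrightarrow> 2 \<le> multiplicity p q \<Longrightarrow> real (p ^ multiplicity p q) \<le> y"
  shows "(\<Sum>q\<in>G. cmod (weyl n A q h)) \<le>
    130 * real k / ln z * x * (\<Sum>i<k. Fsum (large_primes n A y x) (x / z) i * Esum n A h y (k - 1 - i))"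
proof -
  define L where "L = large_primes n A y x"
  have finL: "finite L" by (simp add: L_def)
  define PP where "PP = (\<lambda>T u. {P. prime P \<and> P \<notin> T \<and> z \<le> real P \<and> real (\<Prod>T) * real u * real P \<le> x})"
  define I where "I = Sigma {..<k} (\<lambda>i. Sigma (rough_sets L (x / z) i) (\<lambda>T. Sigma (smooth_nums n A y (k - 1 - i)) (PP T)))"
  let ?val = "\<lambda>a. case a of (i::nat, T, u, P) \<Rightarrow> u * (\<Prod>T * P)"
  have Tprops: "finite T" "\<And>p. p \<in> T \<Longrightarrow> prime p \<and> y < real p" "\<Prod>T > 0" if "T \<in> rough_sets L X i" for T X i
  proof -
    show a: "finite T" using that finL by (auto simp: rough_sets_def intro: finite_subset)
    show b: "\<And>p. p \<in> T \<Longrightarrow> prime p \<and> y < real p" using that by (auto simp: rough_sets_def L_def large_primes_def Qprimes_def)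
    show "\<Prod>T > 0" using a b by (intro prod_primes_pos) auto
  qed
  have finPP: "finite (PP T u)" if "T \<in> rough_sets L X i" "u > 0" for T X i u
  proof (rule finite_subset[OF _ finite_nat_le_real[of "\<lambda>_. True" x]], safe)
    fix P assume "P \<in> PP T u"
    then have "real (\<Prod>T * u * P) \<le> x" by (simp add: PP_def)
    moreover have "1 * P \<le> (\<Prod>T * u) * P" using Tprops(3)[OF that(1)] that(2) by (intro mult_right_mono) auto
    then have "real P \<le> real (\<Prod>T * u * P)" by (simp only: of_nat_le_iff mult_1)
    ultimately show "real P \<le> x" by linarith
  qed
  have u0: "u > 0" if "u \<in> smooth_nums n A y j" for u j using that by (simp add: smooth_nums_def Q_set_def)
  have finI: "finite I" unfolding I_def
    by (intro finite_SigmaI finite_rough_sets finL finPP) (auto intro: u0)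
  have G0: "q > 0" "card (prime_factors q) = k" "real q \<le> x" "q \<in> Q_set n A" if "q \<in> G" for q
    using that G by (auto simp: Q_k_upto_def Q_k_def Q_set_def)
  have "\<exists>a\<in>I. ?val a = q" if q: "q \<in> G" for q
  proof -
    obtain P where P: "P \<in> prime_factors q" "z \<le> real P" using Gz[OF q] by auto
    define T where "T = {p \<in> prime_factors q. y < real p} - {P}"
    define u where "u = (\<Prod>p\<in>{p \<in> prime_factors q. real p \<le> y}. p ^ multiplicity p q)"
    have ins: "insert P T = {p \<in> prime_factors q. \<not> real p \<le> y}" using P z by (auto simp: T_def)
    \<comment> \<open>A prime above \<open>y\<close> dividing \<open>q\<close> more than once would
      give a higher prime power above \<open>y\<close>, which \<open>Gm\<close> excludes.\<close>
    have m: "\<forall>p\<in>insert P T. multiplicity p q = 1"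
    proof (rule ballI, rule ccontr)
      fix p assume p: "p \<in> insert P T"
      assume "multiplicity p q \<noteq> 1"
      moreover have pq: "p \<in> prime_factors q" "y < real p" using p ins by auto
      ultimately have m2: "2 \<le> multiplicity p q" by (simp add: prime_factors_multiplicity)
      have "p dvd p ^ multiplicity p q" using m2 by (intro dvd_power) auto
      then have "p \<le> p ^ multiplicity p q" using pq by (intro dvd_imp_le) (auto simp: prime_gt_0_nat in_prime_factors_imp_prime)
      then have "real p \<le> real (p ^ multiplicity p q)" by (simp only: of_nat_le_iff)
      then show False using Gm[OF q pq(1) m2] pq(2) by linarith
    qed
    have T: "finite T" "P \<notin> T" by (auto simp: T_def)
    note sp = prod_split_primes[where S = "\<lambda>p. real p \<le> y", OF G0(1)[OF q] T ins m u_def]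
    define i where "i = card T"
    have cq: "k = card (prime_factors u) + Suc i"
    proof -
      have "prime_factors q = prime_factors u \<union> insert P T" using sp(3) ins by auto
      moreover have "card (prime_factors u \<union> insert P T) = card (prime_factors u) + card (insert P T)"
        using sp(3) T ins by (intro card_Un_disjoint) auto
      ultimately show ?thesis using G0(2)[OF q] T by (simp add: i_def)
    qed
    have "T \<subseteq> L"
    proof
      fix p assume p: "p \<in> T"
      then have pq: "p \<in> prime_factors q" "y < real p" by (auto simp: T_def)
      have "p ^ multiplicity p q \<in> Q_set n A" using G0(4)[OF q] Q_set_iff[of q n A] pq by blast
      then have "p \<in> Q_set n A" using m p by simp
      moreover have "p \<le> q" using pq G0(1)[OF q] by (intro dvd_imp_le) auto
      then have "real p \<le> x" using G0(3)[OF q] by linarith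
      ultimately show "p \<in> L" using pq by (auto simp: L_def large_primes_def Qprimes_def in_prime_factors_imp_prime)
    qed
    have le: "real (\<Prod>T) * real u * real P \<le> x"
    proof -
      have "real (\<Prod>T) * real u * real P = real q" using arg_cong[OF sp(1), of real] by (simp add: mult_ac)
      then show ?thesis using G0(3)[OF q] by simp
    qed
    have "T \<in> rough_sets L (x / z) i"
    proof -
      have "real (\<Prod>T) * z \<le> real (\<Prod>T) * real u * real P"
      proof -
        have "real (\<Prod>T) * (1 * z) \<le> real (\<Prod>T) * (real u * real P)"
          using sp(2) P z by (intro mult_left_mono mult_mono) (auto intro: prod_nonneg)
        then show ?thesis by (simp add: mult_ac)
      qed
      then have "real (\<Prod>T) \<le> x / z" using le z by (simp add: pos_le_divide_eq)
      then show ?thesis using \<open>T \<subseteq> L\<close> by (simp add: rough_sets_def i_def)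
    qed
    moreover have "u \<in> smooth_nums n A y (k - 1 - i)"
    proof -
      have "u \<in> Q_set n A" unfolding Q_set_iff[of u]
        using sp G0(4)[OF q] Q_set_iff[of q n A] by auto
      moreover have "real (p ^ multiplicity p u) \<le> y" if p: "p \<in> prime_factors u" for p
      proof (cases "2 \<le> multiplicity p q")
        case True
        then show ?thesis using Gm[OF q] p sp(3,4) by auto
      next
        case False
        have "multiplicity p q \<le> 1" using False by simp
        then have "real (p ^ multiplicity p q) \<le> real (p ^ 1)"
          using p by (subst of_nat_le_iff, intro power_increasing) (auto simp: Suc_le_eq prime_gt_0_nat in_prime_factors_imp_prime)
        also have "\<dots> \<le> y" using p sp(3) by auto
        finally show ?thesis using sp(4)[OF p] by simp
      qed
      moreover have "card (prime_factors u) = k - 1 - i" using cq by simp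
      ultimately show ?thesis unfolding smooth_nums_def by blast
    qed
    moreover have "P \<in> PP T u" using P T le by (auto simp: PP_def in_prime_factors_imp_prime)
    moreover have "i < k" using cq by simp
    ultimately have "(i, T, u, P) \<in> I" by (simp add: I_def)
    moreover have "?val (i, T, u, P) = q" using sp(1) by simp
    ultimately show ?thesis by blast
  qed
  then obtain a where a: "\<And>q. q \<in> G \<Longrightarrow> a q \<in> I \<and> ?val (a q) = q" by metis
  have inja: "inj_on a G" by (rule inj_onI) (metis a)
  have "(\<Sum>q\<in>G. cmod (weyl n A q h)) = (\<Sum>q\<in>G. cmod (weyl n A (?val (a q)) h))" using a by simp
  also have "\<dots> = (\<Sum>b\<in>a ` G. cmod (weyl n A (?val b) h))" by (subst sum.reindex[OF inja]) simp
  also have "\<dots> \<le> (\<Sum>b\<in>I. cmod (weyl n A (?val b) h))"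
    using a by (intro sum_mono2 finI) auto
  also have "\<dots> = (\<Sum>i<k. \<Sum>T\<in>rough_sets L (x / z) i. \<Sum>u\<in>smooth_nums n A y (k - 1 - i). \<Sum>P\<in>PP T u. cmod (weyl n A (u * (\<Prod>T * P)) h))"
  proof -
    have "(\<Sum>b\<in>I. cmod (weyl n A (?val b) h)) = (\<Sum>(i, b)\<in>I. cmod (weyl n A (?val (i, b)) h))"
      by (intro sum.cong refl) auto
    also have "\<dots> = (\<Sum>i<k. \<Sum>b\<in>Sigma (rough_sets L (x / z) i) (\<lambda>T. Sigma (smooth_nums n A y (k - 1 - i)) (PP T)). cmod (weyl n A (?val (i, b)) h))"
      unfolding I_def by (rule sum.Sigma[symmetric]) (auto intro!: finite_SigmaI finite_rough_sets finL finPP u0)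
    also have "\<dots> = (\<Sum>i<k. \<Sum>T\<in>rough_sets L (x / z) i. \<Sum>b\<in>Sigma (smooth_nums n A y (k - 1 - i)) (PP T). cmod (weyl n A (?val (i, T, b)) h))"
    proof (rule sum.cong[OF refl])
      fix i
      have "(\<Sum>T\<in>rough_sets L (x / z) i. \<Sum>b\<in>Sigma (smooth_nums n A y (k - 1 - i)) (PP T). cmod (weyl n A (?val (i, T, b)) h)) =
        (\<Sum>(T, b)\<in>Sigma (rough_sets L (x / z) i) (\<lambda>T. Sigma (smooth_nums n A y (k - 1 - i)) (PP T)). cmod (weyl n A (?val (i, T, b)) h))"
        by (rule sum.Sigma) (auto intro!: finite_SigmaI finite_rough_sets finL finPP u0)
      also have "\<dots> = (\<Sum>b\<in>Sigma (rough_sets L (x / z) i) (\<lambda>T. Sigma (smooth_nums n A y (k - 1 - i)) (PP T)). cmod (weyl n A (?val (i, b)) h))"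
        by (intro sum.cong refl) auto
      finally show "(\<Sum>b\<in>Sigma (rough_sets L (x / z) i) (\<lambda>T. Sigma (smooth_nums n A y (k - 1 - i)) (PP T)). cmod (weyl n A (?val (i, b)) h)) =
        (\<Sum>T\<in>rough_sets L (x / z) i. \<Sum>b\<in>Sigma (smooth_nums n A y (k - 1 - i)) (PP T). cmod (weyl n A (?val (i, T, b)) h))" by (rule sym)
    qed
    also have "\<dots> = (\<Sum>i<k. \<Sum>T\<in>rough_sets L (x / z) i. \<Sum>u\<in>smooth_nums n A y (k - 1 - i). \<Sum>P\<in>PP T u. cmod (weyl n A (u * (\<Prod>T * P)) h))"
    proof (rule sum.cong[OF refl], rule sum.cong[OF refl])
      fix i T assume T: "T \<in> rough_sets L (x / z) i"
      have "(\<Sum>u\<in>smooth_nums n A y (k - 1 - i). \<Sum>P\<in>PP T u. cmod (weyl n A (u * (\<Prod>T * P)) h)) =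
        (\<Sum>(u, P)\<in>Sigma (smooth_nums n A y (k - 1 - i)) (PP T). cmod (weyl n A (u * (\<Prod>T * P)) h))"
        by (rule sum.Sigma) (use finPP[OF T] u0 in auto)
      also have "\<dots> = (\<Sum>b\<in>Sigma (smooth_nums n A y (k - 1 - i)) (PP T). cmod (weyl n A (?val (i, T, b)) h))"
        by (intro sum.cong refl) auto
      finally show "(\<Sum>b\<in>Sigma (smooth_nums n A y (k - 1 - i)) (PP T). cmod (weyl n A (?val (i, T, b)) h)) =
        (\<Sum>u\<in>smooth_nums n A y (k - 1 - i). \<Sum>P\<in>PP T u. cmod (weyl n A (u * (\<Prod>T * P)) h))" by (rule sym)
    qed
    finally show ?thesis .
  qed
  also have "\<dots> \<le> (\<Sum>i<k. \<Sum>T\<in>rough_sets L (x / z) i. \<Sum>u\<in>smooth_nums n A y (k - 1 - i).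
      130 * real k / ln z * x * (1 / real (\<Prod>T) * (gfun n A h u / real u)))"
  proof (intro sum_mono)
    fix i T u assume i: "i \<in> {..<k}" and T: "T \<in> rough_sets L (x / z) i" and u: "u \<in> smooth_nums n A y (k - 1 - i)"
    have ur: "real u \<le> r"
    proof -
      have "real u \<le> y ^ (k - 1 - i)" by (rule smooth_nums_le[OF u])
      also have "\<dots> \<le> y ^ k" using yk by (intro power_increasing) auto
      finally show ?thesis using yk by simp
    qed
    have uy: "real p \<le> y" if p: "p \<in> prime_factors u" for p
    proof -
      have "p dvd p ^ multiplicity p u" using p by (intro dvd_power) (auto simp: prime_factors_multiplicity)
      then have "p \<le> p ^ multiplicity p u" using p by (intro dvd_imp_le) (auto simp: prime_gt_0_nat in_prime_factors_imp_prime)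
      then have "real p \<le> real (p ^ multiplicity p u)" by (simp only: of_nat_le_iff)
      also have "\<dots> \<le> y" using u p by (simp add: smooth_nums_def)
      finally show ?thesis .
    qed
    have "card (prime_factors u) < k" using u k by (auto simp: smooth_nums_def)
    then show "(\<Sum>P\<in>PP T u. cmod (weyl n A (u * (\<Prod>T * P)) h)) \<le> 130 * real k / ln z * x * (1 / real (\<Prod>T) * (gfun n A h u / real u))"
      by (intro sum_weyl_over_prime[OF u0[OF u] _ ur uy Tprops(1,2)[OF T] r z x PP_def[THEN fun_cong, THEN fun_cong]])
  qed
  also have "\<dots> = (\<Sum>i<k. \<Sum>T\<in>rough_sets L (x / z) i. 130 * real k / ln z * x * (1 / real (\<Prod>T) * Esum n A h y (k - 1 - i)))"
    unfolding Esum_def by (simp only: sum_distrib_left)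
  also have "\<dots> = 130 * real k / ln z * x * (\<Sum>i<k. Fsum L (x / z) i * Esum n A h y (k - 1 - i))"
    unfolding Fsum_def by (simp only: sum_distrib_left sum_distrib_right)
  finally show ?thesis unfolding L_def .
qed

section \<open>Lower bound for the number of moduli\<close>

text \<open>Replacing every logarithm by \<open>ln x\<close> turns the lower bound for a logarithmic
  sum into a count; the primes up to \<open>y\<close> and those in \<open>T\<close> are then
  discarded.\<close>

lemma card_primes_between_ge:
  fixes \<alpha> x y t :: real
  assumes th: "\<And>t. x0 \<le> t \<Longrightarrow> \<alpha> * t \<le> (\<Sum>p | prime p \<and> real p \<le> t \<and> 1 \<le> rho n A p. ln (real p))"
    and t: "x0 \<le> t" "1 \<le> t" "t \<le> x" "1 < x" and y: "0 \<le> y" and T: "finite T"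
  shows "\<alpha> * t / ln x - y - real (card T) \<le> real (card {P \<in> Qprimes n A. y < real P \<and> P \<notin> T \<and> real P \<le> t})"
proof -
  let ?P = "{P \<in> Qprimes n A. y < real P \<and> P \<notin> T \<and> real P \<le> t}"
  let ?R = "{p. prime p \<and> real p \<le> t \<and> 1 \<le> rho n A p}"
  have lnx: "0 < ln x" using t by simp
  have finR: "finite ?R" by (rule finite_subset[OF _ finite_nat_le_real[of "\<lambda>_. True" t]]) auto
  have "\<alpha> * t \<le> (\<Sum>p\<in>?R. ln (real p))" by (rule th[OF t(1)])
  also have "\<dots> \<le> (\<Sum>p\<in>?R. ln x)" using t by (intro sum_mono) (auto simp: prime_gt_0_nat)
  finally have "\<alpha> * t / ln x \<le> real (card ?R)" using lnx by (simp add: pos_divide_le_eq)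
  also have "card ?R \<le> card (?P \<union> {1..nat \<lfloor>y\<rfloor>} \<union> T)"
  proof (rule card_mono)
    have "?P \<subseteq> ?R" by (auto simp: Qprimes_def Q_set_def)
    then show "finite (?P \<union> {1..nat \<lfloor>y\<rfloor>} \<union> T)" using finR T by (auto intro: finite_subset)
    show "?R \<subseteq> ?P \<union> {1..nat \<lfloor>y\<rfloor>} \<union> T"
    proof
      fix p assume p: "p \<in> ?R"
      then have p0: "1 \<le> p" by (auto simp: Suc_le_eq prime_gt_0_nat)
      show "p \<in> ?P \<union> {1..nat \<lfloor>y\<rfloor>} \<union> T"
      proof (cases "real p \<le> y")
        case True
        then have "p \<le> nat \<lfloor>y\<rfloor>" by (rule le_nat_floor)
        then show ?thesis using p0 by simp
      next
        case False
        then show ?thesis using p p0 by (auto simp: Qprimes_def Q_set_def)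
      qed
    qed
  qed
  also have "\<dots> \<le> card ?P + card {1..nat \<lfloor>y\<rfloor>} + card T"
    using card_Un_le[of "?P \<union> {1..nat \<lfloor>y\<rfloor>}" T] card_Un_le[of ?P "{1..nat \<lfloor>y\<rfloor>}"] by linarith
  finally have "\<alpha> * t / ln x \<le> real (card ?P) + real (nat \<lfloor>y\<rfloor>) + real (card T)" by simp
  moreover have "real (nat \<lfloor>y\<rfloor>) \<le> y" using y by simp
  ultimately show ?thesis by linarith
qed

text \<open>Moduli are counted together with a marked prime factor \<open>P\<close>, hence the
  factor \<open>k\<close> on the right. The quadruples inject into such pairs because
  \<open>y\<close> separates the primes of \<open>T\<close> from those of \<open>U\<close>. The part
  below \<open>y\<close> is taken squarefree, so that its sums are elementary symmetric.\<close>

lemma card_Q_k_ge: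
  fixes x y z r :: real
  assumes k: "1 \<le> k" and yk: "1 \<le> y" "y ^ k \<le> r" and r: "r = z powr (1/16)" "4 \<le> r" and z: "0 < z" "y < z" and x: "z \<le> x"
    and th: "\<And>t. x0 \<le> t \<Longrightarrow> \<alpha> * t \<le> (\<Sum>p | prime p \<and> real p \<le> t \<and> 1 \<le> rho n A p. ln (real p))"
    and \<alpha>: "0 < \<alpha>" and x0: "x0 \<le> r ^ 15" and big: "(y + real k) * (2 * ln x) \<le> \<alpha> * r ^ 15"
  shows "\<alpha> * x / (2 * ln x) * (\<Sum>i<k. Fsum (large_primes n A y x) (x / z) i * esym (\<lambda>p. 1 / real p) (small_primes n A y) (k - 1 - i))
    \<le> real k * real (card (Q_k_upto n A k x))"
proof -
  note fb = floor_root_bounds[OF r z(1)]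
  define L where "L = large_primes n A y x"
  define P1 where "P1 = small_primes n A y"
  have fin: "finite L" "finite P1" by (simp_all add: L_def P1_def)
  have x1: "1 < x" using x fb(5) r(2) by linarith
  have lnx: "0 < ln x" using x1 by simp
  define US where "US = (\<lambda>i. {U. U \<subseteq> P1 \<and> card U = k - 1 - i})"
  define PP where "PP = (\<lambda>T U. {P \<in> Qprimes n A. y < real P \<and> P \<notin> T \<and> real P \<le> x / (real (\<Prod>T) * real (\<Prod>U))})"
  define I where "I = Sigma {..<k} (\<lambda>i. Sigma (rough_sets L (x / z) i) (\<lambda>T. Sigma (US i) (PP T)))"
  have finPP: "finite (PP T U)" for T U
    unfolding PP_def by (rule finite_subset[OF _ finite_nat_le_real[of "\<lambda>_. True" "x / (real (\<Prod>T) * real (\<Prod>U))"]]) auto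
  have finUS: "finite (US i)" for i unfolding US_def using fin by simp
  have finR: "finite (rough_sets L X i)" for X i by (rule finite_rough_sets[OF fin(1)])
  have finI: "finite I" unfolding I_def by (intro finite_SigmaI finR finUS finPP) auto
  have Tpr: "finite T" "T \<subseteq> Qprimes n A" "\<And>p. p \<in> T \<Longrightarrow> prime p \<and> y < real p" "card T = i" "real (\<Prod>T) \<le> x / z" "0 < \<Prod>T" if "T \<in> rough_sets L (x / z) i" for T i
  proof -
    show a: "finite T" using that fin by (auto simp: rough_sets_def intro: finite_subset)
    show b: "T \<subseteq> Qprimes n A" "\<And>p. p \<in> T \<Longrightarrow> prime p \<and> y < real p" "card T = i" "real (\<Prod>T) \<le> x / z"
      using that by (auto simp: rough_sets_def L_def large_primes_def Qprimes_def)
    show "0 < \<Prod>T" using a b by (intro prod_primes_pos) auto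
  qed
  have Upr: "finite U" "U \<subseteq> Qprimes n A" "\<And>p. p \<in> U \<Longrightarrow> prime p \<and> real p \<le> y" "card U = k - 1 - i" "real (\<Prod>U) \<le> r" "0 < \<Prod>U" if "U \<in> US i" for U i
  proof -
    show a: "finite U" using that fin by (auto simp: US_def intro: finite_subset)
    show b: "U \<subseteq> Qprimes n A" "\<And>p. p \<in> U \<Longrightarrow> prime p \<and> real p \<le> y" "card U = k - 1 - i"
      using that by (auto simp: US_def P1_def small_primes_def Qprimes_def)
    show "0 < \<Prod>U" using a b by (intro prod_primes_pos) auto
    have "real (\<Prod>U) = (\<Prod>p\<in>U. real p)" by simp
    also have "\<dots> \<le> (\<Prod>p\<in>U. y)" using b by (intro prod_mono) auto
    also have "\<dots> = y ^ (k - 1 - i)" using b by simp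
    also have "\<dots> \<le> y ^ k" using yk by (intro power_increasing) auto
    finally show "real (\<Prod>U) \<le> r" using yk by linarith
  qed
  define W where "W = (\<lambda>(i::nat, T::nat set, U::nat set, P::nat). (\<Prod>T * \<Prod>U * P, P))"
  have props: "prime_factors (\<Prod>T * \<Prod>U * P) = insert P (T \<union> U) \<and> P \<notin> T \<and> P \<notin> U \<and> T \<inter> U = {}
       \<and> \<Prod>T * \<Prod>U * P \<in> Q_k_upto n A k x"
    if i: "i < k" and T: "T \<in> rough_sets L (x / z) i" and U: "U \<in> US i" and P: "P \<in> PP T U" for i T U P
  proof -
    have PT: "P \<notin> T" using P by (simp add: PP_def)
    have PU: "P \<notin> U" using P Upr(3)[OF U, of P] by (auto simp: PP_def)
    have TU: "T \<inter> U = {}" using Tpr(3)[OF T] Upr(3)[OF U] by force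
    let ?V = "insert P (T \<union> U)"
    have fV: "finite ?V" using Tpr(1)[OF T] Upr(1)[OF U] by simp
    have VQ: "?V \<subseteq> Qprimes n A" using Tpr(2)[OF T] Upr(2)[OF U] P by (auto simp: PP_def)
    have e: "\<Prod>T * \<Prod>U * P = \<Prod>?V"
      using PT PU TU Tpr(1)[OF T] Upr(1)[OF U] by (simp add: prod.union_disjoint mult.commute)
    have pf: "prime_factors (\<Prod>?V) = ?V" by (rule prime_factors_prod_primes(1)[OF fV]) (use VQ in \<open>auto simp: Qprimes_def\<close>)
    have "card ?V = Suc (card T + card U)"
      using PT PU TU Tpr(1)[OF T] Upr(1)[OF U] by (simp add: card_Un_disjoint)
    then have cV: "card ?V = k" using Tpr(4)[OF T] Upr(4)[OF U] i by simp
    have "real P \<le> x / (real (\<Prod>T) * real (\<Prod>U))" using P by (simp add: PP_def)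
    then have "real P * (real (\<Prod>T) * real (\<Prod>U)) \<le> x"
      using Tpr(6)[OF T] Upr(6)[OF U] by (subst (asm) pos_le_divide_eq) (auto simp del: of_nat_prod)
    then have "real (\<Prod>T * \<Prod>U * P) \<le> x" by (simp add: mult_ac)
    moreover have "\<Prod>?V \<in> Q_set n A" by (rule prod_Qprimes_in_Q_set[OF fV VQ])
    ultimately have "\<Prod>?V \<in> Q_k_upto n A k x" unfolding e Q_k_upto_def Q_k_def using pf cV by simp
    then show ?thesis unfolding e using pf PT PU TU by simp
  qed
  have inj: "inj_on W I"
  proof (rule inj_onI)
    fix a b assume a: "a \<in> I" and b: "b \<in> I" and e: "W a = W b"
    obtain i T U P where a': "a = (i, T, U, P)" by (cases a)
    obtain i' T' U' P' where b': "b = (i', T', U', P')" by (cases b)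
    have A: "i < k" "T \<in> rough_sets L (x / z) i" "U \<in> US i" "P \<in> PP T U" using a a' by (auto simp: I_def)
    have B: "i' < k" "T' \<in> rough_sets L (x / z) i'" "U' \<in> US i'" "P' \<in> PP T' U'" using b b' by (auto simp: I_def)
    have eq: "\<Prod>T * \<Prod>U * P = \<Prod>T' * \<Prod>U' * P'" "P = P'" using e a' b' by (auto simp: W_def)
    note pA = props[OF A] and pB = props[OF B]
    have VV: "insert P (T \<union> U) = insert P (T' \<union> U')" using pA pB eq by metis
    have "T \<union> U = T' \<union> U'" using VV pA pB eq(2) by (metis Un_iff insert_ident)
    moreover have "T = {p \<in> T \<union> U. y < real p}" "T' = {p \<in> T' \<union> U'. y < real p}"
      using Tpr(3)[OF A(2)] Upr(3)[OF A(3)] Tpr(3)[OF B(2)] Upr(3)[OF B(3)] by force+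
    moreover have "U = {p \<in> T \<union> U. real p \<le> y}" "U' = {p \<in> T' \<union> U'. real p \<le> y}"
      using Tpr(3)[OF A(2)] Upr(3)[OF A(3)] Tpr(3)[OF B(2)] Upr(3)[OF B(3)] by force+
    ultimately have TU: "T = T'" "U = U'" by metis+
    then have "i = i'" using Tpr(4)[OF A(2)] Tpr(4)[OF B(2)] by simp
    then show "a = b" using a' b' TU eq(2) by simp
  qed
  have finQ: "finite (Q_k_upto n A k x)"
    unfolding Q_k_upto_def by (rule finite_subset[OF _ finite_nat_le_real[of "\<lambda>_. True" x]]) auto
  have "card I \<le> card (Sigma (Q_k_upto n A k x) prime_factors)"
  proof (rule card_inj_on_le[OF inj])
    show "W ` I \<subseteq> Sigma (Q_k_upto n A k x) prime_factors"
    proof (rule image_subsetI)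
      fix a assume a: "a \<in> I"
      obtain i T U P where a': "a = (i, T, U, P)" by (cases a)
      have A: "i < k" "T \<in> rough_sets L (x / z) i" "U \<in> US i" "P \<in> PP T U" using a a' by (auto simp: I_def)
      note p = props[OF A]
      then have "P \<in> prime_factors (\<Prod>T * \<Prod>U * P)" by (metis insertI1)
      then show "W a \<in> Sigma (Q_k_upto n A k x) prime_factors" using p a' by (simp add: W_def)
    qed
  qed (use finQ in auto)
  also have "\<dots> = (\<Sum>q\<in>Q_k_upto n A k x. card (prime_factors q))" using finQ by (intro card_SigmaI) auto
  also have "\<dots> = (\<Sum>q\<in>Q_k_upto n A k x. k)" by (intro sum.cong refl) (auto simp: Q_k_upto_def Q_k_def)
  finally have up: "real (card I) \<le> real k * real (card (Q_k_upto n A k x))"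
    by (metis of_nat_le_iff of_nat_mult mult.commute sum_constant of_nat_id)
  have "real (card I) = (\<Sum>i<k. \<Sum>T\<in>rough_sets L (x / z) i. \<Sum>U\<in>US i. real (card (PP T U)))"
    unfolding I_def by (simp add: card_SigmaI finR finUS finPP finite_SigmaI)
  also have "\<dots> \<ge> (\<Sum>i<k. \<Sum>T\<in>rough_sets L (x / z) i. \<Sum>U\<in>US i. \<alpha> * x / (2 * ln x) * (1 / real (\<Prod>T) * (1 / real (\<Prod>U))))"
  proof (intro sum_mono)
    fix i T U assume i: "i \<in> {..<k}" and T: "T \<in> rough_sets L (x / z) i" and U: "U \<in> US i"
    define t where "t = x / (real (\<Prod>T) * real (\<Prod>U))"
    have pos: "0 < real m \<and> 1 \<le> real m" if "0 < m" for m :: nat using that by linarith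
    have T0: "0 < real (\<Prod>T)" "1 \<le> real (\<Prod>T)" using pos[OF Tpr(6)[OF T]] by blast+
    have U0: "0 < real (\<Prod>U)" "1 \<le> real (\<Prod>U)" using pos[OF Upr(6)[OF U]] by blast+
    \<comment> \<open>From \<open>\<Prod>T \<le> x / z\<close>, \<open>\<Prod>U \<le> r\<close> and
      \<open>z = r ^ 16\<close>.\<close>
    have t15: "r ^ 15 \<le> t"
    proof -
      have "real (\<Prod>T) * z \<le> x" using Tpr(5)[OF T] z(1) by (simp add: pos_le_divide_eq del: of_nat_prod)
      then have "real (\<Prod>T) * (r ^ 15 * r) \<le> x" unfolding fb(4) by (simp flip: power_Suc2 del: of_nat_prod)
      moreover have "real (\<Prod>T) * (r ^ 15 * real (\<Prod>U)) \<le> real (\<Prod>T) * (r ^ 15 * r)"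
        using Upr(5)[OF U] T0 r(2) by (intro mult_left_mono) auto
      ultimately have "r ^ 15 * (real (\<Prod>T) * real (\<Prod>U)) \<le> x" by (simp add: mult_ac del: of_nat_prod)
      then show ?thesis unfolding t_def using T0 U0 by (subst pos_le_divide_eq) (auto simp del: of_nat_prod)
    qed
    have "1 \<le> r ^ 15" using r(2) by (intro one_le_power) auto
    have tx: "t \<le> x"
    proof -
      have "1 * 1 \<le> real (\<Prod>T) * real (\<Prod>U)" using T0 U0 by (intro mult_mono) auto
      then have "x * 1 \<le> x * (real (\<Prod>T) * real (\<Prod>U))" using x1 by (intro mult_left_mono) auto
      then show ?thesis unfolding t_def using T0 U0 by (subst pos_divide_le_eq) (auto simp del: of_nat_prod)
    qed
    have "\<alpha> * t / ln x - y - real (card T) \<le> real (card (PP T U))"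
      unfolding PP_def t_def[symmetric]
      by (rule card_primes_between_ge[OF th]) (use t15 x0 \<open>1 \<le> r ^ 15\<close> tx x1 yk Tpr(1)[OF T] in auto)
    \<comment> \<open>The discarded primes take up at most half of the count; this is the purpose of
      \<open>big\<close>.\<close>
    moreover have "y + real (card T) \<le> \<alpha> * t / (2 * ln x)"
    proof -
      have "(y + real (card T)) * (2 * ln x) \<le> (y + real k) * (2 * ln x)"
        using Tpr(4)[OF T] i lnx by (intro mult_right_mono) auto
      also have "\<dots> \<le> \<alpha> * t" using big t15 \<alpha> by (meson mult_left_mono less_imp_le order_trans)
      finally show ?thesis using lnx by (simp add: pos_le_divide_eq)
    qed
    ultimately have "\<alpha> * t / (2 * ln x) \<le> real (card (PP T U))" using lnx by (simp add: field_simps)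
    then show "\<alpha> * x / (2 * ln x) * (1 / real (\<Prod>T) * (1 / real (\<Prod>U))) \<le> real (card (PP T U))"
      unfolding t_def by (simp add: mult_ac del: of_nat_prod)
  qed
  also have "(\<Sum>i<k. \<Sum>T\<in>rough_sets L (x / z) i. \<Sum>U\<in>US i. \<alpha> * x / (2 * ln x) * (1 / real (\<Prod>T) * (1 / real (\<Prod>U)))) =
    \<alpha> * x / (2 * ln x) * (\<Sum>i<k. Fsum L (x / z) i * esym (\<lambda>p. 1 / real p) P1 (k - 1 - i))"
    unfolding Fsum_def esym_inverse_eq US_def sum_product by (simp only: sum_distrib_left)
  finally show ?thesis using up unfolding L_def P1_def by linarith
qed

section \<open>Exceptional moduli and comparison of the two bounds\<close>

lemma card_square_divisible_le:
  assumes "1 \<le> M" "0 \<le> x"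
  shows "real (card {q. 1 \<le> q \<and> real q \<le> x \<and> (\<exists>m>M. m ^ 2 dvd q)}) \<le> x / real M"
proof -
  define N where "N = nat \<lfloor>x\<rfloor>"
  define K where "K = max M N"
  let ?B = "{q. 1 \<le> q \<and> real q \<le> x \<and> (\<exists>m>M. m ^ 2 dvd q)}"
  have Nx: "real N \<le> x" using assms by (simp add: N_def)
  have sub: "?B \<subseteq> (\<Union>m\<in>{M<..K}. {q. 1 \<le> q \<and> q \<le> N \<and> m ^ 2 dvd q})"
  proof
    fix q assume "q \<in> ?B"
    then obtain m where q: "1 \<le> q" "real q \<le> x" "M < m" "m ^ 2 dvd q" by auto
    have "q \<le> N" unfolding N_def using q(2) by (rule le_nat_floor)
    have "m \<le> m ^ 2" by (simp add: power2_eq_square)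
    also have "m ^ 2 \<le> q" using q by (intro dvd_imp_le) auto
    finally have "m \<in> {M<..K}" using q \<open>q \<le> N\<close> by (auto simp: K_def)
    then show "q \<in> (\<Union>m\<in>{M<..K}. {q. 1 \<le> q \<and> q \<le> N \<and> m ^ 2 dvd q})" using q \<open>q \<le> N\<close> by auto
  qed
  have "card ?B \<le> card (\<Union>m\<in>{M<..K}. {q. 1 \<le> q \<and> q \<le> N \<and> m ^ 2 dvd q})"
    by (rule card_mono[OF _ sub]) (auto intro: finite_subset[of _ "{..N}"])
  also have "\<dots> \<le> (\<Sum>m\<in>{M<..K}. card {q. 1 \<le> q \<and> q \<le> N \<and> m ^ 2 dvd q})" by (rule card_UN_le) simp
  also have "\<dots> = (\<Sum>m\<in>{M<..K}. N div m ^ 2)" by (intro sum.cong refl card_multiples) auto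
  finally have "real (card ?B) \<le> real (\<Sum>m\<in>{M<..K}. N div m ^ 2)" by (simp only: of_nat_le_iff)
  also have "\<dots> = (\<Sum>m\<in>{M<..K}. real (N div m ^ 2))" by simp
  also have "\<dots> \<le> (\<Sum>m\<in>{M<..K}. x * (1 / (real m)\<^sup>2))"
  proof (rule sum_mono)
    fix m assume m: "m \<in> {M<..K}"
    have "real (N div m ^ 2) * real (m ^ 2) \<le> real N"
      by (metis div_times_less_eq_dividend of_nat_le_iff of_nat_mult)
    then have "real (N div m ^ 2) * (real m)\<^sup>2 \<le> x" using Nx by simp
    then show "real (N div m ^ 2) \<le> x * (1 / (real m)\<^sup>2)" using m by (simp add: pos_le_divide_eq)
  qed
  also have "\<dots> = x * (\<Sum>m\<in>{M<..K}. 1 / (real m)\<^sup>2)" by (simp only: sum_distrib_left)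
  also have "\<dots> \<le> x * (1 / real M)"
  proof (intro mult_left_mono assms)
    have "(\<Sum>m\<in>{M<..K}. 1 / (real m)\<^sup>2) \<le> 1 / real M - 1 / real K"
      by (rule sum_inverse_squares_tail) (use assms in \<open>auto simp: K_def\<close>)
    also have "\<dots> \<le> 1 / real M" by simp
    finally show "(\<Sum>m\<in>{M<..K}. 1 / (real m)\<^sup>2) \<le> 1 / real M" .
  qed
  finally show ?thesis by simp
qed

text \<open>Two kinds of moduli are estimated trivially: those with a prime power
  \<open>p ^ v > y\<close>, \<open>v \<ge> 2\<close>, which have a large square divisor, and the
  remaining ones without a prime factor of size \<open>z\<close>, which are at most
  \<open>z ^ k\<close>.\<close>

lemma sum_weyl_le:
  fixes x y z r :: real
  assumes k: "1 \<le> k" and yk: "1 \<le> y" "y ^ k \<le> r" and r: "r = z powr (1/16)" "4 \<le> r" and z: "0 < z" "y < z" and x: "0 \<le> x"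
    and M: "1 \<le> M" "real M ^ 3 \<le> y"
  shows "(\<Sum>q\<in>Q_k_upto n A k x. cmod (weyl n A q h)) \<le> z ^ k + x / real M +
    130 * real k / ln z * x * (\<Sum>i<k. Fsum (large_primes n A y x) (x / z) i * Esum n A h y (k - 1 - i))"
proof -
  let ?Q = "Q_k_upto n A k x"
  define G where "G = {q \<in> ?Q. (\<exists>P\<in>prime_factors q. z \<le> real P) \<and>
     (\<forall>p\<in>prime_factors q. 2 \<le> multiplicity p q \<longrightarrow> real (p ^ multiplicity p q) \<le> y)}"
  have finQ: "finite ?Q"
    unfolding Q_k_upto_def by (rule finite_subset[OF _ finite_nat_le_real[of "\<lambda>_. True" x]]) auto
  let ?S = "{q. 1 \<le> q \<and> real q \<le> x \<and> (\<exists>m>M. m ^ 2 dvd q)}"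
  have "?Q - G \<subseteq> {1..nat \<lfloor>z ^ k\<rfloor>} \<union> ?S"
  proof
    fix q assume q: "q \<in> ?Q - G"
    then have q1: "1 \<le> q" "real q \<le> x" "card (prime_factors q) = k"
      by (auto simp: Q_k_upto_def Q_k_def Q_set_def)
    show "q \<in> {1..nat \<lfloor>z ^ k\<rfloor>} \<union> ?S"
    proof (cases "\<exists>p\<in>prime_factors q. 2 \<le> multiplicity p q \<and> y < real (p ^ multiplicity p q)")
      case True
      then obtain p where p: "p \<in> prime_factors q" "2 \<le> multiplicity p q" "y < real (p ^ multiplicity p q)" by auto
      define v where "v = multiplicity p q"
      \<comment> \<open>The square of \<open>m\<close> divides \<open>q\<close>, and since
        \<open>v \<le> 3 * (v div 2)\<close> for \<open>v \<ge> 2\<close> its cube exceeds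
        \<open>y\<close>; this explains the condition \<open>M ^ 3 \<le> y\<close>.\<close>
      define m where "m = p ^ (v div 2)"
      have p1: "1 \<le> p" using p by (auto simp: Suc_le_eq prime_gt_0_nat in_prime_factors_imp_prime)
      have "p ^ (v div 2 * 2) dvd p ^ v" by (rule le_imp_power_dvd) simp
      then have "m ^ 2 dvd q" unfolding m_def v_def power_mult[symmetric] by (rule dvd_trans[OF _ multiplicity_dvd])
      moreover have "M < m"
      proof -
        have "p ^ v \<le> p ^ (v div 2 * 3)" using p(2) p1 unfolding v_def by (intro power_increasing) auto
        then have "p ^ v \<le> m ^ 3" by (simp add: m_def power_mult)
        then have "real (p ^ v) \<le> real (m ^ 3)" by (simp only: of_nat_le_iff)
        then have "real (M ^ 3) < real (m ^ 3)" using p(3) M(2) unfolding v_def by simp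
        then have "M ^ 3 < m ^ 3" by (simp only: of_nat_less_iff)
        then show ?thesis by (rule power_less_imp_less_base) simp
      qed
      ultimately show ?thesis using q1 by auto
    next
      case False
      then have ns: "\<forall>P\<in>prime_factors q. real P < z" using q by (auto simp: G_def not_less not_le)
      have "real q = (\<Prod>p\<in>prime_factors q. real p ^ multiplicity p q)"
        using q1 by (intro real_eq_prod_prime_powers) auto
      also have "\<dots> \<le> (\<Prod>p\<in>prime_factors q. z)"
      proof (intro prod_mono conjI)
        fix p assume p: "p \<in> prime_factors q"
        show "real p ^ multiplicity p q \<le> z"
        proof (cases "2 \<le> multiplicity p q")
          case True
          then show ?thesis using False p z by force
        next
          case False
          then have "multiplicity p q = 1" using p by (simp add: prime_factors_multiplicity)
          then show ?thesis using ns p by (simp add: less_imp_le)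
        qed
      qed auto
      also have "\<dots> = z ^ k" using q1 by simp
      finally have "q \<le> nat \<lfloor>z ^ k\<rfloor>" by (rule le_nat_floor)
      then show ?thesis using q1 by auto
    qed
  qed
  moreover have "finite ?S" by (rule finite_subset[OF _ finite_nat_le_real[of "\<lambda>_. True" x]]) auto
  ultimately have "card (?Q - G) \<le> card ({1..nat \<lfloor>z ^ k\<rfloor>} \<union> ?S)" by (intro card_mono) auto
  also have "\<dots> \<le> card {1..nat \<lfloor>z ^ k\<rfloor>} + card ?S" by (rule card_Un_le)
  finally have "real (card (?Q - G)) \<le> real (nat \<lfloor>z ^ k\<rfloor>) + real (card ?S)" by simp
  also have "\<dots> \<le> z ^ k + x / real M"
    using card_square_divisible_le[OF M(1) x] z by (intro add_mono) auto
  finally have bad: "real (card (?Q - G)) \<le> z ^ k + x / real M" .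
  have "(\<Sum>q\<in>?Q. cmod (weyl n A q h)) = (\<Sum>q\<in>?Q - G. cmod (weyl n A q h)) + (\<Sum>q\<in>G. cmod (weyl n A q h))"
    using finQ by (intro sum.subset_diff) (auto simp: G_def)
  also have "(\<Sum>q\<in>?Q - G. cmod (weyl n A q h)) \<le> (\<Sum>q\<in>?Q - G. 1)" by (intro sum_mono norm_weyl_le_1)
  also have "\<dots> \<le> z ^ k + x / real M" using bad by simp
  also have "(\<Sum>q\<in>G. cmod (weyl n A q h)) \<le> 130 * real k / ln z * x * (\<Sum>i<k. Fsum (large_primes n A y x) (x / z) i * Esum n A h y (k - 1 - i))"
    by (rule sum_weyl_good_le[OF k yk r z x]) (auto simp: G_def)
  finally show ?thesis by simp
qed

text \<open>
  The terms with \<open>2 * i \<le> k - 1\<close> are compared one by one; each remaining term is small compared with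
  the single term \<open>i = 0\<close> on the right, since \<open>S\<close> is much smaller than \<open>A'\<close>.
\<close>

lemma convolution_ratio:
  fixes F E e :: "nat \<Rightarrow> real"
  assumes F: "\<And>i. 0 \<le> F i" "F 0 = 1" "\<And>i. F i \<le> S ^ i / fact i"
    and E: "\<And>j. 0 \<le> E j" "\<And>j. E j \<le> B ^ j / fact j"
    and e: "\<And>j. j < k \<Longrightarrow> A' ^ j / fact j \<le> e j"
    and B: "0 \<le> B" "B \<le> exp (- c) * A'" "0 \<le> c" and A': "0 < A'" and S: "0 \<le> S" "S \<le> A' / 64" and k: "1 \<le> k"
  shows "(\<Sum>i<k. F i * E (k - 1 - i)) \<le>
    (exp (- c * (real k - 1) / 2) + real k / 4 ^ (k - 1)) * (\<Sum>i<k. F i * e (k - 1 - i))"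
proof -
  let ?L = "\<Sum>i<k. F i * e (k - 1 - i)"
  have epos: "0 \<le> e j" if "j < k" for j
    using order_trans[OF _ e[OF that]] A' by simp
  have e1: "e (k - 1) \<le> ?L"
  proof -
    have "F 0 * e (k - 1 - 0) \<le> ?L"
      using k F epos by (intro member_le_sum) auto
    then show ?thesis using F by simp
  qed
  have L0: "0 \<le> ?L" using e1 epos[of "k - 1"] k by linarith
  have term_le: "F i * E (k - 1 - i) \<le> exp (- c * (real k - 1) / 2) * (F i * e (k - 1 - i)) + ?L / 4 ^ (k - 1)"
    if i: "i < k" for i
  proof (cases "2 * i \<le> k - 1")
    case True
    define j where "j = k - 1 - i"
    have "E j \<le> B ^ j / fact j" by (rule E)
    also have "\<dots> \<le> (exp (- c) * A') ^ j / fact j" using B by (intro divide_right_mono power_mono) auto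
    also have "\<dots> = exp (- c * real j) * (A' ^ j / fact j)"
      by (simp add: power_mult_distrib exp_of_nat_mult[symmetric] mult.commute)
    also have "\<dots> \<le> exp (- c * real j) * e j" using e[of j] k by (intro mult_left_mono) (auto simp: j_def)
    also have "\<dots> \<le> exp (- c * (real k - 1) / 2) * e j"
    proof (intro mult_right_mono epos)
      have "real k - 1 \<le> 2 * real j" using True k by (simp add: j_def)
      then have "c * (real k - 1) \<le> c * (2 * real j)" using B by (intro mult_left_mono) auto
      then show "exp (- c * real j) \<le> exp (- c * (real k - 1) / 2)" by simp
    qed (use k in \<open>auto simp: j_def\<close>)
    finally have "F i * E j \<le> F i * (exp (- c * (real k - 1) / 2) * e j)" using F by (intro mult_left_mono)
    moreover have "0 \<le> ?L / 4 ^ (k - 1)" using L0 by simp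
    ultimately show ?thesis unfolding j_def by (simp add: mult_ac)
  next
    case False
    define j where "j = k - 1 - i"
    have ij: "i + j = k - 1" using i by (simp add: j_def)
    have BA: "B \<le> A'"
    proof -
      have "exp (- c) * A' \<le> 1 * A'" using B A' by (intro mult_right_mono) auto
      then show ?thesis using B by simp
    qed
    have "F i * E j \<le> (S ^ i / fact i) * (B ^ j / fact j)"
      using F E S by (intro mult_mono) auto
    also have "\<dots> \<le> ((A' / 64) ^ i / fact i) * (A' ^ j / fact j)"
      using S B A' BA by (intro mult_mono divide_right_mono power_mono) auto
    also have "\<dots> = (A' ^ (k - 1) / fact (k - 1)) * ((fact (k - 1) / (fact i * fact j)) / 64 ^ i)"
      using ij by (simp add: power_divide power_add[symmetric] mult_ac)
    \<comment> \<open>Here \<open>2 * i \<ge> k - 1\<close>, so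
      \<open>64 ^ i \<ge> 8 ^ (k - 1)\<close>; the binomial coefficient takes back only
      \<open>2 ^ (k - 1)\<close>, and \<open>4 ^ (k - 1)\<close> remains.\<close>
    also have "\<dots> \<le> (A' ^ (k - 1) / fact (k - 1)) * (2 ^ (k - 1) / 8 ^ (k - 1))"
    proof (intro mult_left_mono frac_le)
      have "i \<le> k - 1" "k - 1 - i = j" using ij by auto
      then have "fact (k - 1) / (fact i * fact j) = real ((k - 1) choose i)" by (simp add: binomial_fact)
      also have "\<dots> \<le> real (2 ^ (k - 1))" by (simp only: of_nat_le_iff binomial_le_pow2)
      finally show "fact (k - 1) / (fact i * fact j) \<le> (2::real) ^ (k - 1)" by simp
      have "(8::real) ^ (k - 1) \<le> 8 ^ (2 * i)" using False by (intro power_increasing) auto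
      also have "\<dots> = 64 ^ i" by (simp add: power_mult)
      finally show "(8::real) ^ (k - 1) \<le> 64 ^ i" .
    qed (use A' in auto)
    also have "\<dots> = (A' ^ (k - 1) / fact (k - 1)) / 4 ^ (k - 1)"
    proof -
      have "(8::real) ^ (k - 1) = 2 ^ (k - 1) * 4 ^ (k - 1)" by (simp flip: power_mult_distrib)
      then show ?thesis by simp
    qed
    also have "\<dots> \<le> ?L / 4 ^ (k - 1)"
      using e[of "k - 1"] e1 k by (intro divide_right_mono) auto
    finally have "F i * E j \<le> ?L / 4 ^ (k - 1)" .
    moreover have "0 \<le> exp (- c * (real k - 1) / 2) * (F i * e j)"
      using F epos[of j] i by (intro mult_nonneg_nonneg) (auto simp: j_def)
    ultimately show ?thesis unfolding j_def by linarith
  qed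
  have "(\<Sum>i<k. F i * E (k - 1 - i)) \<le> (\<Sum>i<k. exp (- c * (real k - 1) / 2) * (F i * e (k - 1 - i)) + ?L / 4 ^ (k - 1))"
    by (intro sum_mono term_le) auto
  also have "\<dots> = exp (- c * (real k - 1) / 2) * ?L + real k * (?L / 4 ^ (k - 1))"
    by (simp add: sum.distrib sum_distrib_left)
  finally show ?thesis by (simp add: distrib_right)
qed

section \<open>Choice of parameters\<close>

lemma ln2_bounds: "1 / 2 \<le> ln (2::real)" "ln (2::real) \<le> 1"
proof -
  have "ln (1 / 2 :: real) \<le> 1 / 2 - 1" by (rule ln_le_minus_one) simp
  then show "1 / 2 \<le> ln (2::real)" by (simp add: ln_div)
  show "ln (2::real) \<le> 1" using ln_le_minus_one[of "2::real"] by simp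
qed

lemma ln_floor_ge:
  fixes y :: real
  assumes "4 \<le> y"
  shows "ln y / 2 \<le> ln (real (nat \<lfloor>y\<rfloor>))"
proof -
  have "sqrt y \<le> y / 2" using assms by (intro real_le_lsqrt) (auto simp: power2_eq_square field_simps)
  also have "\<dots> \<le> real (nat \<lfloor>y\<rfloor>)" using assms by linarith
  finally have "ln (sqrt y) \<le> ln (real (nat \<lfloor>y\<rfloor>))" using assms by (subst ln_le_cancel_iff) auto
  then show ?thesis using assms by (simp add: ln_sqrt)
qed

text \<open>Passing to integer parts lowers \<open>ln ln\<close> by at most
  \<open>ln 2 \<le> 1\<close>, because \<open>sqrt y \<le> \<lfloor>y\<rfloor>\<close> for
  \<open>y \<ge> 4\<close>.\<close>

lemma sum_inverse_primes_between_le: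
  fixes x y :: real
  assumes "4 \<le> y" "y \<le> x"
  shows "(\<Sum>p | prime p \<and> y < real p \<and> real p \<le> x. 1 / real p) \<le> ln (ln x) - ln (ln y) + 2 + 6 / ln y"
proof -
  let ?m = "nat \<lfloor>y\<rfloor>" and ?N = "nat \<lfloor>x\<rfloor>"
  have m: "2 \<le> ?m" "?m \<le> ?N" using assms by (linarith, simp add: nat_mono floor_mono)
  have ly: "0 < ln y / 2" using assms by simp
  note lf = ln_floor_ge[OF assms(1)]
  have "(\<Sum>p | prime p \<and> y < real p \<and> real p \<le> x. 1 / real p) \<le> (\<Sum>p | prime p \<and> ?m < p \<and> p \<le> ?N. 1 / real p)"
  proof (rule sum_mono2)
    show "{p. prime p \<and> y < real p \<and> real p \<le> x} \<subseteq> {p. prime p \<and> ?m < p \<and> p \<le> ?N}"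
    proof safe
      fix p :: nat assume "y < real p" then show "?m < p" using assms by linarith
    qed (rule le_nat_floor)
  qed auto
  also have "\<dots> \<le> ln (ln ?N) - ln (ln ?m) + 1 + 3 / ln ?m" by (rule sum_inverse_primes_le[OF m])
  also have "ln (ln ?N) \<le> ln (ln x)"
  proof -
    have "1 < real ?N" using m by linarith
    moreover have "real ?N \<le> x" using assms by simp
    ultimately show ?thesis by (subst ln_le_cancel_iff) auto
  qed
  finally have main: "(\<Sum>p | prime p \<and> y < real p \<and> real p \<le> x. 1 / real p) \<le> ln (ln x) - ln (ln ?m) + 1 + 3 / ln ?m" by simp
  have a: "ln (ln y) - 1 \<le> ln (ln ?m)"
  proof -
    have "ln (ln y / 2) \<le> ln (ln ?m)" using lf ly by (subst ln_le_cancel_iff) auto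
    then show ?thesis using ly ln2_bounds by (simp add: ln_div)
  qed
  have "3 / ln ?m \<le> 3 / (ln y / 2)" using lf ly by (intro divide_left_mono mult_pos_pos) auto
  then have "3 / ln ?m \<le> 6 / ln y" by simp
  with main a show ?thesis by linarith
qed

lemma sum_inverse_primes_upto_le:
  fixes x :: real
  assumes "4 \<le> x"
  shows "(\<Sum>p | prime p \<and> real p \<le> x. 1 / real p) \<le> ln (ln x) + 9"
proof -
  let ?N = "nat \<lfloor>x\<rfloor>"
  have N: "2 \<le> ?N" using assms by linarith
  have "(\<Sum>p | prime p \<and> real p \<le> x. 1 / real p) \<le> (\<Sum>p\<in>insert 2 {p. prime p \<and> 2 < p \<and> p \<le> ?N}. 1 / real p)"
  proof (rule sum_mono2)
    show "{p. prime p \<and> real p \<le> x} \<subseteq> insert 2 {p. prime p \<and> 2 < p \<and> p \<le> ?N}"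
    proof safe
      fix p :: nat assume p: "prime p" "real p \<le> x" "p \<noteq> 2"
      then show "2 < p" using prime_ge_2_nat[OF p(1)] by simp
      show "p \<le> ?N" using p(2) by (rule le_nat_floor)
    qed
  qed auto
  also have "\<dots> = 1 / 2 + (\<Sum>p | prime p \<and> 2 < p \<and> p \<le> ?N. 1 / real p)" by (subst sum.insert) auto
  also have "(\<Sum>p | prime p \<and> 2 < p \<and> p \<le> ?N. 1 / real p) \<le> ln (ln ?N) - ln (ln (real 2)) + 1 + 3 / ln (real 2)"
    by (rule sum_inverse_primes_le) (use N in auto)
  also have "ln (ln ?N) \<le> ln (ln x)"
  proof -
    have "1 < real ?N" using N by linarith
    moreover have "real ?N \<le> x" using assms by simp
    ultimately show ?thesis by (subst ln_le_cancel_iff) auto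
  qed
  finally have main: "(\<Sum>p | prime p \<and> real p \<le> x. 1 / real p) \<le> 1 / 2 + (ln (ln x) - ln (ln (real 2)) + 1 + 3 / ln (real 2))" by simp
  have a: "- ln (ln (real 2)) \<le> 1"
  proof -
    have "ln (1 / 2) \<le> ln (ln (2::real))" using ln2_bounds by (subst ln_le_cancel_iff) auto
    then show ?thesis using ln2_bounds by (simp add: ln_div)
  qed
  have "3 / ln (real 2) \<le> 3 / (1/2)" using ln2_bounds by (intro divide_left_mono mult_pos_pos) auto
  then have "3 / ln (real 2) \<le> 6" by simp
  with main a show ?thesis by linarith
qed

text \<open>The range of \<open>k\<close> is used only through these inequalities. Its lower end has
  the shape \<open>K ln K\<close> with \<open>K = 20 (6 + n) / \<delta>\<close>, which makes
  \<open>ln k\<close> a small multiple of \<open>\<delta> k\<close>. Its upper end bounds the square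
  of \<open>ln k\<close> by \<open>\<alpha> \<delta> l / 140\<close>, and giving up one factor
  \<open>ln k \<ge> 6\<close> produces \<open>840 = 6 * 140\<close>.\<close>

lemma parameter_bounds:
  fixes \<alpha> \<delta> l :: real and k n :: nat
  assumes n: "1 \<le> n" and \<alpha>: "0 < \<alpha>" "\<alpha> \<le> 3" and \<delta>: "0 < \<delta>" "\<delta> \<le> 1" and l: "0 < l"
    and k1: "20 * (6 + real n) / \<delta> * ln (20 * (6 + real n) / \<delta>) \<le> real k"
    and k2: "real k \<le> exp (sqrt (\<alpha> * \<delta> * l / (20 * (6 + real n))))"
  shows "400 \<le> real k" "6 \<le> ln (real k)" "ln (real k) \<le> \<alpha> * \<delta> * l / 840" "ln (real k) \<le> \<delta> * real k / 70" "1680 \<le> l"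
    "10000 * real k ^ 4 * l \<le> exp l"
proof -
  define M where "M = 20 * (6 + real n)"
  define K where "K = M / \<delta>"
  have M: "140 \<le> M" using n by (simp add: M_def)
  have "M * 1 \<le> M * (1 / \<delta>)" using M \<delta> by (intro mult_left_mono) auto
  then have K140: "140 \<le> K" "M \<le> K" using M by (simp_all add: K_def)
  have e1: "exp (1::real) \<le> 3" by (rule exp_le)
  have ln140: "4 \<le> ln (140::real)"
  proof -
    have "exp (4::real) = exp 1 ^ 4" by (simp flip: exp_of_nat_mult)
    also have "\<dots> \<le> 3 ^ 4" using e1 by (intro power_mono) auto
    also have "\<dots> \<le> 140" by simp
    finally have "ln (exp (4::real)) \<le> ln 140" by (subst ln_le_cancel_iff) auto
    then show ?thesis by simp
  qed
  have lnK: "4 \<le> ln K"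
  proof -
    have "ln 140 \<le> ln K" using K140 by (subst ln_le_cancel_iff) auto
    then show ?thesis using ln140 by linarith
  qed
  have kK: "K * ln K \<le> real k" using k1 by (simp add: K_def M_def)
  have "140 * 4 \<le> K * ln K" using K140 lnK by (intro mult_mono) auto
  then have k560: "560 \<le> real k" using kK by linarith
  then show "400 \<le> real k" by simp
  show lk6: "6 \<le> ln (real k)"
  proof -
    \<comment> \<open>The bound 3 for \<open>exp 1\<close> would not do, as
      \<open>3 ^ 6 > 560\<close>.\<close>
    have e: "exp (1::real) \<le> 2.75"
    proof -
      have "exp (-1::real) \<ge> (\<Sum>i<6. (-1) ^ i /\<^sub>R fact i)"
      proof -
        have "\<exists>t. \<bar>t\<bar> \<le> \<bar>-1::real\<bar> \<and> exp (-1) = (\<Sum>m<6. (-1) ^ m / fact m) + exp t / fact 6 * (-1) ^ 6"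
          by (rule Maclaurin_exp_le)
        then obtain t where "exp (-1::real) = (\<Sum>m<6. (-1) ^ m / fact m) + exp t / fact 6 * (-1) ^ 6" by blast
        then show ?thesis by (simp add: divide_inverse mult.commute)
      qed
      then have "11 / 30 \<le> exp (-1::real)" by (simp add: eval_nat_numeral)
      then have "exp 1 * (11 / 30) \<le> exp 1 * exp (-1::real)" by (intro mult_left_mono) auto
      then show ?thesis by (simp flip: exp_add)
    qed
    have "exp (6::real) = exp 1 ^ 6" by (simp flip: exp_of_nat_mult)
    also have "\<dots> \<le> 2.75 ^ 6" using e by (intro power_mono) auto
    also have "\<dots> \<le> 560" by (simp add: eval_nat_numeral)
    also have "\<dots> \<le> real k" by (rule k560)
    finally have "ln (exp (6::real)) \<le> ln (real k)" using k560 by (subst ln_le_cancel_iff) auto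
    then show ?thesis by simp
  qed
  have "ln (real k) \<le> sqrt (\<alpha> * \<delta> * l / M)"
  proof -
    have "ln (real k) \<le> ln (exp (sqrt (\<alpha> * \<delta> * l / M)))"
      using k2 k560 unfolding M_def by (subst ln_le_cancel_iff) auto
    then show ?thesis by simp
  qed
  then have "ln (real k) ^ 2 \<le> sqrt (\<alpha> * \<delta> * l / M) ^ 2" using lk6 by (intro power_mono) auto
  also have "\<dots> = \<alpha> * \<delta> * l / M" using \<alpha> \<delta> l M by simp
  also have "\<dots> \<le> \<alpha> * \<delta> * l / 140" using \<alpha> \<delta> l M by (intro divide_left_mono) auto
  finally have sq: "ln (real k) ^ 2 \<le> \<alpha> * \<delta> * l / 140" .
  have "6 * ln (real k) \<le> ln (real k) * ln (real k)" using lk6 by (intro mult_right_mono) auto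
  then show lkl: "ln (real k) \<le> \<alpha> * \<delta> * l / 840" using sq by (simp add: power2_eq_square)
  show "ln (real k) \<le> \<delta> * real k / 70"
  proof -
    \<comment> \<open>The tangent of \<open>ln\<close> at \<open>k0 = K ln K\<close>, combined with
      \<open>ln k0 \<le> 2 ln K = k0 / (K / 2)\<close>, gives
      \<open>ln k \<le> 2 k / K\<close>.\<close>
    define k0 where "k0 = K * ln K"
    have k0: "0 < k0" "K / 2 \<le> k0" using K140 lnK by (auto simp: k0_def intro: order_trans[of _ "K * 1"])
    have "ln (real k / k0) \<le> real k / k0 - 1" using k0 k560 by (intro ln_le_minus_one) auto
    then have "ln (real k) \<le> ln k0 + (real k - k0) / k0" using k0 k560 by (simp add: ln_div diff_divide_distrib)
    also have "(real k - k0) / k0 \<le> (real k - k0) / (K / 2)"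
      using kK k0 K140 unfolding k0_def[symmetric] by (intro divide_left_mono) auto
    also have "ln k0 \<le> 2 * ln K"
    proof -
      have "ln (ln K) \<le> ln K" using ln_le_minus_one[of "ln K"] lnK by linarith
      then show ?thesis unfolding k0_def using K140 lnK by (simp add: ln_mult)
    qed
    also have "2 * ln K = k0 / (K / 2)" using K140 by (simp add: k0_def)
    finally have "ln (real k) \<le> real k / (K / 2)" by (simp add: diff_divide_distrib)
    also have "\<dots> \<le> real k / (70 / \<delta>)"
    proof (intro divide_left_mono)
      show "70 / \<delta> \<le> K / 2" unfolding K_def using M \<delta> by (simp add: field_simps)
    qed (use K140 \<delta> in auto)
    finally show ?thesis by (simp add: mult.commute)
  qed
  have ad: "\<alpha> * \<delta> \<le> 3" using mult_mono[of \<alpha> 3 \<delta> 1] \<alpha> \<delta> by simp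
  have "\<alpha> * \<delta> * l \<le> 3 * l" using ad l by (intro mult_right_mono) auto
  then show l1680: "1680 \<le> l" using lkl lk6 by linarith
  have lkl2: "ln (real k) \<le> l / 280" using lkl \<open>\<alpha> * \<delta> * l \<le> 3 * l\<close> by linarith
  have "real k ^ 4 = exp (4 * ln (real k))"
  proof -
    have "exp (4 * ln (real k)) = exp (ln (real k)) ^ 4" by (simp flip: exp_of_nat_mult)
    then show ?thesis using k560 by simp
  qed
  also have "\<dots> \<le> exp (l / 2)" using lkl2 l by simp
  finally have k4: "real k ^ 4 \<le> exp (l / 2)" .
  have "10000 * l \<le> (l / 6) ^ 3"
  proof -
    have "280 * 280 \<le> (l / 6) * (l / 6)" using l1680 by (intro mult_mono) auto
    then have "280 * 280 * (l / 6) \<le> (l / 6) * (l / 6) * (l / 6)" using l by (intro mult_right_mono) auto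
    moreover have "10000 * l \<le> 280 * 280 * (l / 6)" using l by simp
    ultimately show ?thesis unfolding power3_eq_cube by linarith
  qed
  also have "\<dots> \<le> exp (l / 6) ^ 3"
  proof (rule power_mono)
    show "l / 6 \<le> exp (l / 6)" using exp_ge_add_one_self[of "l / 6"] by linarith
  qed (use l in simp)
  also have "\<dots> = exp (l / 2)" by (simp flip: exp_of_nat_mult)
  finally have "10000 * l \<le> exp (l / 2)" .
  then have "10000 * l * real k ^ 4 \<le> exp (l / 2) * exp (l / 2)" using k4 l by (intro mult_mono) auto
  also have "\<dots> = exp l" by (simp flip: exp_add)
  finally show "10000 * real k ^ 4 * l \<le> exp l" by (simp add: mult_ac)
qed

section \<open>The saving at the small primes\<close>

text \<open>With \<open>w = 1 - lam / rho\<close>, the inequality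
  \<open>sqrt (1 - w) \<le> 1 - w / 2\<close> converts half of the assumed sum of
  \<open>w / p\<close> into a saving. Lost are the primes above \<open>y\<close>, which do not occur
  in \<open>u\<close>, and the primes dividing \<open>h\<close>, where \<open>gsq\<close> is
  trivial.\<close>

lemma sum_sqrt_gsq_le:
  fixes x y Lk :: real
  assumes n: "1 \<le> n" and xy: "y \<le> x"
    and dx: "d \<le> (\<Sum>p | prime p \<and> real p \<le> x \<and> p \<in> Q_set n A. (1 - real (lam n A p) / real (rho n A p)) * (1 / real p))"
    and S: "(\<Sum>p\<in>large_primes n A y x. 1 / real p) \<le> S"
    and Dv: "(\<Sum>p\<in>{p\<in>small_primes n A y. \<forall>i<n. int p dvd h i}. 1 / real p) \<le> Lk"
  shows "(\<Sum>p\<in>small_primes n A y. sqrt (gsq n A h p 1) / real p) \<le> (\<Sum>p\<in>small_primes n A y. 1 / real p) - (d - S - Lk) / 2"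
proof -
  define w where "w = (\<lambda>p. (1 - real (lam n A p) / real (rho n A p)))"
  let ?D = "{p\<in>small_primes n A y. \<forall>i<n. int p dvd h i}"
  let ?s = "small_primes n A y" and ?l = "large_primes n A y x"
  have w01: "0 \<le> w p" "w p \<le> 1" if "p \<in> Qprimes n A" for p
  proof -
    have "lam n A p \<le> rho n A p" using that n by (intro lam_le_rho) (auto simp: Qprimes_def prime_ge_2_nat)
    moreover have "0 < rho n A p" using that by (auto simp: Qprimes_def Q_set_def)
    ultimately show "0 \<le> w p" "w p \<le> 1" by (auto simp: w_def)
  qed
  have sQ: "p \<in> Qprimes n A" if "p \<in> ?s \<or> p \<in> ?l" for p using that by (auto simp: small_primes_def large_primes_def)
  have g: "sqrt (gsq n A h p 1) / real p \<le> 1 / real p - (w p / real p) / 2 + (if p \<in> ?D then (w p / real p) / 2 else 0)"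
    if p: "p \<in> ?s" for p
  proof (cases "p \<in> ?D")
    case True
    then show ?thesis by (simp add: gsq_def)
  next
    case False
    then have "gsq n A h p 1 = real (lam n A p) / real (rho n A p)" using p by (auto simp: gsq_def)
    then have e: "gsq n A h p 1 = 1 - w p" by (simp add: w_def)
    have "sqrt (1 - w p) \<le> 1 - w p / 2"
    proof (rule real_le_lsqrt)
      have "(1 - w p / 2)\<^sup>2 = 1 - w p + (w p)\<^sup>2 / 4" by (simp add: power2_eq_square algebra_simps)
      then show "1 - w p \<le> (1 - w p / 2)\<^sup>2" by simp
    qed (use w01[OF sQ, of p] p in auto)
    then have "sqrt (gsq n A h p 1) / real p \<le> (1 - w p / 2) / real p" unfolding e by (intro divide_right_mono) auto
    moreover have "(if p \<in> ?D then (w p / real p) / 2 else 0) = 0" using False by (rule if_not_P)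
    ultimately show ?thesis by (simp only: diff_divide_distrib) simp
  qed
  have "(\<Sum>p\<in>?s. sqrt (gsq n A h p 1) / real p) \<le> (\<Sum>p\<in>?s. 1 / real p - (w p / real p) / 2 + (if p \<in> ?D then (w p / real p) / 2 else 0))"
    by (intro sum_mono g)
  also have "\<dots> = (\<Sum>p\<in>?s. 1 / real p) - (\<Sum>p\<in>?s. w p / real p) / 2 + (\<Sum>p\<in>?s. if p \<in> ?D then (w p / real p) / 2 else 0)"
    by (simp add: sum.distrib sum_subtractf sum_divide_distrib)
  also have "(\<Sum>p\<in>?s. if p \<in> ?D then (w p / real p) / 2 else 0) = (\<Sum>p\<in>?D. (w p / real p) / 2)"
  proof -
    have "(\<Sum>p\<in>?s. if p \<in> ?D then (w p / real p) / 2 else 0) = (\<Sum>p\<in>{p\<in>?s. p \<in> ?D}. (w p / real p) / 2)"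
      by (rule sum.inter_filter[symmetric]) simp
    also have "{p\<in>?s. p \<in> ?D} = ?D" by auto
    finally show ?thesis .
  qed
  also have "\<dots> \<le> (\<Sum>p\<in>?D. (1 / real p) / 2)"
    using w01[OF sQ] by (intro sum_mono divide_right_mono) auto
  also have "\<dots> \<le> Lk / 2" unfolding sum_divide_distrib[symmetric] using Dv by linarith
  finally have 1: "(\<Sum>p\<in>?s. sqrt (gsq n A h p 1) / real p) \<le> (\<Sum>p\<in>?s. 1 / real p) - (\<Sum>p\<in>?s. w p / real p) / 2 + Lk / 2" by simp
  have "{p. prime p \<and> real p \<le> x \<and> p \<in> Q_set n A} = ?s \<union> ?l"
    using xy by (auto simp: small_primes_def large_primes_def Qprimes_def)
  then have "d \<le> (\<Sum>p\<in>?s \<union> ?l. w p / real p)" using dx by (simp add: w_def)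
  also have "\<dots> = (\<Sum>p\<in>?s. w p / real p) + (\<Sum>p\<in>?l. w p / real p)"
    by (intro sum.union_disjoint) (auto simp: small_primes_def large_primes_def)
  also have "(\<Sum>p\<in>?l. w p / real p) \<le> (\<Sum>p\<in>?l. 1 / real p)"
    using w01[OF sQ] by (intro sum_mono divide_right_mono) auto
  finally show ?thesis using 1 S by (simp add: field_simps)
qed

text \<open>The product of these primes divides a nonzero entry of \<open>h\<close>, and each of
  them adds at least \<open>ln 2 \<ge> 1/2\<close> to its logarithm.\<close>

lemma card_common_primes_le:
  assumes "finite T" "\<And>p. p \<in> T \<Longrightarrow> prime p \<and> (\<forall>i<n. int p dvd h i)" and i: "i < n" "h i \<noteq> 0" "\<bar>h i\<bar> \<le> int H"
  shows "real (card T) \<le> 2 * ln (real H)"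
proof -
  have "\<Prod>T dvd nat \<bar>h i\<bar>"
    by (rule prod_primes_dvd) (use assms in \<open>auto simp: int_dvd_int_iff[symmetric] simp del: int_dvd_int_iff\<close>)
  then have le: "\<Prod>T \<le> H" using i dvd_imp_le[of "\<Prod>T" "nat \<bar>h i\<bar>"] by auto
  have H: "0 < H" using i by auto
  have "real (card T) / 2 = (\<Sum>p\<in>T. 1 / 2)" by simp
  also have "\<dots> \<le> (\<Sum>p\<in>T. ln (real p))"
  proof (rule sum_mono)
    fix p assume "p \<in> T"
    then have "2 \<le> p" using assms(2) by (auto intro: prime_ge_2_nat)
    then have "ln 2 \<le> ln (real p)" by simp
    then show "1 / 2 \<le> ln (real p)" using ln2_bounds by linarith
  qed
  also have "\<dots> \<le> ln (real (\<Prod>T))"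
  proof (rule sum_ln_primes_le[OF assms(1)])
    show "\<Prod>T > 0" using assms by (intro prod_primes_pos) auto
  qed (use assms in auto)
  also have "\<dots> \<le> ln (real H)"
  proof -
    have "0 < \<Prod>T" using assms by (intro prod_primes_pos) auto
    then have "0 < real (\<Prod>T)" "real (\<Prod>T) \<le> real H" using le by linarith+
    then show ?thesis using H by (subst ln_le_cancel_iff) auto
  qed
  finally show ?thesis by simp
qed

section \<open>Averages of Weyl sums over the moduli\<close>

text \<open>The upper bound for the sum and the lower bound for the number of moduli contain the
  same sums over \<open>T\<close>, so their quotient is governed by \<open>B / A'\<close>, the ratio
  of the reciprocal sums over small primes with and without the local savings.\<close>

lemma sum_weyl_average_le:
  fixes \<alpha> \<delta> x x0 :: real and k n :: nat and h :: "nat \<Rightarrow> int"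
  assumes n: "1 \<le> n" and \<alpha>: "0 < \<alpha>" "\<alpha> \<le> 3" and \<delta>: "0 < \<delta>" "\<delta> \<le> 1"
    and x0: "2 \<le> x0" "x0 + 1 \<le> x" and l: "100 * (1 + ln (ln (real (nat \<lceil>x0\<rceil>) + 1))) \<le> ln (ln x)" "x0 \<le> ln (ln x)"
    and k1: "20 * (6 + real n) / \<delta> * ln (20 * (6 + real n) / \<delta>) \<le> real k"
    and k2: "real k \<le> exp (sqrt (\<alpha> * \<delta> * ln (ln x) / (20 * (6 + real n))))"
    and th: "\<And>t. x0 \<le> t \<Longrightarrow> \<alpha> * t \<le> (\<Sum>p | prime p \<and> real p \<le> t \<and> 1 \<le> rho n A p. ln (real p))"
    and dx: "\<delta> * ln (ln x) \<le> (\<Sum>p | prime p \<and> real p \<le> x \<and> p \<in> Q_set n A. (1 - real (lam n A p) / real (rho n A p)) * (1 / real p))"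
    and h: "i0 < n" "h i0 \<noteq> 0" "\<bar>h i0\<bar> \<le> int H" and H: "ln (real H) \<le> \<delta> * real k / 6 + 1"
  shows "(\<Sum>q\<in>Q_k_upto n A k x. cmod (weyl n A q h)) \<le> 3200 / \<alpha> * exp (- \<delta> * real k / 6) * real (card (Q_k_upto n A k x))"
proof -
  define l where "l = ln (ln x)"
  define lx where "lx = ln x"
  define lk where "lk = ln (real k)"
  define N where "N = real (card (Q_k_upto n A k x))"
  have l0: "0 < l" using x0 l(2) unfolding l_def by linarith
  note pb = parameter_bounds[OF n \<alpha> \<delta> l0 k1 k2[folded l_def]]
  have k400: "400 \<le> real k" by (rule pb(1))
  have k: "1 \<le> k" using k400 by linarith
  have lk6: "6 \<le> lk" and lkl: "lk \<le> \<alpha> * \<delta> * l / 840" and lkd: "lk \<le> \<delta> * real k / 70"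
    using pb unfolding lk_def by auto
  have x1: "1 < x" using x0 by linarith
  have lx0: "0 < lx" using x1 by (simp add: lx_def)
  have lxl: "exp l = lx" using lx0 by (simp add: l_def lx_def)
  have lxk: "10000 * real k ^ 4 * l \<le> lx" using pb(6) lxl by simp
  have ex: "exp lx = x" using x1 by (simp add: lx_def)
  have ad: "\<alpha> * \<delta> * l \<le> \<alpha> * l" "\<alpha> * \<delta> * l \<le> 3 * (\<delta> * l)"
  proof -
    have "\<alpha> * l * \<delta> \<le> \<alpha> * l * 1" using \<alpha> \<delta> l0 by (intro mult_left_mono) auto
    then show "\<alpha> * \<delta> * l \<le> \<alpha> * l" by (simp add: mult_ac)
    have "\<alpha> * (\<delta> * l) \<le> 3 * (\<delta> * l)" using \<alpha> \<delta> l0 by (intro mult_right_mono) auto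
    then show "\<alpha> * \<delta> * l \<le> 3 * (\<delta> * l)" by (simp add: mult_ac)
  qed
  define z where "z = exp (lx / (2 * real k))"
  define y where "y = exp (lx / (32 * (real k)\<^sup>2))"
  define r where "r = exp (lx / (32 * real k))"
  have kp: "0 < real k" "1 \<le> real k" using k400 by auto
  have rz: "r = z powr (1/16)" by (simp add: r_def z_def powr_def)
  have yk: "y ^ k = r"
  proof -
    have "y ^ k = exp (real k * (lx / (32 * (real k)\<^sup>2)))" unfolding y_def by (rule exp_of_nat_mult[symmetric])
    also have "real k * (lx / (32 * (real k)\<^sup>2)) = lx / (32 * real k)" using kp by (simp add: power2_eq_square)
    finally show ?thesis by (simp add: r_def)
  qed
  have zk: "z ^ k = exp (lx / 2)"
  proof -
    have "z ^ k = exp (real k * (lx / (2 * real k)))" unfolding z_def by (rule exp_of_nat_mult[symmetric])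
    also have "real k * (lx / (2 * real k)) = lx / 2" using kp by simp
    finally show ?thesis .
  qed
  have k23: "(real k)\<^sup>2 \<le> real k ^ 4" "real k ^ 2 * (real k)\<^sup>2 = real k ^ 4" "real k \<le> (real k)\<^sup>2" "1 \<le> (real k)\<^sup>2"
  proof -
    show "(real k)\<^sup>2 \<le> real k ^ 4" by (rule power_increasing) (use kp in auto)
    show "real k ^ 2 * (real k)\<^sup>2 = real k ^ 4" by (simp flip: power_add)
    show "real k \<le> (real k)\<^sup>2" using kp by (simp add: power2_eq_square)
    show "1 \<le> (real k)\<^sup>2" by (rule one_le_power) (rule kp(2))
  qed
  have lxk2: "100 * ((real k)\<^sup>2 * l) \<le> lx / (96 * (real k)\<^sup>2)"
  proof -
    have "100 * ((real k)\<^sup>2 * l) * (96 * (real k)\<^sup>2) = 9600 * (real k ^ 4 * l)" by (simp add: eval_nat_numeral)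
    also have "\<dots> \<le> 10000 * (real k ^ 4 * l)" using l0 by (intro mult_right_mono) auto
    also have "\<dots> \<le> lx" using lxk by (simp add: mult_ac)
    finally show ?thesis using kp by (simp add: pos_le_divide_eq)
  qed
  have l_le: "l \<le> (real k)\<^sup>2 * l" using k23(4) l0 by simp
  have lny: "ln y = lx / (32 * (real k)\<^sup>2)" by (simp add: y_def)
  have lny_big: "300 * ((real k)\<^sup>2 * l) \<le> ln y"
  proof -
    have "lx / (32 * (real k)\<^sup>2) = 3 * (lx / (96 * (real k)\<^sup>2))" by simp
    then show ?thesis using lxk2 lny by linarith
  qed
  have lny_l: "300 * l \<le> ln y" using lny_big l_le by linarith
  have y_le_r: "y \<le> r" unfolding y_def r_def
    using kp lx0 k23(3) by (subst exp_le_cancel_iff, intro divide_left_mono) auto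
  have lnr: "ln r = lx / (32 * real k)" by (simp add: r_def)
  have lnr_l: "300 * l \<le> ln r"
  proof -
    have "ln y \<le> ln r" using y_le_r by (subst ln_le_cancel_iff) (auto simp: y_def r_def)
    then show ?thesis using lny_l by linarith
  qed
  have l1680: "1680 \<le> l" by (rule pb(5))
  have y4: "4 \<le> y"
  proof -
    have "4 \<le> 1 + ln y" using lny_l l1680 by linarith
    also have "\<dots> \<le> exp (ln y)" by (rule exp_ge_add_one_self)
    finally show ?thesis by (simp add: y_def)
  qed
  have r4: "4 \<le> r" using y4 y_le_r by linarith
  have z0: "0 < z" by (simp add: z_def)
  have r_lt_z: "r < z" unfolding r_def z_def using kp lx0 by (simp add: divide_strict_left_mono)
  have yz: "y < z" using y_le_r r_lt_z by linarith
  have zx: "z \<le> x" unfolding ex[symmetric] z_def using kp lx0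
    by (simp add: pos_divide_le_eq)
  have yx: "y \<le> x" using yz zx by linarith
  have lnz: "ln z = lx / (2 * real k)" by (simp add: z_def)
  define L where "L = large_primes n A y x"
  define P1 where "P1 = small_primes n A y"
  define S where "S = (\<Sum>p\<in>L. 1 / real p)"
  define A1 where "A1 = (\<Sum>p\<in>P1. 1 / real p)"
  have S0: "0 \<le> S" unfolding S_def by (intro sum_nonneg) auto
  \<comment> \<open>\<open>ln ln x - ln ln y\<close> is \<open>2 ln k + ln 32\<close>; the constants
    are absorbed by \<open>ln k \<ge> 6\<close>.\<close>
  have S4: "S \<le> 4 * lk"
  proof -
    have "S \<le> (\<Sum>p | prime p \<and> y < real p \<and> real p \<le> x. 1 / real p)"
      unfolding S_def L_def
      by (intro sum_mono2 finite_subset[OF _ finite_nat_le_real[of "\<lambda>_. True" x]])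
         (auto simp: large_primes_def Qprimes_def)
    also have "\<dots> \<le> ln (ln x) - ln (ln y) + 2 + 6 / ln y"
      by (rule sum_inverse_primes_between_le[OF y4 yx])
    also have "ln (ln y) = ln (ln x) - (ln 32 + 2 * lk)"
      unfolding lny lx_def[symmetric] lk_def using lx0 kp by (simp add: ln_div ln_mult ln_realpow)
    also have "ln (32::real) \<le> 5"
    proof -
      have "ln (32::real) = ln (2 ^ 5)" by simp
      also have "\<dots> = 5 * ln 2" by (subst ln_realpow) auto
      finally show ?thesis using ln2_bounds by linarith
    qed
    also have "6 / ln y \<le> 1" using lny_l l1680 by (simp add: divide_le_eq_1)
    finally show ?thesis using lk6 by (simp add: algebra_simps)
  qed
  have setU: "{p. p \<in> Qprimes n A \<and> p \<le> nat \<lfloor>x\<rfloor>} = P1 \<union> L"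
  proof -
    have "p \<le> nat \<lfloor>x\<rfloor> \<longleftrightarrow> real p \<le> x" for p
      using x1 by (simp add: le_nat_iff le_floor_iff)
    then have "{p. p \<in> Qprimes n A \<and> p \<le> nat \<lfloor>x\<rfloor>} = {p \<in> Qprimes n A. real p \<le> x}" by blast
    also have "\<dots> = P1 \<union> L" unfolding P1_def L_def small_primes_def large_primes_def using yx by force
    finally show ?thesis .
  qed
  have A1S: "A1 + S = (\<Sum>p\<in>P1 \<union> L. 1 / real p)"
    unfolding A1_def S_def by (rule sum.union_disjoint[symmetric]) (auto simp: P1_def L_def small_primes_def large_primes_def)
  have A1_upper: "A1 \<le> l + 9"
  proof -
    have "A1 \<le> (\<Sum>p | prime p \<and> real p \<le> x. 1 / real p)"
      unfolding A1_def P1_def using yx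
      by (intro sum_mono2 finite_subset[OF _ finite_nat_le_real[of "\<lambda>_. True" x]])
         (auto simp: small_primes_def Qprimes_def)
    also have "\<dots> \<le> l + 9" unfolding l_def using y4 yx by (intro sum_inverse_primes_upto_le) auto
    finally show ?thesis .
  qed
  \<comment> \<open>The density hypothesis is silent below \<open>x0\<close>; the resulting loss
    \<open>ln (ln (m0 + 1))\<close> is at most \<open>l / 100\<close> because \<open>x\<close> is
    large in terms of \<open>x0\<close>.\<close>
  have A1_lower: "(99 / 100) * (\<alpha> * l) - \<alpha> \<le> A1 + S"
  proof -
    define m0 where "m0 = nat \<lceil>x0\<rceil>"
    have m0: "2 \<le> m0" "x0 \<le> real m0" "real m0 \<le> x0 + 1" using x0 unfolding m0_def by linarith+
    have m0N: "m0 \<le> nat \<lfloor>x\<rfloor>" by (rule le_nat_floor) (use m0 x0 in linarith)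
    have "\<alpha> * (ln (ln (nat \<lfloor>x\<rfloor>)) - ln (ln (real m0 + 1))) \<le> (\<Sum>p | p \<in> Qprimes n A \<and> p \<le> nat \<lfloor>x\<rfloor>. 1 / real p)"
    proof (rule sum_inverse_primes_ge[OF _ \<alpha>(1) m0(1) m0N])
      fix m assume "m0 \<le> m"
      then have "x0 \<le> real m" using m0 by linarith
      then have "\<alpha> * real m \<le> (\<Sum>p | prime p \<and> real p \<le> real m \<and> 1 \<le> rho n A p. ln (real p))" by (rule th)
      also have "{p. prime p \<and> real p \<le> real m \<and> 1 \<le> rho n A p} = {p. p \<in> Qprimes n A \<and> p \<le> m}"
        by (auto simp: Qprimes_def Q_set_def prime_gt_0_nat Suc_le_eq)
      finally show "\<alpha> * real m \<le> (\<Sum>p | p \<in> Qprimes n A \<and> p \<le> m. ln (real p))" .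
    qed (simp add: Qprimes_def)
    then have "\<alpha> * (ln (ln (nat \<lfloor>x\<rfloor>)) - ln (ln (real m0 + 1))) \<le> A1 + S" using setU A1S by simp
    moreover have "\<alpha> * (l * (99 / 100) - 1) \<le> \<alpha> * (ln (ln (nat \<lfloor>x\<rfloor>)) - ln (ln (real m0 + 1)))"
    proof (intro mult_left_mono)
      have "ln (lx / 2) \<le> ln (ln (nat \<lfloor>x\<rfloor>))"
        using ln_floor_ge[of x] y4 yx lx0 unfolding lx_def by (subst ln_le_cancel_iff) auto
      then have "l - 1 \<le> ln (ln (nat \<lfloor>x\<rfloor>))" using lx0 ln2_bounds by (simp add: ln_div l_def lx_def)
      moreover have "ln (ln (real m0 + 1)) \<le> l / 100" using l(1)[folded m0_def l_def] by argo
      ultimately show "l * (99 / 100) - 1 \<le> ln (ln (nat \<lfloor>x\<rfloor>)) - ln (ln (real m0 + 1))" by simp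
    qed (use \<alpha> in auto)
    ultimately show ?thesis by (simp add: algebra_simps)
  qed
  \<comment> \<open>The subtracted \<open>lk\<close> is the \<open>c\<close> of
    \<open>esym_ge\<close>: fewer than \<open>k\<close> primes have reciprocal sum at most
    \<open>ln k\<close>.\<close>
  define A' where "A' = A1 - lk"
  have al: "5040 \<le> \<alpha> * l" using lk6 lkl ad(1) by linarith
  have A'_lower: "(97 / 100) * (\<alpha> * l) \<le> A'"
    using A1_lower S4 lkl ad(1) al \<alpha> unfolding A'_def by linarith
  have A'1: "1 \<le> A'" using A'_lower al by linarith
  have A'_upper: "A' \<le> (101 / 100) * l" using A1_upper lk6 l1680 unfolding A'_def by linarith
  have S64: "S \<le> A' / 64" using S4 lkl ad(1) A'_lower al by linarith
  define B where "B = (\<Sum>p\<in>P1. sqrt (gsq n A h p 1) / real p) + 1"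
  have B0: "0 \<le> B" unfolding B_def by (intro add_nonneg_nonneg sum_nonneg) (auto simp: gsq_nonneg)
  \<comment> \<open>Half of \<open>\<delta> * l\<close> is saved, of which 48/100 survives the error
    terms; relative to \<open>A' \<le> 101/100 * l\<close> this leaves 46/100.\<close>
  have B_le: "B \<le> exp (- ((46 / 100) * \<delta>)) * A'"
  proof -
    let ?D = "{p\<in>small_primes n A y. \<forall>i<n. int p dvd h i}"
    \<comment> \<open>The bound on \<open>H\<close> allows fewer than \<open>k\<close> common prime
      divisors, so again their reciprocals add up to at most \<open>ln k\<close>.\<close>
    have D: "(\<Sum>p\<in>?D. 1 / real p) \<le> lk"
    proof -
      have fD: "finite ?D" by simp
      have "real (card ?D) \<le> 2 * ln (real H)"
        by (rule card_common_primes_le[where n = n and h = h and i = i0]) (use fD h in \<open>auto simp: small_primes_def Qprimes_def\<close>)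
      also have "\<dots> \<le> real k - 1"
      proof -
        have "\<delta> * real k \<le> 1 * real k" using \<delta> by (intro mult_right_mono) auto
        then show ?thesis using H k400 by linarith
      qed
      finally have c: "real (card ?D) + 1 \<le> real k" by simp
      have "(\<Sum>p\<in>?D. 1 / real p) \<le> ln (real (card ?D) + 1)"
        by (rule reciprocal_sum_prod_le_card(1)[OF fD]) (auto simp: small_primes_def Qprimes_def prime_ge_2_nat)
      also have "\<dots> \<le> lk" unfolding lk_def using c by (subst ln_le_cancel_iff) auto
      finally show ?thesis .
    qed
    have "B \<le> A1 - (\<delta> * l - S - lk) / 2 + 1"
      unfolding B_def A1_def P1_def
      using sum_sqrt_gsq_le[OF n yx dx[folded l_def] _ D, of S] by (simp add: S_def L_def)
    also have "\<dots> \<le> A' - (48 / 100) * (\<delta> * l)"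
    proof -
      have "lk \<le> (\<delta> * l) / 280" using lkl ad(2) by linarith
      then show ?thesis using S4 lk6 unfolding A'_def by argo
    qed
    also have "\<dots> \<le> A' - (46 / 100) * \<delta> * A'"
    proof -
      have "(46 / 100) * \<delta> * A' \<le> (46 / 100) * \<delta> * ((101 / 100) * l)" using A'_upper \<delta> by (intro mult_left_mono) auto
      also have "\<dots> = (4646 / 10000) * (\<delta> * l)" by simp
      also have "\<dots> \<le> (48 / 100) * (\<delta> * l)" using \<delta> l0 by (intro mult_right_mono) auto
      finally show ?thesis by linarith
    qed
    also have "\<dots> = (1 + - ((46 / 100) * \<delta>)) * A'" by (simp add: algebra_simps)
    also have "\<dots> \<le> exp (- ((46 / 100) * \<delta>)) * A'"
      using A'1 by (intro mult_right_mono exp_ge_add_one_self) auto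
    finally show ?thesis .
  qed
  define e where "e = esym (\<lambda>p. 1 / real p) P1"
  have finP: "finite P1" "finite L" by (simp_all add: P1_def L_def)
  have P12: "2 \<le> p" if "p \<in> P1" for p using that by (auto simp: P1_def small_primes_def Qprimes_def prime_ge_2_nat)
  have e_ge: "A' ^ j / fact j \<le> e j" if "j < k" for j
    unfolding e_def A'_def A1_def
  proof (rule esym_ge[where k = k])
    fix T assume T: "T \<subseteq> P1" "card T < k"
    have fT: "finite T" using T finP by (auto intro: finite_subset)
    have "(\<Sum>p\<in>T. 1 / real p) \<le> ln (real (card T) + 1)"
      by (rule reciprocal_sum_prod_le_card(1)[OF fT]) (use T P12 in auto)
    also have "\<dots> \<le> lk" unfolding lk_def using T(2) by (subst ln_le_cancel_iff) auto
    finally show "(\<Sum>p\<in>T. 1 / real p) \<le> lk" .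
  qed (use finP A'1 that in \<open>auto simp: A'_def A1_def\<close>)
  define F where "F = Fsum L (x / z)"
  define E where "E = Esum n A h y"
  define \<Lambda> where "\<Lambda> = (\<Sum>i<k. F i * e (k - 1 - i))"
  define fac where "fac = exp (- ((46 / 100) * \<delta>) * (real k - 1) / 2) + real k / 4 ^ (k - 1)"
  have FE: "(\<Sum>i<k. F i * E (k - 1 - i)) \<le> fac * \<Lambda>"
    unfolding fac_def \<Lambda>_def
  proof (rule convolution_ratio[where S = S and B = B and A' = A'])
    show "F 0 = 1" unfolding F_def using finP zx z0 by (intro Fsum_0) auto
    show "F i \<le> S ^ i / fact i" for i unfolding F_def S_def by (rule Fsum_le[OF finP(2)])
    show "E j \<le> B ^ j / fact j" for j unfolding E_def by (rule Esum_le) (simp add: B_def P1_def)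
  qed (use e_ge B0 B_le \<delta> A'1 S0 S64 k in \<open>auto simp: F_def E_def Fsum_nonneg Esum_nonneg\<close>)
  have lower: "\<alpha> * x / (2 * lx) * \<Lambda> \<le> real k * N"
    unfolding \<Lambda>_def F_def e_def L_def P1_def N_def lx_def
  proof (rule card_Q_k_ge[where r = r])
    show "x0 \<le> r ^ 15"
    proof -
      have "x0 \<le> 1 + ln r" using l(2) lnr_l l0 unfolding l_def by linarith
      also have "\<dots> \<le> exp (ln r)" by (rule exp_ge_add_one_self)
      also have "\<dots> = r ^ 1" by (simp add: r_def)
      also have "\<dots> \<le> r ^ 15" using r4 by (intro power_increasing) auto
      finally show ?thesis .
    qed
    show "(y + real k) * (2 * ln x) \<le> \<alpha> * r ^ 15"
    proof -
      have lx_r: "lx \<le> r"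
      proof -
        have "exp l \<le> exp (ln r)" using lnr_l l0 by (subst exp_le_cancel_iff) linarith
        then show ?thesis using lxl by (simp add: r_def)
      qed
      have "real k = exp lk" using kp by (simp add: lk_def)
      also have "\<dots> \<le> exp (ln r)"
      proof (subst exp_le_cancel_iff)
        have "\<alpha> * \<delta> * l \<le> 3 * l" using ad(2) mult_right_mono[of \<delta> 1 l] \<delta> l0 by linarith
        then show "lk \<le> ln r" using lkl lnr_l l0 by linarith
      qed
      finally have kr: "real k \<le> r" by (simp add: r_def)
      have lr: "l \<le> r" using lxl lx_r exp_ge_add_one_self[of l] by linarith
      have "(y + real k) * (2 * lx) \<le> (r + r) * (2 * r)" using y_le_r kr lx_r lx0 kp r4 by (intro mult_mono) auto
      also have "\<dots> = 4 * r ^ 2" by (simp add: power2_eq_square)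
      also have "\<dots> \<le> 5040 * r ^ 2" using r4 by (intro mult_right_mono) auto
      also have "\<dots> \<le> (\<alpha> * l) * r ^ 2" using al by (intro mult_right_mono) auto
      also have "\<dots> \<le> (\<alpha> * r) * r ^ 2" using lr \<alpha> by (intro mult_right_mono mult_left_mono) auto
      also have "\<dots> = \<alpha> * r ^ 3" by (simp add: eval_nat_numeral)
      also have "\<dots> \<le> \<alpha> * r ^ 15" using r4 \<alpha> by (intro mult_left_mono power_increasing) auto
      finally show ?thesis by (simp add: lx_def)
    qed
  qed (use k y4 yk rz r4 z0 yz zx th \<alpha> in auto)
  have \<Lambda>1: "1 / fact (k - 1) \<le> \<Lambda>"
  proof -
    have epos: "0 \<le> e j" for j unfolding e_def by (rule esym_nonneg) auto
    have "1 / fact (k - 1) \<le> A' ^ (k - 1) / fact (k - 1)"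
      using A'1 by (intro divide_right_mono one_le_power) auto
    also have "\<dots> \<le> e (k - 1)" using k by (intro e_ge) auto
    also have "\<dots> = F 0 * e (k - 1 - 0)"
      using finP zx z0 by (simp add: F_def Fsum_0)
    also have "\<dots> \<le> \<Lambda>" unfolding \<Lambda>_def
      using k epos by (intro member_le_sum) (auto simp: F_def intro!: mult_nonneg_nonneg Fsum_nonneg)
    finally show ?thesis .
  qed
  have \<Lambda>0: "0 \<le> \<Lambda>"
  proof -
    have "0 \<le> 1 / (fact (k - 1) :: real)" by simp
    then show ?thesis using \<Lambda>1 by linarith
  qed
  have x\<Lambda>: "x * \<Lambda> \<le> 2 * lx * real k * N / \<alpha>"
    using lower \<alpha> lx0 by (simp add: field_simps)
  have dk: "0 \<le> \<delta> * real k" "\<delta> * real k \<le> real k" using \<delta> kp by (auto simp: mult_left_le_one_le)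
  \<comment> \<open>The exponent drops from 46/100 to 23/100 because in the leading terms of
    \<open>convolution_ratio\<close> only half of the \<open>k - 1\<close> primes are sure to lie
    below \<open>y\<close>.\<close>
  have fac6: "fac \<le> 6 * exp (- (23 / 100) * (\<delta> * real k))"
  proof -
    have "exp (- ((46 / 100) * \<delta>) * (real k - 1) / 2) = exp ((23 / 100) * \<delta>) * exp (- (23 / 100) * (\<delta> * real k))"
    proof -
      have "- ((46 / 100) * \<delta>) * (real k - 1) / 2 = (23 / 100) * \<delta> + - (23 / 100) * (\<delta> * real k)"
        by (simp add: field_simps)
      then show ?thesis by (simp only: exp_add)
    qed
    also have "\<dots> \<le> 2 * exp (- (23 / 100) * (\<delta> * real k))"
    proof (rule mult_right_mono)
      have "exp ((23 / 100) * \<delta>) \<le> exp (ln 2)" using \<delta> ln2_bounds by (subst exp_le_cancel_iff) linarith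
      then show "exp ((23 / 100) * \<delta>) \<le> 2" by simp
    qed simp
    finally have 1: "exp (- ((46 / 100) * \<delta>) * (real k - 1) / 2) \<le> 2 * exp (- (23 / 100) * (\<delta> * real k))" .
    have "real k / 4 ^ (k - 1) = 4 * (real k / 4 ^ k)"
    proof -
      have "(4::real) ^ k = 4 * 4 ^ (k - 1)" using k by (simp flip: power_Suc)
      then show ?thesis by simp
    qed
    also have "real k / 4 ^ k \<le> exp lk / exp (real k)"
    proof (intro frac_le)
      have "exp (real k) \<le> exp (real k * ln 4)"
      proof (subst exp_le_cancel_iff)
        have "ln (4::real) = 2 * ln 2" using ln_realpow[of "2::real" 2] by simp
        then have "1 \<le> ln (4::real)" using ln2_bounds by linarith
        then show "real k \<le> real k * ln 4" using kp by simp
      qed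
      also have "\<dots> = 4 ^ k" by (simp add: exp_of_nat_mult)
      finally show "exp (real k) \<le> 4 ^ k" .
    qed (use kp in \<open>auto simp: lk_def\<close>)
    also have "exp lk / exp (real k) = exp (lk - real k)" by (rule exp_diff[symmetric])
    also have "\<dots> \<le> exp (- (23 / 100) * (\<delta> * real k))" using lkd dk by (subst exp_le_cancel_iff) linarith
    finally show ?thesis using 1 unfolding fac_def by linarith
  qed
  \<comment> \<open>The factor \<open>k ^ 3\<close> costs at most
    \<open>exp (3/70 * \<delta> * k)\<close>, and \<open>23/100 - 3/70 > 1/6\<close>.\<close>
  have main: "130 * real k / ln z * x * (\<Sum>i<k. F i * E (k - 1 - i)) \<le> 3120 / \<alpha> * exp (- \<delta> * real k / 6) * N"
  proof -
    have "130 * real k / ln z * x * (\<Sum>i<k. F i * E (k - 1 - i)) \<le> 130 * real k / ln z * x * (fac * \<Lambda>)"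
      using FE kp lnz lx0 x1 by (intro mult_left_mono) auto
    also have "\<dots> = 260 * (real k)\<^sup>2 / lx * fac * (x * \<Lambda>)"
      using kp lx0 by (simp add: lnz power2_eq_square field_simps)
    also have "\<dots> \<le> 260 * (real k)\<^sup>2 / lx * fac * (2 * lx * real k * N / \<alpha>)"
      using x\<Lambda> lx0 kp by (intro mult_left_mono mult_nonneg_nonneg) (auto simp: fac_def)
    also have "\<dots> = 520 * real k ^ 3 * N / \<alpha> * fac" using lx0 by (simp add: eval_nat_numeral field_simps)
    also have "\<dots> \<le> 520 * real k ^ 3 * N / \<alpha> * (6 * exp (- (23 / 100) * (\<delta> * real k)))"
      using fac6 \<alpha> kp by (intro mult_left_mono) (auto simp: N_def)
    also have "\<dots> = 3120 / \<alpha> * (real k ^ 3 * exp (- (23 / 100) * (\<delta> * real k))) * N" by simp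
    also have "\<dots> \<le> 3120 / \<alpha> * exp (- \<delta> * real k / 6) * N"
    proof (intro mult_right_mono mult_left_mono)
      have "real k ^ 3 = exp (3 * lk)"
      proof -
        have "exp (3 * lk) = exp lk ^ 3" by (simp flip: exp_of_nat_mult)
        then show ?thesis using kp by (simp add: lk_def)
      qed
      then have "real k ^ 3 * exp (- (23 / 100) * (\<delta> * real k)) = exp (3 * lk - (23 / 100) * (\<delta> * real k))" by (simp flip: exp_add)
      also have "\<dots> \<le> exp (- \<delta> * real k / 6)" proof (subst exp_le_cancel_iff)
        have "3 * lk - (23 / 100) * (\<delta> * real k) \<le> - (\<delta> * real k) / 6" using lkd dk by argo
        then show "3 * lk - (23 / 100) * (\<delta> * real k) \<le> - \<delta> * real k / 6" by (simp only: mult_minus_left)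
      qed
      finally show "real k ^ 3 * exp (- (23 / 100) * (\<delta> * real k)) \<le> exp (- \<delta> * real k / 6)" .
    qed (use \<alpha> in \<open>auto simp: N_def\<close>)
    finally show ?thesis .
  qed
  \<comment> \<open>The largest \<open>M\<close> with \<open>M ^ 3 \<le> y\<close>, as
    \<open>sum_weyl_le\<close> permits.\<close>
  define M where "M = nat \<lfloor>y powr (1/3)\<rfloor>"
  have y3: "y powr (1/3) = exp (lx / (96 * (real k)\<^sup>2))" by (simp add: powr_def y_def)
  have y3_2: "2 \<le> y powr (1/3)"
  proof -
    have "2 \<le> 1 + lx / (96 * (real k)\<^sup>2)" using lxk2 l_le l1680 by linarith
    also have "\<dots> \<le> exp (lx / (96 * (real k)\<^sup>2))" by (rule exp_ge_add_one_self)
    finally show ?thesis by (simp add: y3)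
  qed
  have M1: "1 \<le> M" and M_le: "real M \<le> y powr (1/3)" and M_ge: "y powr (1/3) / 2 \<le> real M"
    using y3_2 unfolding M_def by linarith+
  have M3: "real M ^ 3 \<le> y"
  proof -
    have "real M ^ 3 \<le> (y powr (1/3)) ^ 3" using M_le by (intro power_mono) auto
    also have "\<dots> = y" using y4 by (simp add: powr_powr flip: powr_realpow)
    finally show ?thesis .
  qed
  have bad: "z ^ k + x / real M \<le> 1 / \<alpha> * exp (- \<delta> * real k / 6) * N"
  proof -
    \<comment> \<open>\<open>Ex\<close> is made so that \<open>exp (lx - Ex)\<close> is at most
      \<open>exp (- k) * N / \<alpha>\<close>, by the lower bound for \<open>N\<close> and
      \<open>\<Lambda> \<ge> 1 / (k - 1)!\<close>. The trivially bounded moduli are fewer than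
      \<open>x\<close> by a factor of about \<open>exp (lx / (96 * k^2))\<close>, which far exceeds
      \<open>exp Ex\<close>.\<close>
    define Ex where "Ex = real k + ln (2 * lx) + real k * lk"
    have lk_le: "lk \<le> real k" using lkd dk by linarith
    have Ex_le: "Ex + 2 \<le> 100 * ((real k)\<^sup>2 * l)"
    proof -
      have "ln (2 * lx) \<le> 1 + l" using lx0 ln2_bounds by (simp add: ln_mult l_def lx_def)
      moreover have "real k * lk \<le> (real k)\<^sup>2" using lk_le kp by (simp add: power2_eq_square)
      moreover have "(real k)\<^sup>2 \<le> (real k)\<^sup>2 * l"
        using mult_left_mono[of 1 l "(real k)\<^sup>2"] l1680 by simp
      ultimately have "Ex + 2 \<le> 3 * ((real k)\<^sup>2 * l) + 3" using k23(3) l_le unfolding Ex_def by linarith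
      then show ?thesis using l_le l1680 by linarith
    qed
    have a: "z ^ k \<le> exp (lx - Ex) / 2"
    proof -
      have "lx / (96 * (real k)\<^sup>2) \<le> lx / 2"
      proof (intro divide_left_mono)
        show "2 \<le> 96 * (real k)\<^sup>2" using k23(4) by linarith
      qed (use lx0 kp in auto)
      then have "exp (lx / 2) \<le> exp (lx - Ex - ln 2)"
        using Ex_le lxk2 ln2_bounds by (subst exp_le_cancel_iff) linarith
      also have "\<dots> = exp (lx - Ex) / 2" by (simp add: exp_diff)
      finally show ?thesis by (simp add: zk)
    qed
    have b: "x / real M \<le> exp (lx - Ex) / 2"
    proof -
      have "x / real M \<le> x / (y powr (1/3) / 2)" using M_ge y3_2 x1 M1 y4 by (intro divide_left_mono mult_pos_pos) auto
      also have "\<dots> = exp (lx + ln 2 - lx / (96 * (real k)\<^sup>2))" by (simp add: y3 exp_diff exp_add ex)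
      also have "\<dots> \<le> exp (lx - Ex - ln 2)"
        using Ex_le lxk2 ln2_bounds by (subst exp_le_cancel_iff) linarith
      also have "\<dots> = exp (lx - Ex) / 2" by (simp add: exp_diff)
      finally show ?thesis .
    qed
    have "exp (lx - Ex) = x * exp (- real k) / (2 * lx * exp (real k * lk))"
      unfolding Ex_def using lx0 by (simp add: exp_diff exp_add ex exp_minus field_simps)
    also have "exp (real k * lk) = real k ^ k" using kp by (simp add: exp_of_nat_mult lk_def)
    also have "x * exp (- real k) / (2 * lx * real k ^ k) \<le> x * exp (- real k) / (2 * lx * fact k)"
    proof (intro divide_left_mono mult_left_mono)
      have "fact k \<le> k ^ k" using fact_le_power[of k, where ?'a = nat] by simp
      then have "real (fact k) \<le> real (k ^ k)" by (simp only: of_nat_le_iff)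
      then show "fact k \<le> real k ^ k" by simp
    qed (use lx0 x1 kp in auto)
    also have "\<dots> = exp (- real k) * (x * (1 / fact (k - 1))) / (2 * lx * real k)"
    proof -
      have "(fact k :: real) = real k * fact (k - 1)" using k by (intro fact_reduce) auto
      then show ?thesis by (simp add: mult_ac)
    qed
    also have "\<dots> \<le> exp (- real k) * (x * \<Lambda>) / (2 * lx * real k)"
      using \<Lambda>1 x1 lx0 kp by (intro divide_right_mono mult_left_mono) auto
    also have "\<dots> \<le> exp (- real k) * (2 * lx * real k * N / \<alpha>) / (2 * lx * real k)"
      using x\<Lambda> lx0 kp by (intro divide_right_mono mult_left_mono) auto
    also have "\<dots> = 1 / \<alpha> * exp (- real k) * N" using lx0 kp by simp
    also have "\<dots> \<le> 1 / \<alpha> * exp (- \<delta> * real k / 6) * N"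
      using dk \<alpha> by (intro mult_right_mono mult_left_mono) (auto simp: N_def)
    finally show ?thesis using a b by linarith
  qed
  have "(\<Sum>q\<in>Q_k_upto n A k x. cmod (weyl n A q h)) \<le> z ^ k + x / real M + 130 * real k / ln z * x * (\<Sum>i<k. F i * E (k - 1 - i))"
    unfolding F_def E_def L_def
    by (rule sum_weyl_le[where r = r]) (use k y4 yk rz r4 z0 yz x1 M1 M3 in auto)
  also have "\<dots> \<le> 3121 / \<alpha> * exp (- \<delta> * real k / 6) * N"
  proof -
    have "3121 / \<alpha> = 1 / \<alpha> + 3120 / \<alpha>" by (simp flip: add_divide_distrib)
    then have "3121 / \<alpha> * exp (- \<delta> * real k / 6) * N =
      1 / \<alpha> * exp (- \<delta> * real k / 6) * N + 3120 / \<alpha> * exp (- \<delta> * real k / 6) * N"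
      by (simp only: distrib_right)
    then show ?thesis using add_mono[OF bad main] by (simp only:)
  qed
  also have "\<dots> \<le> 3200 / \<alpha> * exp (- \<delta> * real k / 6) * N"
    using \<alpha> by (intro mult_right_mono divide_right_mono) (auto simp: N_def)
  finally show ?thesis unfolding N_def .
qed

section \<open>The average discrepancy\<close>

text \<open>Trades the power of \<open>ln H\<close> in the discrepancy bound for
  \<open>exp (X / 36)\<close>, where \<open>X = \<delta> k\<close>; the 36 is
  \<open>1 / (1/12 - 1/18)\<close>.\<close>

lemma linear_power_le_exp:
  assumes "1 \<le> (n::nat)" "0 \<le> X"
  shows "(9 + X / 3) ^ n \<le> (12 * real n + 9) ^ n * exp (X / 36)"
proof -
  have "9 + X / 3 \<le> (12 * real n + 9) * (1 + X / (36 * real n))"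
    using assms by (simp add: field_simps)
  also have "\<dots> \<le> (12 * real n + 9) * exp (X / (36 * real n))"
    by (intro mult_left_mono exp_ge_add_one_self) auto
  finally have "(9 + X / 3) ^ n \<le> ((12 * real n + 9) * exp (X / (36 * real n))) ^ n"
    using assms by (intro power_mono) auto
  also have "\<dots> = (12 * real n + 9) ^ n * exp (real n * (X / (36 * real n)))"
    by (simp only: power_mult_distrib exp_of_nat_mult)
  also have "real n * (X / (36 * real n)) = X / 36" using assms by simp
  finally show ?thesis .
qed

text \<open>Chebyshev's bound limits the density, so terms of the discrepancy that lack the factor
  \<open>1 / \<alpha>\<close> can be given one at the cost of a factor 3.\<close>

lemma density_le_3:
  assumes "2 \<le> x0" "\<And>t. x0 \<le> t \<Longrightarrow> \<alpha> * t \<le> (\<Sum>p | prime p \<and> real p \<le> t \<and> 1 \<le> rho n A p. ln (real p))"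
  shows "\<alpha> \<le> 3"
proof -
  define m where "m = nat \<lceil>x0\<rceil>"
  have m: "x0 \<le> real m" "0 < m" using assms(1) unfolding m_def by linarith+
  have "\<alpha> * real m \<le> (\<Sum>p | prime p \<and> real p \<le> real m \<and> 1 \<le> rho n A p. ln (real p))" by (rule assms(2)[OF m(1)])
  also have "\<dots> \<le> theta m" unfolding theta_def
    by (intro sum_mono2) (auto simp: Suc_le_eq prime_gt_0_nat)
  also have "\<dots> \<le> 3 * real m" by (rule theta_le3)
  finally show ?thesis using m by simp
qed

lemma average_disc_le:
  fixes \<alpha> \<delta> x x0 :: real and k n :: nat
  assumes n: "1 \<le> n" and \<alpha>: "0 < \<alpha>" and \<delta>: "0 < \<delta>" "\<delta> \<le> 1"
    and x0: "2 \<le> x0" "x0 + 1 \<le> x" and l: "100 * (1 + ln (ln (real (nat \<lceil>x0\<rceil>) + 1))) \<le> ln (ln x)" "x0 \<le> ln (ln x)"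
    and k1: "20 * (6 + real n) / \<delta> * ln (20 * (6 + real n) / \<delta>) \<le> real k"
    and k2: "real k \<le> exp (sqrt (\<alpha> * \<delta> * ln (ln x) / (20 * (6 + real n))))"
    and th: "\<And>t. x0 \<le> t \<Longrightarrow> \<alpha> * t \<le> (\<Sum>p | prime p \<and> real p \<le> t \<and> 1 \<le> rho n A p. ln (real p))"
    and dx: "\<delta> * ln (ln x) \<le> (\<Sum>p | prime p \<and> real p \<le> x \<and> p \<in> Q_set n A. (1 - real (lam n A p) / real (rho n A p)) * (1 / real p))"
  shows "1 / real (card (Q_k_upto n A k x)) * (\<Sum>q\<in>Q_k_upto n A k x. disc n (Delta n A q))
    \<le> (9 * real n * 3 ^ n + (6 * real n + 3200) * (12 * real n + 9) ^ n) / \<alpha> * exp (- \<delta> * real k / 18)"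
proof (cases "card (Q_k_upto n A k x) = 0")
  case True
  \<comment> \<open>With cardinality 0 the left side is 0, because \<open>1 / 0 = 0\<close>.\<close>
  then show ?thesis using \<alpha> by (simp only: of_nat_0 div_by_0 mult_zero_left) simp
next
  case False
  let ?Q = "Q_k_upto n A k x"
  define N where "N = real (card ?Q)"
  have N0: "0 < N" using False by (simp add: N_def)
  have finQ: "finite ?Q" using False by (rule contrapos_np) (rule card.infinite)
  have \<alpha>3: "\<alpha> \<le> 3" by (rule density_le_3[OF x0(1) th])
  have l0: "0 < ln (ln x)" using x0 l(2) by linarith
  note pb = parameter_bounds[OF n \<alpha> \<alpha>3 \<delta> l0 k1 k2]
  define X where "X = \<delta> * real k"
  have X: "0 \<le> X" "X \<le> real k" using \<delta> by (auto simp: X_def mult_left_le_one_le)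
  \<comment> \<open>\<open>\<eta>^2 * H\<close> is about 1, as \<open>disc_le\<close> requires. The
    Weyl averages save \<open>exp (- X / 6)\<close>, more than \<open>\<eta>\<close>, so the
    smoothing width decides the final exponent.\<close>
  define \<eta> where "\<eta> = exp (- X / 12)"
  have \<eta>: "0 < \<eta>" "\<eta> \<le> 1" using X by (auto simp: \<eta>_def)
  define H where "H = nat \<lceil>exp (X / 6)\<rceil>"
  have e1: "1 \<le> exp (X / 6)" using X by simp
  have Hge: "exp (X / 6) \<le> real H" unfolding H_def by (rule real_nat_ceiling_ge)
  have Hle: "real H \<le> 2 * exp (X / 6)" using e1 unfolding H_def by linarith
  have H1: "1 \<le> H" using Hge e1 by linarith
  have lnH: "ln (real H) \<le> X / 6 + 1"
  proof -
    have "ln (real H) \<le> ln (2 * exp (X / 6))" using Hle H1 by (subst ln_le_cancel_iff) auto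
    also have "\<dots> = ln 2 + X / 6" by (simp add: ln_mult)
    finally show ?thesis using ln2_bounds by linarith
  qed
  have \<eta>H: "1 \<le> \<eta>\<^sup>2 * real H"
  proof -
    have "1 = \<eta>\<^sup>2 * exp (X / 6)" by (simp add: \<eta>_def power2_eq_square flip: exp_add)
    also have "\<dots> \<le> \<eta>\<^sup>2 * real H" using Hge by (intro mult_left_mono) auto
    finally show ?thesis .
  qed
  define C1 where "C1 = (12 * real n + 9) ^ n"
  define Z where "Z = 7 + 2 * ln (real H)"
  have Z1: "1 \<le> Z" using H1 by (simp add: Z_def)
  have Zn: "Z ^ n \<le> C1 * exp (X / 36)"
  proof -
    have "Z ^ n \<le> (9 + X / 3) ^ n" using lnH Z1 unfolding Z_def by (intro power_mono) auto
    also have "\<dots> \<le> C1 * exp (X / 36)" unfolding C1_def by (rule linear_power_le_exp[OF n X(1)])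
    finally show ?thesis .
  qed
  have Zn1: "Z ^ (n - 1) \<le> C1 * exp (X / 36)"
    using Zn power_increasing[of "n - 1" n Z] Z1 by linarith
  let ?B = "PiE {..<n} (\<lambda>_. {- int H..int H}) - {zvec n}"
  let ?w = "\<lambda>h. \<Prod>i<n. beta \<eta> (h i)"
  have finB: "finite ?B" by (intro finite_Diff finite_PiE) auto
  have w0: "0 \<le> ?w h" for h using \<eta> by (intro prod_nonneg) (simp add: beta_nonneg)
  define R where "R = real n * 3 ^ n * (3 * exp (- X / 18)) + real n * Z ^ (n - 1) * (2 * \<eta>)"
  have ek: "k \<noteq> 0" using pb(1) by auto
  have disc_q: "disc n (Delta n A q) \<le> R + (\<Sum>h\<in>?B. ?w h * cmod (weyl n A q h))" if q: "q \<in> ?Q" for q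
  proof -
    have q0: "0 < q" "1 \<le> rho n A q" "card (prime_factors q) = k"
      using q by (auto simp: Q_k_upto_def Q_k_def Q_set_def)
    \<comment> \<open>Having \<open>k\<close> distinct prime factors, \<open>q\<close> is at least
      \<open>2 ^ k\<close>, which makes the term \<open>2 / q\<close> exponentially small in
      \<open>k\<close>.\<close>
    have "2 ^ k = (\<Prod>p\<in>prime_factors q. 2::nat)" using q0 by simp
    also have "\<dots> \<le> \<Prod>(prime_factors q)"
      by (intro prod_mono) (auto dest: in_prime_factors_imp_prime prime_ge_2_nat)
    also have "\<dots> dvd q" by (rule prod_primes_dvd) auto
    then have "\<Prod>(prime_factors q) \<le> q" using q0 by (intro dvd_imp_le) auto
    finally have q2k: "2 ^ k \<le> q" .
    have "(2::nat) ^ 1 \<le> 2 ^ k" using ek by (intro power_increasing) auto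
    then have q2: "2 \<le> q" using q2k by simp
    have "2 / real q \<le> 2 * exp (- X / 18)"
    proof -
      have "exp (X / 18) \<le> exp (real k * ln 2)"
      proof (subst exp_le_cancel_iff)
        have "real k * (1 / 2) \<le> real k * ln 2" using ln2_bounds by (intro mult_left_mono) auto
        then show "X / 18 \<le> real k * ln 2" using X by linarith
      qed
      also have "\<dots> = 2 ^ k" by (simp add: exp_of_nat_mult)
      also have "\<dots> \<le> real q"
      proof -
        have "real (2 ^ k) \<le> real q" using q2k by (simp only: of_nat_le_iff)
        then show ?thesis by simp
      qed
      finally have "2 / real q \<le> 2 / exp (X / 18)" by (intro divide_left_mono) (use q0 in auto)
      moreover have "exp (- X / 18) = 1 / exp (X / 18)" using exp_minus[of "X / 18"] by (simp add: inverse_eq_divide)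
      ultimately show ?thesis by simp
    qed
    moreover have "\<eta> \<le> exp (- X / 18)" unfolding \<eta>_def using X by simp
    ultimately have "\<eta> + 2 / real q \<le> 3 * exp (- X / 18)" by linarith
    then have "real n * 3 ^ n * (\<eta> + 2 / real q) \<le> real n * 3 ^ n * (3 * exp (- X / 18))"
      by (intro mult_left_mono) auto
    moreover have "disc n (Delta n A q) \<le> real n * 3 ^ n * (\<eta> + 2 / real q)
      + real n * (7 + 2 * ln (real H)) ^ (n - 1) * (2 * \<eta>) + (\<Sum>h\<in>?B. ?w h * cmod (weyl n A q h))"
      by (rule disc_le[OF n q2 q0(2) H1 \<eta> \<eta>H])
    ultimately show ?thesis unfolding R_def Z_def by linarith
  qed
  have weyl_h: "(\<Sum>q\<in>?Q. cmod (weyl n A q h)) \<le> 3200 / \<alpha> * exp (- X / 6) * N" if h: "h \<in> ?B" for h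
  proof -
    have "\<exists>i<n. h i \<noteq> 0"
    proof (rule ccontr)
      assume "\<not> (\<exists>i<n. h i \<noteq> 0)"
      then have h0: "h i = 0" if "i < n" for i using that by blast
      have "h \<in> extensional {..<n}" using DiffD1[OF h] by (simp only: PiE_iff)
      moreover have "zvec n \<in> extensional {..<n}" by (simp add: zvec_def)
      moreover have "h i = zvec n i" if "i \<in> {..<n}" for i using h0[of i] that by (simp add: zvec_def)
      ultimately have "h = zvec n" by (rule extensionalityI)
      then show False using DiffD2[OF h] by simp
    qed
    then obtain i where i: "i < n" "h i \<noteq> 0" by auto
    have hi: "\<bar>h i\<bar> \<le> int H"
    proof -
      have "h \<in> PiE {..<n} (\<lambda>_. {- int H..int H})" using h by (rule DiffD1)
      then have "h i \<in> {- int H..int H}" by (rule PiE_mem) (use i in simp)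
      then show ?thesis by auto
    qed
    have "(\<Sum>q\<in>?Q. cmod (weyl n A q h)) \<le> 3200 / \<alpha> * exp (- \<delta> * real k / 6) * real (card ?Q)"
      by (rule sum_weyl_average_le[where x = x and H = H and n = n and A = A and h = h and \<alpha> = \<alpha> and \<delta> = \<delta> and k = k, OF n \<alpha> \<alpha>3 \<delta> x0 l k1 k2 th dx i hi lnH[unfolded X_def]])
    then show ?thesis by (simp add: X_def N_def)
  qed
  have sumw: "(\<Sum>h\<in>?B. ?w h) \<le> Z ^ n"
  proof -
    have "(\<Sum>h\<in>?B. ?w h) \<le> (\<Sum>h\<in>PiE {..<n} (\<lambda>_. {- int H..int H}). ?w h)"
      using w0 by (intro sum_mono2 finite_PiE) auto
    also have "\<dots> = (\<Prod>i<n. \<Sum>h\<in>{- int H..int H}. beta \<eta> h)" by (rule prod_sum_PiE[symmetric]) auto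
    also have "\<dots> = (\<Sum>h\<in>{- int H..int H}. beta \<eta> h) ^ n" by simp
    also have "\<dots> \<le> Z ^ n"
    proof (rule power_mono)
      show "(\<Sum>h\<in>{- int H..int H}. beta \<eta> h) \<le> Z" using sum_beta_box[OF H1 \<eta>(1)] by (simp add: Z_def)
      show "0 \<le> (\<Sum>h\<in>{- int H..int H}. beta \<eta> h)" using \<eta> by (intro sum_nonneg) (simp add: beta_nonneg)
    qed
    finally show ?thesis .
  qed
  have "(\<Sum>q\<in>?Q. disc n (Delta n A q)) \<le> (\<Sum>q\<in>?Q. R + (\<Sum>h\<in>?B. ?w h * cmod (weyl n A q h)))"
    by (intro sum_mono disc_q)
  also have "\<dots> = N * R + (\<Sum>q\<in>?Q. \<Sum>h\<in>?B. ?w h * cmod (weyl n A q h))" by (simp add: sum.distrib N_def)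
  also have "(\<Sum>q\<in>?Q. \<Sum>h\<in>?B. ?w h * cmod (weyl n A q h)) = (\<Sum>h\<in>?B. \<Sum>q\<in>?Q. ?w h * cmod (weyl n A q h))" by (rule sum.swap)
  also have "\<dots> = (\<Sum>h\<in>?B. ?w h * (\<Sum>q\<in>?Q. cmod (weyl n A q h)))" by (simp only: sum_distrib_left)
  also have "\<dots> \<le> (\<Sum>h\<in>?B. ?w h * (3200 / \<alpha> * exp (- X / 6) * N))"
    by (intro sum_mono mult_left_mono weyl_h w0)
  also have "\<dots> = (\<Sum>h\<in>?B. ?w h) * (3200 / \<alpha> * exp (- X / 6) * N)" by (simp only: sum_distrib_right)
  also have "\<dots> \<le> (C1 * exp (X / 36)) * (3200 / \<alpha> * exp (- X / 6) * N)"
    using sumw Zn \<alpha> N0 by (intro mult_right_mono) auto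
  finally have "1 / N * (\<Sum>q\<in>?Q. disc n (Delta n A q)) \<le> R + (C1 * exp (X / 36)) * (3200 / \<alpha> * exp (- X / 6))"
    using N0 by (simp add: field_simps)
  also have "\<dots> \<le> (9 * real n * 3 ^ n + (6 * real n + 3200) * C1) / \<alpha> * exp (- X / 18)"
  proof -
    define ee where "ee = exp (- X / 18)"
    have C10: "0 \<le> C1" by (simp add: C1_def)
    have ee0: "0 \<le> ee" by (simp add: ee_def)
    have a: "exp (X / 36) * \<eta> = ee" unfolding \<eta>_def ee_def by (simp flip: exp_add)
    have "exp (X / 36) * exp (- X / 6) = exp (X / 36 + - X / 6)" by (rule exp_add[symmetric])
    also have "\<dots> \<le> ee" unfolding ee_def using X by (subst exp_le_cancel_iff) linarith
    finally have b: "exp (X / 36) * exp (- X / 6) \<le> ee" .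
    have "real n * Z ^ (n - 1) * (2 * \<eta>) \<le> real n * (C1 * exp (X / 36)) * (2 * \<eta>)"
      using Zn1 \<eta> by (intro mult_right_mono mult_left_mono) auto
    also have "\<dots> = 2 * real n * C1 * ee" using a by (simp add: mult_ac)
    finally have R: "R \<le> (3 * real n * 3 ^ n + 2 * real n * C1) * ee" unfolding R_def ee_def by (simp add: algebra_simps)
    also have "\<dots> \<le> (3 * real n * 3 ^ n + 2 * real n * C1) * ee * (3 / \<alpha>)"
    proof -
      have "1 \<le> 3 / \<alpha>" using \<alpha> \<alpha>3 by simp
      then show ?thesis using C10 ee0
        by (intro mult_left_mono[of 1 "3 / \<alpha>", simplified mult_1_right] mult_nonneg_nonneg add_nonneg_nonneg) auto
    qed
    finally have R': "R \<le> (9 * real n * 3 ^ n + 6 * real n * C1) / \<alpha> * ee" by (simp add: field_simps)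
    have "(C1 * exp (X / 36)) * (3200 / \<alpha> * exp (- X / 6)) = 3200 * C1 / \<alpha> * (exp (X / 36) * exp (- X / 6))" by simp
    also have "\<dots> \<le> 3200 * C1 / \<alpha> * ee" using b C10 \<alpha> by (intro mult_left_mono) auto
    finally have "R + (C1 * exp (X / 36)) * (3200 / \<alpha> * exp (- X / 6)) \<le> (9 * real n * 3 ^ n + 6 * real n * C1) / \<alpha> * ee + 3200 * C1 / \<alpha> * ee"
      using R' by linarith
    also have "\<dots> = (9 * real n * 3 ^ n + (6 * real n + 3200) * C1) / \<alpha> * ee"
      by (simp add: algebra_simps add_divide_distrib)
    finally show ?thesis unfolding ee_def .
  qed
  finally show ?thesis by (simp add: N_def X_def C1_def)
qed

theorem theorem1p3:
  "\<exists>(C :: nat \<Rightarrow> real) (X :: real \<Rightarrow> real \<Rightarrow> real).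
     \<forall>(n::nat) (A :: nat \<Rightarrow> (nat \<Rightarrow> nat) set) (\<alpha>::real) (x0::real) (x::real) (\<delta>::real) (k::nat).
       1 \<le> n \<longrightarrow>
       prime_power_family n A \<longrightarrow>
       0 < \<alpha> \<longrightarrow> 2 \<le> x0 \<longrightarrow>
       (\<forall>y\<ge>x0. \<alpha> * y \<le> (\<Sum>p | prime p \<and> real p \<le> y \<and> 1 \<le> rho n A p. ln (real p))) \<longrightarrow>
       X x0 \<alpha> \<le> x \<longrightarrow>
       0 < \<delta> \<longrightarrow> \<delta> \<le> 1 \<longrightarrow>
       \<delta> * ln (ln x) \<le>
         (\<Sum>p | prime p \<and> real p \<le> x \<and> p \<in> Q_set n A.
            (1 - real (lam n A p) / real (rho n A p)) * (1 / real p)) \<longrightarrow>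
       20 * (6 + real n) / \<delta> * ln (20 * (6 + real n) / \<delta>) \<le> real k \<longrightarrow>
       real k \<le> exp (sqrt (\<alpha> * \<delta> * ln (ln x) / (20 * (6 + real n)))) \<longrightarrow>
       1 / real (card (Q_k_upto n A k x)) *
           (\<Sum>q\<in>Q_k_upto n A k x. disc n (Delta n A q))
         \<le> C n * (1 / \<alpha> * (exp (- \<delta> * real k / 18) + ln x powr (- \<alpha> * \<delta> / 18)))"
proof -
  define C where "C = (\<lambda>n::nat. 9 * real n * 3 ^ n + (6 * real n + 3200) * (12 * real n + 9) ^ n)"
  \<comment> \<open>Doubly exponential, since \<open>average_disc_le\<close> compares quantities
    depending on \<open>x0\<close> with \<open>ln (ln x)\<close>.\<close>
  define X where "X = (\<lambda>(x0::real) (\<alpha>::real). exp (exp (100 * (1 + ln (ln (real (nat \<lceil>x0\<rceil>) + 1))) + x0 + 1)))"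
  show ?thesis
  proof (rule exI[of _ C], rule exI[of _ X], intro allI impI)
    fix n :: nat and A :: "nat \<Rightarrow> (nat \<Rightarrow> nat) set" and \<alpha> x0 x \<delta> :: real and k :: nat
    assume n: "1 \<le> n" and "prime_power_family n A" and \<alpha>: "0 < \<alpha>" and x0: "2 \<le> x0"
      and th: "\<forall>y\<ge>x0. \<alpha> * y \<le> (\<Sum>p | prime p \<and> real p \<le> y \<and> 1 \<le> rho n A p. ln (real p))"
      and xX: "X x0 \<alpha> \<le> x" and \<delta>: "0 < \<delta>" "\<delta> \<le> 1"
      and dx: "\<delta> * ln (ln x) \<le> (\<Sum>p | prime p \<and> real p \<le> x \<and> p \<in> Q_set n A. (1 - real (lam n A p) / real (rho n A p)) * (1 / real p))"
      and k1: "20 * (6 + real n) / \<delta> * ln (20 * (6 + real n) / \<delta>) \<le> real k"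
      and k2: "real k \<le> exp (sqrt (\<alpha> * \<delta> * ln (ln x) / (20 * (6 + real n))))"
    define c where "c = 100 * (1 + ln (ln (real (nat \<lceil>x0\<rceil>) + 1)))"
    \<comment> \<open>From \<open>x0 \<ge> 2\<close> follows
      \<open>\<lceil>x0\<rceil> + 1 \<ge> 3 \<ge> exp 1\<close>, so the iterated logarithm is
      nonnegative.\<close>
    have c0: "0 \<le> c"
    proof -
      have "3 \<le> real (nat \<lceil>x0\<rceil>) + 1" using x0 by linarith
      then have "exp 1 \<le> real (nat \<lceil>x0\<rceil>) + 1" using exp_le by linarith
      then have "ln (exp 1) \<le> ln (real (nat \<lceil>x0\<rceil>) + 1)" by (subst ln_le_cancel_iff) auto
      then show ?thesis unfolding c_def by simp
    qed
    have xe: "exp (exp (c + x0 + 1)) \<le> x" using xX by (simp add: X_def c_def)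
    have "c + x0 + 1 + 1 \<le> exp (c + x0 + 1)" "exp (c + x0 + 1) + 1 \<le> exp (exp (c + x0 + 1))"
      using exp_ge_add_one_self[of "c + x0 + 1"] exp_ge_add_one_self[of "exp (c + x0 + 1)"] by linarith+
    then have xx: "x0 + 1 \<le> x" using xe c0 by linarith
    have "ln (exp (exp (c + x0 + 1))) \<le> ln x" using xe xx x0 by (subst ln_le_cancel_iff) auto
    then have "exp (c + x0 + 1) \<le> ln x" by simp
    then have "ln (exp (c + x0 + 1)) \<le> ln (ln x)"
      using exp_gt_zero[of "c + x0 + 1"] by (subst ln_le_cancel_iff) linarith+
    then have ll: "c + x0 + 1 \<le> ln (ln x)" by simp
    have "1 / real (card (Q_k_upto n A k x)) * (\<Sum>q\<in>Q_k_upto n A k x. disc n (Delta n A q))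
      \<le> C n / \<alpha> * exp (- \<delta> * real k / 18)"
      unfolding C_def
      by (rule average_disc_le[OF n \<alpha> \<delta> x0 xx _ _ k1 k2 _ dx]) (use ll c0 x0 th in \<open>auto simp: c_def\<close>)
    also have "\<dots> = C n * (1 / \<alpha> * exp (- \<delta> * real k / 18))" by simp
    also have "\<dots> \<le> C n * (1 / \<alpha> * (exp (- \<delta> * real k / 18) + ln x powr (- \<alpha> * \<delta> / 18)))"
      using \<alpha> by (intro mult_left_mono) (auto simp: C_def)
    finally show "1 / real (card (Q_k_upto n A k x)) * (\<Sum>q\<in>Q_k_upto n A k x. disc n (Delta n A q))
      \<le> C n * (1 / \<alpha> * (exp (- \<delta> * real k / 18) + ln x powr (- \<alpha> * \<delta> / 18)))" .
  qed
qed

end
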